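(* Let $G$ be a finite group. Suppose that for some chargeon $C$ and fluxion $F$ of $\mathcal{Z}(G)$ with $C\neq F$, the permutation matrix $P$ of the transposition $(C,F)$ of simple objects is a modular invariant for $\mathcal{Z}(G)$. Then $G\simeq \mathbf{H}^{+}\rtimes\mathbf{H}^{\times}$ for some (finite) near-field $\mathbf{H}$. Conversely, for every finite near-field $\mathbf{H}$, the group $G=\mathbf{H}^{+}\rtimes\mathbf{H}^{\times}$ has a chargeon $C$ and a fluxion $F\neq C$ in $\mathcal{Z}(G)$ such that the permutation matrix of the transposition $(C,F)$ is a modular invariant for $\mathcal{Z}(G)$.
   Context: For a finite group $G$, $\mathcal{Z}(G)$ is the modular tensor category of finite-dimensional complex representations of the Drinfeld double $D(G)$. Its simple objects are indexed, up to isomorphism, by pairs $(\overline{a},\pi)$, where $\overline{a}$ is a conjugacy class of $G$ with chosen representative $a$ and $\pi$ is an irreducible complex representation of the centralizer $Z(a)=\{h\in G: ha=ah\}$. A simple object $(\overline a,\pi)$ is a chargeon if $a=e$ and a fluxion if $\pi$ is the trivial representation; $\mathbf{0}=(\overline e,\mathbf 1)$ is the trivial object. The $S$-matrix, indexed by simple objects, is $S_{(\overline{a},\pi)(\overline{a'},\pi')}=\frac{1}{|Z(a)|\,|Z(a')|}\sum_{h\in G:\ ha'h^{-1}\in Z(a)}\mathrm{tr}_{\pi}(ha'^{-1}h^{-1})\,\mathrm{tr}_{\pi'}(h^{-1}a^{-1}h)$, and the $T$-matrix is diagonal with $T_{(\overline{a},\pi)(\overline a,\pi)}=\mathrm{tr}_{\pi}(a)/\mathrm{tr}_{\pi}(e)$,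 where $\mathrm{tr}_\pi$ denotes the character. A modular invariant is a matrix $M$ indexed by simple objects, with non-negative integer entries and $M_{\mathbf{0}\mathbf{0}}=1$, that commutes with both $S$ and $T$. A near-field is a set $\mathbf{H}$ with binary operations $+$ and $\times$ such that $(\mathbf{H},+)$ is an abelian group with identity $0$; $0\times x=x\times 0=0$ for all $x$; $(\mathbf{H}\setminus\{0\},\times)$ is a group with identity $1$; and $x\times(y+z)=x\times y+x\times z$ for all $x,y,z$ (right distributivity is not assumed). $\mathbf{H}^{+}\rtimes\mathbf{H}^{\times}$ is the group of pairs $(a,\alpha)$ with $a\in\mathbf{H}$, $\alpha\in\mathbf{H}\setminus\{0\}$, and multiplication $(a,\alpha)(b,\beta)=(a+\alpha\times b,\alpha\times\beta)$. *)

theory Defs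
  imports "HOL-Algebra.Algebra" "Jordan_Normal_Form.Matrix"
begin

definition mat_tr :: "complex mat \<Rightarrow> complex" where
  "mat_tr A = (\<Sum>i<dim_row A. A $$ (i, i))"

definition is_rep :: "('g, 'b) monoid_scheme \<Rightarrow> 'g set \<Rightarrow> nat \<Rightarrow> ('g \<Rightarrow> complex mat) \<Rightarrow> bool" where
  "is_rep G Hs n \<rho> \<longleftrightarrow>
     (\<forall>h\<in>Hs. \<rho> h \<in> carrier_mat n n) \<and>
     \<rho> \<one>\<^bsub>G\<^esub> = 1\<^sub>m n \<and>
     (\<forall>g\<in>Hs. \<forall>h\<in>Hs. \<rho> (g \<otimes>\<^bsub>G\<^esub> h) = \<rho> g * \<rho> h)"

definition invariant_subspace :: "'g set \<Rightarrow> nat \<Rightarrow> ('g \<Rightarrow> complex mat) \<Rightarrow> complex vec set \<Rightarrow> bool" where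
  "invariant_subspace Hs n \<rho> W \<longleftrightarrow>
     W \<subseteq> carrier_vec n \<and> 0\<^sub>v n \<in> W \<and>
     (\<forall>v\<in>W. \<forall>w\<in>W. v + w \<in> W) \<and>
     (\<forall>c. \<forall>v\<in>W. c \<cdot>\<^sub>v v \<in> W) \<and>
     (\<forall>h\<in>Hs. \<forall>v\<in>W. \<rho> h *\<^sub>v v \<in> W)"

definition is_irrep :: "('g, 'b) monoid_scheme \<Rightarrow> 'g set \<Rightarrow> nat \<Rightarrow> ('g \<Rightarrow> complex mat) \<Rightarrow> bool" where
  "is_irrep G Hs n \<rho> \<longleftrightarrow> is_rep G Hs n \<rho> \<and> n > 0 \<and>
     (\<forall>W. invariant_subspace Hs n \<rho> W \<longrightarrow> W = {0\<^sub>v n} \<or> W = carrier_vec n)"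

text \<open>Characters of irreducible representations (extended by 0 outside Hs); these are in
  bijection with isomorphism classes of irreducible representations.\<close>
definition irr_chars :: "('g, 'b) monoid_scheme \<Rightarrow> 'g set \<Rightarrow> ('g \<Rightarrow> complex) set" where
  "irr_chars G Hs = {(\<lambda>h. if h \<in> Hs then mat_tr (\<rho> h) else 0) | n \<rho>. is_irrep G Hs n \<rho>}"

definition triv_char :: "'g set \<Rightarrow> 'g \<Rightarrow> complex" where
  "triv_char Hs = (\<lambda>h. if h \<in> Hs then 1 else 0)"

definition centr :: "('g, 'b) monoid_scheme \<Rightarrow> 'g \<Rightarrow> 'g set" where
  "centr G a = {h \<in> carrier G. h \<otimes>\<^bsub>G\<^esub> a = a \<otimes>\<^bsub>G\<^esub> h}"

definition conj_class :: "('g, 'b) monoid_scheme \<Rightarrow> 'g \<Rightarrow> 'g set" where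
  "conj_class G a = {g \<otimes>\<^bsub>G\<^esub> a \<otimes>\<^bsub>G\<^esub> inv\<^bsub>G\<^esub> g | g. g \<in> carrier G}"

definition class_reps :: "('g, 'b) monoid_scheme \<Rightarrow> 'g set" where
  "class_reps G = (\<lambda>c. SOME a. a \<in> c) ` {conj_class G a | a. a \<in> carrier G}"

definition simples :: "('g, 'b) monoid_scheme \<Rightarrow> ('g \<times> ('g \<Rightarrow> complex)) set" where
  "simples G = {(a, \<chi>) | a \<chi>. a \<in> class_reps G \<and> \<chi> \<in> irr_chars G (centr G a)}"

definition zero_obj :: "('g, 'b) monoid_scheme \<Rightarrow> 'g \<times> ('g \<Rightarrow> complex)" where
  "zero_obj G = (\<one>\<^bsub>G\<^esub>, triv_char (carrier G))"

definition is_chargeon :: "('g, 'b) monoid_scheme \<Rightarrow> 'g \<times> ('g \<Rightarrow> complex) \<Rightarrow> bool" where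
  "is_chargeon G Ob \<longleftrightarrow> Ob \<in> simples G \<and> fst Ob = one G"

definition is_fluxion :: "('g, 'b) monoid_scheme \<Rightarrow> 'g \<times> ('g \<Rightarrow> complex) \<Rightarrow> bool" where
  "is_fluxion G Ob \<longleftrightarrow> Ob \<in> simples G \<and> snd Ob = triv_char (centr G (fst Ob))"

definition S_mat :: "('g, 'b) monoid_scheme \<Rightarrow> 'g \<times> ('g \<Rightarrow> complex) \<Rightarrow> 'g \<times> ('g \<Rightarrow> complex) \<Rightarrow> complex" where
  "S_mat G Ob Ob2 = (case Ob of (a, \<chi>) \<Rightarrow> case Ob2 of (a', \<chi>') \<Rightarrow>
     (1 / (of_nat (card (centr G a)) * of_nat (card (centr G a')))) *
     (\<Sum>h \<in> {h \<in> carrier G. h \<otimes>\<^bsub>G\<^esub> a' \<otimes>\<^bsub>G\<^esub> inv\<^bsub>G\<^esub> h \<in> centr G a}.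
        \<chi> (h \<otimes>\<^bsub>G\<^esub> inv\<^bsub>G\<^esub> a' \<otimes>\<^bsub>G\<^esub> inv\<^bsub>G\<^esub> h) *
        \<chi>' (inv\<^bsub>G\<^esub> h \<otimes>\<^bsub>G\<^esub> inv\<^bsub>G\<^esub> a \<otimes>\<^bsub>G\<^esub> h)))"

definition T_mat :: "('g, 'b) monoid_scheme \<Rightarrow> 'g \<times> ('g \<Rightarrow> complex) \<Rightarrow> 'g \<times> ('g \<Rightarrow> complex) \<Rightarrow> complex" where
  "T_mat G Ob Ob2 = (if Ob = Ob2 then (case Ob of (a, \<chi>) \<Rightarrow> \<chi> a / \<chi> \<one>\<^bsub>G\<^esub>) else 0)"

definition commutes_on :: "'o set \<Rightarrow> ('o \<Rightarrow> 'o \<Rightarrow> complex) \<Rightarrow> ('o \<Rightarrow> 'o \<Rightarrow> complex) \<Rightarrow> bool" where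
  "commutes_on I A B \<longleftrightarrow>
     (\<forall>x\<in>I. \<forall>y\<in>I. (\<Sum>z\<in>I. A x z * B z y) = (\<Sum>z\<in>I. B x z * A z y))"

definition modular_invariant ::
  "('g, 'b) monoid_scheme \<Rightarrow> ('g \<times> ('g \<Rightarrow> complex) \<Rightarrow> 'g \<times> ('g \<Rightarrow> complex) \<Rightarrow> nat) \<Rightarrow> bool" where
  "modular_invariant G M \<longleftrightarrow>
     M (zero_obj G) (zero_obj G) = 1 \<and>
     commutes_on (simples G) (\<lambda>x y. of_nat (M x y)) (S_mat G) \<and>
     commutes_on (simples G) (\<lambda>x y. of_nat (M x y)) (T_mat G)"

definition transp_perm_mat :: "'o \<Rightarrow> 'o \<Rightarrow> 'o \<Rightarrow> 'o \<Rightarrow> nat" where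
  "transp_perm_mat C F x y =
     (if x = (if y = C then F else if y = F then C else y) then 1 else 0)"

definition near_field :: "('a, 'b) ring_scheme \<Rightarrow> bool" where
  "near_field R \<longleftrightarrow>
     abelian_group R \<and>
     (\<forall>x\<in>carrier R. \<forall>y\<in>carrier R. x \<otimes>\<^bsub>R\<^esub> y \<in> carrier R) \<and>
     (\<forall>x\<in>carrier R. \<zero>\<^bsub>R\<^esub> \<otimes>\<^bsub>R\<^esub> x = \<zero>\<^bsub>R\<^esub> \<and> x \<otimes>\<^bsub>R\<^esub> \<zero>\<^bsub>R\<^esub> = \<zero>\<^bsub>R\<^esub>) \<and>
     group \<lparr>carrier = carrier R - {\<zero>\<^bsub>R\<^esub>}, monoid.mult = monoid.mult R, one = \<one>\<^bsub>R\<^esub>\<rparr> \<and>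
     (\<forall>x\<in>carrier R. \<forall>y\<in>carrier R. \<forall>z\<in>carrier R.
        x \<otimes>\<^bsub>R\<^esub> (y \<oplus>\<^bsub>R\<^esub> z) = x \<otimes>\<^bsub>R\<^esub> y \<oplus>\<^bsub>R\<^esub> x \<otimes>\<^bsub>R\<^esub> z)"

definition nf_group :: "('a, 'b) ring_scheme \<Rightarrow> ('a \<times> 'a) monoid" where
  "nf_group R = \<lparr>carrier = carrier R \<times> (carrier R - {\<zero>\<^bsub>R\<^esub>}),
     monoid.mult = (\<lambda>p q. (fst p \<oplus>\<^bsub>R\<^esub> (snd p \<otimes>\<^bsub>R\<^esub> fst q), snd p \<otimes>\<^bsub>R\<^esub> snd q)),
     one = (\<zero>\<^bsub>R\<^esub>, \<one>\<^bsub>R\<^esub>)\<rparr>"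

end

theory Submission
  imports Defs "Jordan_Normal_Form.Char_Poly" "HOL-Combinatorics.Transposition"
begin

text \<open>Commuting with S forces the S-matrix rows of C = (1, \<chi>) and F = (a, 1) to agree outside
  the two columns C and F. Let d = \<chi>(1) and Z = Z(a).

  The column of the trivial object gives |G| = d |Z|, and the columns of the other chargeons
  (1, \<psi>) give \<psi>(a) = \<psi>(1); column orthogonality on G then yields
  \<chi>(a^-1) = d - |Z|. Comparing the entries CC and FF shows that the conjugacy class of a lies
  in Z, and weighting the columns (a, \<psi>) by \<psi>(1) and summing them with column orthogonality
  on Z yields |Z| = d + 1. Hence Z consists of 1 and the class of a. It is therefore an abelian normal
  subgroup whose order is coprime to its index d, and it has a complement L, which acts regularly by
  conjugation on the nontrivial elements of Z. Identifying l in L with l a l^-1 makes Z a near-field.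

  Conversely, the affine action of the group of a near-field on the near-field is doubly
  transitive, so its permutation character is 1 + \<chi> with \<chi> irreducible. For this \<chi> and
  a nonzero translation a, row orthogonality verifies the equalities of S-matrix entries.\<close>

section \<open>Linear algebra\<close>

text \<open>The groups to be found are the finite sharply doubly transitive ones: Z acts on itself
  by translation and L acts on Z by conjugation, and near-fields coordinatize such actions.
  Conjugation respects the product of Z, and this is the one distributive law that a near-field has.

  The numbers come from comparing two rows of different nature. In the row of a chargeon each entry
  is the single product \<open>\<chi> (inv b) * \<psi> \<one>\<close> divided by |Z(b)|, while in
  the row of a fluxion it is a sum of values of \<psi> over conjugates of a^-1. The latter is hard
  to evaluate for one \<psi>. Weighted by \<psi>(1) and added over all \<psi> it is known, because
  the regular character vanishes away from 1. So the column relation against the identity carries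
  the forward direction, whereas the converse evaluates the same sums for each \<psi> separately,
  averaging over a single conjugacy class.

  The smallest instance is the group of order 2, with d = 1: the sign character as a chargeon is
  exchanged with the nontrivial flux.\<close>

lemma subspace_mult_vec:
  fixes P :: "complex mat"
  assumes P: "P \<in> carrier_mat n n" and x: "x \<in> carrier_vec n"
    and W: "0\<^sub>v n \<in> W" "\<And>v w. v \<in> W \<Longrightarrow> w \<in> W \<Longrightarrow> v + w \<in> W" "\<And>c v. v \<in> W \<Longrightarrow> c \<cdot>\<^sub>v v \<in> W"
    and cols: "\<And>j. j < n \<Longrightarrow> col P j \<in> W"
  shows "P *\<^sub>v x \<in> W"
proof -
  have "m \<le> n \<Longrightarrow> vec n (\<lambda>r. \<Sum>l<m. P $$ (r, l) * x $ l) \<in> W" for m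
  proof (induction m)
    case 0
    have "vec n (\<lambda>r. 0) = 0\<^sub>v n" by auto
    then have "vec n (\<lambda>r. 0) \<in> W" using W(1) by metis
    then show ?case by simp
  next
    case (Suc m)
    have "vec n (\<lambda>r. \<Sum>l<Suc m. P $$ (r, l) * x $ l)
        = vec n (\<lambda>r. \<Sum>l<m. P $$ (r, l) * x $ l) + x $ m \<cdot>\<^sub>v col P m"
      using Suc.prems P by (intro eq_vecI) (auto simp: mult.commute)
    then show ?case using Suc cols[of m] W by simp
  qed
  from this[of n] have "vec n (\<lambda>r. \<Sum>l<n. P $$ (r, l) * x $ l) \<in> W" by simp
  moreover have "P *\<^sub>v x = vec n (\<lambda>r. \<Sum>l<n. P $$ (r, l) * x $ l)"
    using P x by (intro eq_vecI) (auto simp: scalar_prod_def lessThan_atLeast0)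
  ultimately show ?thesis by simp
qed

lemma mat_mult_index_sum:
  assumes "A \<in> carrier_mat n m" "B \<in> carrier_mat m k" "i < n" "j < k"
  shows "(A * B) $$ (i, j) = (\<Sum>l<m. A $$ (i, l) * B $$ (l, j))"
  using assms by (auto simp: scalar_prod_def lessThan_atLeast0)

lemma mult_unit_vec_col:
  fixes P :: "'a :: semiring_1 mat"
  assumes "P \<in> carrier_mat n m" "j < m"
  shows "P *\<^sub>v unit_vec m j = col P j"
  using assms by (intro eq_vecI) (auto simp: scalar_prod_right_unit)

text \<open>Right multiplication by E replaces column j of a matrix P by P u and keeps the others,
  which is the exchange step for bases. Writing down the inverse F shows that a nonzero coordinate
  \<open>u $ j\<close> is all that the exchange asks for.\<close>

lemma column_replacement_inverse:
  fixes u :: "complex vec"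
  assumes "j < n" "u $ j \<noteq> 0"
  defines "E \<equiv> mat n n (\<lambda>(r, c). if c = j then u $ r else if r = c then 1 else 0)"
    and "F \<equiv> mat n n (\<lambda>(r, c). if c = j then (if r = j then 1 / u $ j else - u $ r / u $ j)
      else if r = c then 1 else 0)"
  shows "E * F = 1\<^sub>m n" "F * E = 1\<^sub>m n"
proof -
  have EF: "E \<in> carrier_mat n n" "F \<in> carrier_mat n n" by (auto simp: E_def F_def)
  show 1: "E * F = 1\<^sub>m n"
  proof (intro eq_matI)
    fix r c assume rc: "r < dim_row (1\<^sub>m n)" "c < dim_col (1\<^sub>m n)"
    then have rc': "r < n" "c < n" by auto
    have "(E * F) $$ (r, c) = (\<Sum>l<n. E $$ (r, l) * F $$ (l, c))"
      by (rule mat_mult_index_sum[OF EF rc'])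
    also have "\<dots> = (\<Sum>l\<in>{j}. E $$ (r, l) * F $$ (l, c)) + (\<Sum>l\<in>{..<n} - {j}. E $$ (r, l) * F $$ (l, c))"
      using assms(1) by (subst sum.subset_diff[of "{j}"]) (auto simp: add.commute)
    also have "(\<Sum>l\<in>{..<n} - {j}. E $$ (r, l) * F $$ (l, c))
      = (\<Sum>l\<in>{..<n} - {j}. if l = r then F $$ (r, c) else 0)"
      using rc' by (intro sum.cong) (auto simp: E_def)
    also have "\<dots> = (if r = j then 0 else F $$ (r, c))"
      using rc' by (auto simp: sum.delta')
    also have "(\<Sum>l\<in>{j}. E $$ (r, l) * F $$ (l, c)) + (if r = j then 0 else F $$ (r, c)) = 1\<^sub>m n $$ (r, c)"
      using rc' assms(1,2) by (auto simp: E_def F_def)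
    finally show "(E * F) $$ (r, c) = 1\<^sub>m n $$ (r, c)" .
  qed (auto simp: E_def F_def)
  show "F * E = 1\<^sub>m n" using mat_mult_left_right_inverse[OF EF 1] .
qed

text \<open>The index set J is chosen maximal among all pairs of an invertible P and a set of columns of P
  lying in W; a vector of W with a nonzero coordinate outside J could replace a column of P.\<close>
lemma adapted_basis:
  fixes W :: "complex vec set"
  assumes Wc: "W \<subseteq> carrier_vec n"
  obtains P Q J where "P \<in> carrier_mat n n" "Q \<in> carrier_mat n n" "P * Q = 1\<^sub>m n" "Q * P = 1\<^sub>m n"
    "J \<subseteq> {..<n}" "\<And>j. j \<in> J \<Longrightarrow> col P j \<in> W" "\<And>w i. w \<in> W \<Longrightarrow> i < n \<Longrightarrow> i \<notin> J \<Longrightarrow> (Q *\<^sub>v w) $ i = 0"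
proof -
  define A where "A P Q J \<longleftrightarrow> P \<in> carrier_mat n n \<and> Q \<in> carrier_mat n n \<and> P * Q = 1\<^sub>m n \<and> Q * P = 1\<^sub>m n \<and>
    J \<subseteq> {..<n} \<and> (\<forall>j\<in>J. col P j \<in> W)" for P Q :: "complex mat" and J
  define S where "S = {J. \<exists>P Q. A P Q J}"
  have "{} \<in> S" by (auto simp: S_def A_def intro!: exI[of _ "1\<^sub>m n"])
  moreover have "finite S"
    by (rule finite_subset[of _ "Pow {..<n}"]) (auto simp: S_def A_def)
  ultimately obtain J where J: "J \<in> S" "\<And>J'. J' \<in> S \<Longrightarrow> J \<subseteq> J' \<Longrightarrow> J' = J"
    using finite_has_maximal[of S] by (metis empty_iff)
  then obtain P Q where A: "A P Q J" by (auto simp: S_def)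
  then have PQ: "P \<in> carrier_mat n n" "Q \<in> carrier_mat n n" "P * Q = 1\<^sub>m n" "Q * P = 1\<^sub>m n"
    "J \<subseteq> {..<n}" "\<forall>j\<in>J. col P j \<in> W" by (auto simp: A_def)
  have "(Q *\<^sub>v w) $ i = 0" if w: "w \<in> W" and i: "i < n" "i \<notin> J" for w i
  proof (rule ccontr)
    define u where "u = Q *\<^sub>v w"
    assume "(Q *\<^sub>v w) $ i \<noteq> 0"
    then have ui: "u $ i \<noteq> 0" by (simp add: u_def)
    have wc: "w \<in> carrier_vec n" using w Wc by auto
    have uc: "u \<in> carrier_vec n" using PQ wc by (auto simp: u_def)
    have Pu: "P *\<^sub>v u = w" unfolding u_def using PQ wc by (simp flip: assoc_mult_mat_vec)
    define E where "E = mat n n (\<lambda>(r, c). if c = i then u $ r else if r = c then 1 else 0)"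
    define F where "F = mat n n (\<lambda>(r, c). if c = i then (if r = i then 1 / u $ i else - u $ r / u $ i)
      else if r = c then 1 else 0)"
    have EF: "E * F = 1\<^sub>m n" "F * E = 1\<^sub>m n"
      using column_replacement_inverse[OF i(1) ui] by (auto simp: E_def F_def)
    have c: "E \<in> carrier_mat n n" "F \<in> carrier_mat n n" by (auto simp: E_def F_def)
    have 1: "P * E * (F * Q) = 1\<^sub>m n"
    proof -
      have "P * E * (F * Q) = P * (E * F) * Q"
        using PQ c by (simp add: assoc_mult_mat[of _ n n _ n _ n])
      then show ?thesis using PQ EF by simp
    qed
    have 2: "F * Q * (P * E) = 1\<^sub>m n"
      using mat_mult_left_right_inverse[OF _ _ 1] PQ c by (meson mult_carrier_mat)
    have col: "col (P * E) j = (if j = i then w else col P j)" if "j < n" for j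
    proof -
      have "col (P * E) j = P *\<^sub>v col E j" using that c PQ by (metis col_mult2)
      also have "col E j = (if j = i then u else unit_vec n j)"
        using that uc by (auto simp: E_def)
      finally show ?thesis using Pu PQ that by (auto simp: mult_unit_vec_col)
    qed
    have "A (P * E) (F * Q) (insert i J)"
      unfolding A_def using PQ c 1 2 i w col by auto
    then have "insert i J \<in> S" by (auto simp: S_def)
    then show False using J(2)[of "insert i J"] i by auto
  qed
  then show thesis using that PQ by blast
qed

section \<open>Representations and characters of a subgroup\<close>

lemma mat_tr_mult_commute:
  assumes "A \<in> carrier_mat n m" "B \<in> carrier_mat m n"
  shows "mat_tr (A * B) = mat_tr (B * A)"
proof -
  have "mat_tr (A * B) = (\<Sum>i<n. \<Sum>l<m. A $$ (i, l) * B $$ (l, i))"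
    using assms mat_mult_index_sum[OF assms] by (simp add: mat_tr_def)
  also have "\<dots> = (\<Sum>l<m. \<Sum>i<n. B $$ (l, i) * A $$ (i, l))"
    by (subst sum.swap) (simp add: mult.commute)
  also have "\<dots> = mat_tr (B * A)"
    using assms mat_mult_index_sum[OF assms(2,1)] by (simp add: mat_tr_def)
  finally show ?thesis .
qed

text \<open>Simple objects involve characters of every centralizer, so representations are studied
  on a subgroup H of a fixed G. Taking H to be the whole carrier covers the chargeons.\<close>

locale finite_subgroup = group G for G (structure) +
  fixes H
  assumes subgroup_H: "subgroup H G" and finite_H: "finite H"
begin

lemma H_closed [simp, intro]:
  "\<one> \<in> H" "x \<in> H \<Longrightarrow> y \<in> H \<Longrightarrow> x \<otimes> y \<in> H" "x \<in> H \<Longrightarrow> inv x \<in> H" "x \<in> H \<Longrightarrow> x \<in> carrier G"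
  using subgroup_H subgroup.mem_carrier
  by (auto intro: subgroup.one_closed subgroup.m_closed subgroup.m_inv_closed)

lemma sum_translate: "g \<in> H \<Longrightarrow> (\<Sum>h\<in>H. f (g \<otimes> h)) = (\<Sum>h\<in>H. f h)"
  by (rule sum.reindex_bij_witness[of _ "\<lambda>h. inv g \<otimes> h" "\<lambda>h. g \<otimes> h"]) (auto simp flip: m_assoc)

lemma card_H_pos: "card H > 0"
  using finite_H H_closed(1) by (metis card_gt_0_iff empty_iff)

lemma repD:
  assumes "is_rep G H n \<rho>"
  shows "h \<in> H \<Longrightarrow> \<rho> h \<in> carrier_mat n n" "\<rho> \<one> = 1\<^sub>m n" 
    "g \<in> H \<Longrightarrow> h \<in> H \<Longrightarrow> \<rho> (g \<otimes> h) = \<rho> g * \<rho> h"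
  using assms by (auto simp: is_rep_def)

lemma rep_conjugate:
  assumes \<rho>: "is_rep G H n \<rho>" and PQ: "P \<in> carrier_mat n n" "Q \<in> carrier_mat n n" "P * Q = 1\<^sub>m n" "Q * P = 1\<^sub>m n"
  shows "is_rep G H n (\<lambda>h. Q * \<rho> h * P)"
  unfolding is_rep_def
proof (intro conjI ballI)
  fix g h assume gh: "g \<in> H" "h \<in> H"
  note c = repD(1)[OF \<rho> gh(1)] repD(1)[OF \<rho> gh(2)] PQ(1,2)
  have "Q * \<rho> g * P * (Q * \<rho> h * P) = Q * \<rho> g * (P * Q) * (\<rho> h * P)"
    using c gh by (simp add: assoc_mult_mat[of _ n n _ n _ n])
  also have "\<dots> = Q * (\<rho> g * \<rho> h) * P"
    unfolding PQ using c gh by (simp add: assoc_mult_mat[of _ n n _ n _ n])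
  finally show "Q * \<rho> (g \<otimes> h) * P = Q * \<rho> g * P * (Q * \<rho> h * P)"
    using repD(3)[OF \<rho> gh] by simp
qed (use repD[OF \<rho>] PQ in auto)

text \<open>One condition on products serves both diagonal blocks of a block triangular
  representation: for the block of the subspace the right factor vanishes, for the block of the
  quotient the left one.\<close>

lemma rep_block:
  assumes \<rho>: "is_rep G H n \<rho>" and I: "I \<subseteq> {..<n}"
    and zero: "\<And>g h i j l. g \<in> H \<Longrightarrow> h \<in> H \<Longrightarrow> i \<in> I \<Longrightarrow> j \<in> I \<Longrightarrow> l < n \<Longrightarrow> l \<notin> I \<Longrightarrow>
      \<rho> g $$ (i, l) * \<rho> h $$ (l, j) = 0"
  obtains \<sigma> where "is_rep G H (card I) \<sigma>" "\<And>h. h \<in> H \<Longrightarrow> mat_tr (\<sigma> h) = (\<Sum>i\<in>I. \<rho> h $$ (i, i))"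
proof -
  have fin: "finite I" using I finite_subset by blast
  obtain e where e: "bij_betw e {..<card I} I"
    using ex_bij_betw_nat_finite[OF fin] by (auto simp: lessThan_atLeast0)
  then have eI: "e i \<in> I" if "i < card I" for i using that by (auto dest: bij_betwE)
  with I have en: "e i < n" if "i < card I" for i using that by auto
  have e_inj: "e i = e j \<longleftrightarrow> i = j" if "i < card I" "j < card I" for i j
    using that e by (auto simp: bij_betw_def inj_on_def)
  define \<sigma> where "\<sigma> h = mat (card I) (card I) (\<lambda>(i, j). \<rho> h $$ (e i, e j))" for h
  have "is_rep G H (card I) \<sigma>"
    unfolding is_rep_def
  proof (intro conjI ballI)
    show "\<sigma> \<one> = 1\<^sub>m (card I)"
      using en e_inj by (intro eq_matI) (auto simp: \<sigma>_def repD(2)[OF \<rho>])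
  next
    fix g h assume gh: "g \<in> H" "h \<in> H"
    show "\<sigma> (g \<otimes> h) = \<sigma> g * \<sigma> h"
    proof (intro eq_matI)
      fix i j assume "i < dim_row (\<sigma> g * \<sigma> h)" "j < dim_col (\<sigma> g * \<sigma> h)"
      then have ij: "i < card I" "j < card I" by (auto simp: \<sigma>_def)
      have "(\<sigma> g * \<sigma> h) $$ (i, j) = (\<Sum>l<card I. \<rho> g $$ (e i, e l) * \<rho> h $$ (e l, e j))"
        using ij by (subst mat_mult_index_sum[of _ "card I" "card I" _ "card I"]) (auto simp: \<sigma>_def)
      also have "\<dots> = (\<Sum>l\<in>I. \<rho> g $$ (e i, l) * \<rho> h $$ (l, e j))"
        by (rule sum.reindex_bij_betw[OF e])
      also have "\<dots> = (\<Sum>l<n. \<rho> g $$ (e i, l) * \<rho> h $$ (l, e j))"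
        using I zero gh eI ij by (intro sum.mono_neutral_left) auto
      also have "\<dots> = (\<rho> g * \<rho> h) $$ (e i, e j)"
        using en ij repD(1)[OF \<rho>] gh by (subst mat_mult_index_sum[of _ n n _ n]) auto
      finally show "\<sigma> (g \<otimes> h) $$ (i, j) = (\<sigma> g * \<sigma> h) $$ (i, j)"
        using ij repD(3)[OF \<rho> gh] by (simp add: \<sigma>_def)
    qed (auto simp: \<sigma>_def)
  qed (auto simp: \<sigma>_def)
  moreover have "mat_tr (\<sigma> h) = (\<Sum>i\<in>I. \<rho> h $$ (i, i))" for h
    unfolding mat_tr_def using sum.reindex_bij_betw[OF e, of "\<lambda>i. \<rho> h $$ (i, i)"] by (simp add: \<sigma>_def)
  ultimately show thesis using that by blast
qed

text \<open>In a basis adapted to W all matrices are block triangular, and the trace sees only the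
  two diagonal blocks. These are the representations on W and on the quotient by W.\<close>

lemma rep_splits:
  assumes \<rho>: "is_rep G H n \<rho>" and W: "invariant_subspace H n \<rho> W" and nt: "W \<noteq> {0\<^sub>v n}" "W \<noteq> carrier_vec n"
  obtains k l \<sigma> \<tau> where "k < n" "l < n" "is_rep G H k \<sigma>" "is_rep G H l \<tau>"
    "\<And>h. h \<in> H \<Longrightarrow> mat_tr (\<rho> h) = mat_tr (\<sigma> h) + mat_tr (\<tau> h)"
proof -
  have W': "W \<subseteq> carrier_vec n" "0\<^sub>v n \<in> W" "\<And>v w. v \<in> W \<Longrightarrow> w \<in> W \<Longrightarrow> v + w \<in> W"
    "\<And>c v. v \<in> W \<Longrightarrow> c \<cdot>\<^sub>v v \<in> W" "\<And>h v. h \<in> H \<Longrightarrow> v \<in> W \<Longrightarrow> \<rho> h *\<^sub>v v \<in> W"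
    using W by (auto simp: invariant_subspace_def)
  obtain P Q J where PQ: "P \<in> carrier_mat n n" "Q \<in> carrier_mat n n" "P * Q = 1\<^sub>m n" "Q * P = 1\<^sub>m n"
    and J: "J \<subseteq> {..<n}" "\<And>j. j \<in> J \<Longrightarrow> col P j \<in> W"
      "\<And>w i. w \<in> W \<Longrightarrow> i < n \<Longrightarrow> i \<notin> J \<Longrightarrow> (Q *\<^sub>v w) $ i = 0"
    using adapted_basis[OF W'(1)] by metis
  have PQv: "P *\<^sub>v (Q *\<^sub>v v) = v" if "v \<in> carrier_vec n" for v
    using PQ that by (simp flip: assoc_mult_mat_vec)
  \<comment> \<open>Nontriviality of W makes J a proper nonempty index set, so both blocks have
    degree below n and an induction on the degree can proceed.\<close>
  have "J \<noteq> {}"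
  proof
    assume "J = {}"
    have "w = 0\<^sub>v n" if w: "w \<in> W" for w
    proof -
      have "Q *\<^sub>v w = 0\<^sub>v n" using J(3)[OF w] \<open>J = {}\<close> PQ by (intro eq_vecI) auto
      moreover have "P *\<^sub>v 0\<^sub>v n = 0\<^sub>v n" using PQ by (intro eq_vecI) auto
      ultimately show ?thesis using PQv[of w] w W'(1) by auto
    qed
    then show False using nt(1) W'(2) by blast
  qed
  have "J \<noteq> {..<n}"
  proof
    assume "J = {..<n}"
    then have "P *\<^sub>v x \<in> W" if "x \<in> carrier_vec n" for x
      using subspace_mult_vec[OF PQ(1) that] W' J(2) by auto
    then have "carrier_vec n \<subseteq> W" using PQv PQ by (metis mult_mat_vec_carrier subsetI)
    then show False using nt(2) W'(1) by auto
  qed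
  define R where "R h = Q * \<rho> h * P" for h
  have R: "is_rep G H n R" unfolding R_def by (rule rep_conjugate[OF \<rho> PQ])
  \<comment> \<open>Column j of \<open>R h\<close> lists the coordinates of the image of a vector of
    W; this image is again in W and has no coordinate outside J.\<close>
  have Rz: "R h $$ (i, j) = 0" if "h \<in> H" "i < n" "i \<notin> J" "j \<in> J" for h i j
  proof -
    have jn: "j < n" using that J by auto
    have c: "\<rho> h \<in> carrier_mat n n" using repD(1)[OF \<rho>] that by auto
    have "R h $$ (i, j) = col (R h) j $ i" using that jn PQ c by (auto simp: R_def)
    moreover have "R h = Q * (\<rho> h * P)"
      unfolding R_def using PQ c by (simp add: assoc_mult_mat[of _ n n _ n _ n])
    moreover have "col (Q * (\<rho> h * P)) j = Q *\<^sub>v (\<rho> h *\<^sub>v col P j)"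
      using PQ c jn by (metis col_mult2 mult_carrier_mat)
    ultimately show ?thesis using J W'(5) that by metis
  qed
  have trR: "mat_tr (\<rho> h) = mat_tr (R h)" if "h \<in> H" for h
  proof -
    have c: "\<rho> h \<in> carrier_mat n n" using repD(1)[OF \<rho>] that by auto
    have "mat_tr (R h) = mat_tr (P * (Q * \<rho> h))"
      unfolding R_def using PQ c by (intro mat_tr_mult_commute) auto
    also have "P * (Q * \<rho> h) = \<rho> h" using PQ c by (simp flip: assoc_mult_mat[of _ n n _ n _ n])
    finally show ?thesis by simp
  qed
  obtain \<sigma> where \<sigma>: "is_rep G H (card J) \<sigma>" "\<And>h. h \<in> H \<Longrightarrow> mat_tr (\<sigma> h) = (\<Sum>i\<in>J. R h $$ (i, i))"
  proof (rule rep_block[OF R J(1)])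
    show "R g $$ (i, l) * R h $$ (l, j) = 0"
      if "g \<in> H" "h \<in> H" "i \<in> J" "j \<in> J" "l < n" "l \<notin> J" for g h i j l using Rz that by simp
  qed (use that in blast)
  let ?J' = "{..<n} - J"
  obtain \<tau> where \<tau>: "is_rep G H (card ?J') \<tau>" "\<And>h. h \<in> H \<Longrightarrow> mat_tr (\<tau> h) = (\<Sum>i\<in>?J'. R h $$ (i, i))"
  proof (rule rep_block[OF R])
    show "?J' \<subseteq> {..<n}" by auto
    show "R g $$ (i, l) * R h $$ (l, j) = 0"
      if "g \<in> H" "h \<in> H" "i \<in> ?J'" "j \<in> ?J'" "l < n" "l \<notin> ?J'" for g h i j l using Rz that by simp
  qed (use that in blast)
  have "J \<subset> {..<n}" "?J' \<subset> {..<n}" using J(1) \<open>J \<noteq> {}\<close> \<open>J \<noteq> {..<n}\<close> by auto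
  then have "card J < n" "card ?J' < n"
    by (metis card_lessThan finite_lessThan psubset_card_mono)+
  moreover have "mat_tr (\<rho> h) = mat_tr (\<sigma> h) + mat_tr (\<tau> h)" if h: "h \<in> H" for h
  proof -
    have "dim_row (R h) = n" using repD(1)[OF R h] by auto
    then have "mat_tr (\<rho> h) = (\<Sum>i<n. R h $$ (i, i))" unfolding trR[OF h] by (simp add: mat_tr_def)
    also have "\<dots> = (\<Sum>i\<in>?J'. R h $$ (i, i)) + (\<Sum>i\<in>J. R h $$ (i, i))"
      using J(1) by (intro sum.subset_diff) auto
    finally show ?thesis using h \<sigma>(2) \<tau>(2) by simp
  qed
  ultimately show thesis using that \<sigma>(1) \<tau>(1) by blast
qed

text \<open>Strong induction on the degree, splitting along any proper invariant subspace. A list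
  keeps the multiplicities; degree 0 gives the empty list and is separate because irreducibility
  demands a positive degree.\<close>

lemma character_decomposition:
  assumes "is_rep G H n \<rho>"
  shows "\<exists>cs. set cs \<subseteq> irr_chars G H \<and> (\<forall>h\<in>H. mat_tr (\<rho> h) = (\<Sum>c\<leftarrow>cs. c h))"
  using assms
proof (induction n arbitrary: \<rho> rule: less_induct)
  case (less n \<rho>)
  show ?case
  proof (cases "n = 0 \<or> is_irrep G H n \<rho>")
    case True
    then show ?thesis
    proof
      assume "n = 0"
      then have "\<forall>h\<in>H. mat_tr (\<rho> h) = 0" using repD(1)[OF less.prems] by (fastforce simp: mat_tr_def)
      then show ?thesis by (intro exI[of _ "[]"]) auto
    next
      assume "is_irrep G H n \<rho>"
      then show ?thesis
        by (intro exI[of _ "[\<lambda>h. if h \<in> H then mat_tr (\<rho> h) else 0]"]) (auto simp: irr_chars_def)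
    qed
  next
    case False
    then obtain W where "invariant_subspace H n \<rho> W" "W \<noteq> {0\<^sub>v n}" "W \<noteq> carrier_vec n"
      using less.prems by (auto simp: is_irrep_def)
    then obtain k l \<sigma> \<tau> where *: "k < n" "l < n" "is_rep G H k \<sigma>" "is_rep G H l \<tau>"
      "\<And>h. h \<in> H \<Longrightarrow> mat_tr (\<rho> h) = mat_tr (\<sigma> h) + mat_tr (\<tau> h)"
      using rep_splits[OF less.prems] by metis
    obtain cs ds where "set cs \<subseteq> irr_chars G H" "\<forall>h\<in>H. mat_tr (\<sigma> h) = (\<Sum>c\<leftarrow>cs. c h)"
      "set ds \<subseteq> irr_chars G H" "\<forall>h\<in>H. mat_tr (\<tau> h) = (\<Sum>c\<leftarrow>ds. c h)"
      using less.IH[OF *(1,3)] less.IH[OF *(2,4)] by auto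
    then show ?thesis using *(5) by (intro exI[of _ "cs @ ds"]) auto
  qed
qed

end

section \<open>Schur's lemma\<close>

lemma mult_mat_zero_vec:
  fixes T :: "'a :: semiring_0 mat"
  assumes "T \<in> carrier_mat n m"
  shows "T *\<^sub>v 0\<^sub>v m = 0\<^sub>v n"
  using assms by (intro eq_vecI) auto

lemma zero_mult_mat_vec:
  fixes v :: "'a :: semiring_0 vec"
  assumes "v \<in> carrier_vec m"
  shows "0\<^sub>m n m *\<^sub>v v = 0\<^sub>v n"
  using assms by (intro eq_vecI) (auto simp: scalar_prod_def)

lemma smult_one_mult_vec:
  fixes v :: "complex vec"
  assumes "v \<in> carrier_vec n"
  shows "(c \<cdot>\<^sub>m 1\<^sub>m n) *\<^sub>v v = c \<cdot>\<^sub>v v"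
  using assms by (intro eq_vecI) (auto simp: scalar_prod_def if_distrib[of "\<lambda>x. x * _"] mult.assoc
      simp flip: sum_distrib_left cong: if_cong)

lemma mat_tr_smult_one: "mat_tr (c \<cdot>\<^sub>m 1\<^sub>m n) = c * of_nat n"
  by (simp add: mat_tr_def)

lemma mat_tr_one: "mat_tr (1\<^sub>m n) = of_nat n"
  by (simp add: mat_tr_def)

lemma eq_matI_vec:
  fixes A B :: "complex mat"
  assumes c: "A \<in> carrier_mat n m" "B \<in> carrier_mat n m"
    and eq: "\<And>v. v \<in> carrier_vec m \<Longrightarrow> A *\<^sub>v v = B *\<^sub>v v"
  shows "A = B"
proof (intro eq_matI)
  fix i j assume ij: "i < dim_row B" "j < dim_col B"
  then have ij': "i < n" "j < m" using c by auto
  have "col A j = col B j"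
    using eq[of "unit_vec m j"] c ij' by (simp add: mult_unit_vec_col)
  moreover have "A $$ (i, j) = col A j $ i" "B $$ (i, j) = col B j $ i" using c ij' by auto
  ultimately show "A $$ (i, j) = B $$ (i, j)" by simp
qed (use c in auto)

context finite_subgroup
begin

lemma irrepD:
  assumes "is_irrep G H n \<rho>"
  shows "is_rep G H n \<rho>" "n > 0" "invariant_subspace H n \<rho> W \<Longrightarrow> W = {0\<^sub>v n} \<or> W = carrier_vec n"
  using assms by (auto simp: is_irrep_def)

lemma invariant_subspace_kernel:
  assumes \<rho>: "is_rep G H n \<rho>" and \<sigma>: "is_rep G H m \<sigma>" and T: "T \<in> carrier_mat n m"
    and comm: "\<And>h. h \<in> H \<Longrightarrow> \<rho> h * T = T * \<sigma> h"
  shows "invariant_subspace H m \<sigma> {v \<in> carrier_vec m. T *\<^sub>v v = 0\<^sub>v n}"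
  unfolding invariant_subspace_def
proof (intro conjI ballI allI)
  fix h v assume h: "h \<in> H" and v: "v \<in> {v \<in> carrier_vec m. T *\<^sub>v v = 0\<^sub>v n}"
  note c = repD(1)[OF \<rho> h] repD(1)[OF \<sigma> h]
  have v': "v \<in> carrier_vec m" "T *\<^sub>v v = 0\<^sub>v n" using v by auto
  have "T *\<^sub>v (\<sigma> h *\<^sub>v v) = \<rho> h *\<^sub>v (T *\<^sub>v v)"
    using assoc_mult_mat_vec[OF T c(2) v'(1)] assoc_mult_mat_vec[OF c(1) T v'(1)] comm[OF h] by simp
  also have "\<dots> = 0\<^sub>v n" using v'(2) mult_mat_zero_vec[OF c(1)] by simp
  finally show "\<sigma> h *\<^sub>v v \<in> {v \<in> carrier_vec m. T *\<^sub>v v = 0\<^sub>v n}" using c v by auto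
next
  show "0\<^sub>v m \<in> {v \<in> carrier_vec m. T *\<^sub>v v = 0\<^sub>v n}" using mult_mat_zero_vec[OF T] by auto
next
  fix v w assume "v \<in> {v \<in> carrier_vec m. T *\<^sub>v v = 0\<^sub>v n}" "w \<in> {v \<in> carrier_vec m. T *\<^sub>v v = 0\<^sub>v n}"
  then show "v + w \<in> {v \<in> carrier_vec m. T *\<^sub>v v = 0\<^sub>v n}"
    using T by (auto simp: mult_add_distrib_mat_vec)
next
  fix c :: complex and v assume "v \<in> {v \<in> carrier_vec m. T *\<^sub>v v = 0\<^sub>v n}"
  then show "c \<cdot>\<^sub>v v \<in> {v \<in> carrier_vec m. T *\<^sub>v v = 0\<^sub>v n}"
    using T by (auto simp: mult_mat_vec)
qed auto

lemma invariant_subspace_image: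
  assumes \<rho>: "is_rep G H n \<rho>" and \<sigma>: "is_rep G H m \<sigma>" and T: "T \<in> carrier_mat n m"
    and comm: "\<And>h. h \<in> H \<Longrightarrow> \<rho> h * T = T * \<sigma> h"
  shows "invariant_subspace H n \<rho> {T *\<^sub>v v | v. v \<in> carrier_vec m}"
  unfolding invariant_subspace_def
proof (intro conjI ballI allI)
  fix h w assume h: "h \<in> H" and w: "w \<in> {T *\<^sub>v v | v. v \<in> carrier_vec m}"
  note c = repD(1)[OF \<rho> h] repD(1)[OF \<sigma> h]
  obtain v where v: "v \<in> carrier_vec m" "w = T *\<^sub>v v" using w by auto
  have "\<rho> h *\<^sub>v w = T *\<^sub>v (\<sigma> h *\<^sub>v v)"
    using assoc_mult_mat_vec[OF T c(2) v(1)] assoc_mult_mat_vec[OF c(1) T v(1)] comm[OF h] v(2) by simp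
  moreover have "\<sigma> h *\<^sub>v v \<in> carrier_vec m" using c v by auto
  ultimately show "\<rho> h *\<^sub>v w \<in> {T *\<^sub>v v | v. v \<in> carrier_vec m}" by blast
next
  have "0\<^sub>v n = T *\<^sub>v 0\<^sub>v m" using mult_mat_zero_vec[OF T] by simp
  then show "0\<^sub>v n \<in> {T *\<^sub>v v | v. v \<in> carrier_vec m}" using zero_carrier_vec by blast
next
  fix v w assume "v \<in> {T *\<^sub>v v | v. v \<in> carrier_vec m}" "w \<in> {T *\<^sub>v v | v. v \<in> carrier_vec m}"
  then obtain v' w' where "v' \<in> carrier_vec m" "w' \<in> carrier_vec m" "v = T *\<^sub>v v'" "w = T *\<^sub>v w'" by blast
  then have "v' + w' \<in> carrier_vec m" "v + w = T *\<^sub>v (v' + w')"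
    using T by (auto simp: mult_add_distrib_mat_vec)
  then show "v + w \<in> {T *\<^sub>v v | v. v \<in> carrier_vec m}" by blast
next
  fix c :: complex and v assume "v \<in> {T *\<^sub>v v | v. v \<in> carrier_vec m}"
  then obtain v' where "v' \<in> carrier_vec m" "v = T *\<^sub>v v'" by blast
  then have "c \<cdot>\<^sub>v v' \<in> carrier_vec m" "c \<cdot>\<^sub>v v = T *\<^sub>v (c \<cdot>\<^sub>v v')"
    using T by (auto simp: mult_mat_vec)
  then show "c \<cdot>\<^sub>v v \<in> {T *\<^sub>v v | v. v \<in> carrier_vec m}" by blast
qed (use T in auto)

text \<open>Kernel and image of an intertwiner are invariant, so irreducibility makes T injective
  and surjective. The columns of S are preimages of the unit vectors, which gives
  \<open>T * S = 1\<^sub>m n\<close>; as n and m may differ a priori, the other identity is taken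
  from the trivial kernel.\<close>

lemma schur_invertible:
  assumes \<rho>: "is_irrep G H n \<rho>" and \<sigma>: "is_irrep G H m \<sigma>" and T: "T \<in> carrier_mat n m"
    and comm: "\<And>h. h \<in> H \<Longrightarrow> \<rho> h * T = T * \<sigma> h" and nz: "T \<noteq> 0\<^sub>m n m"
  obtains S where "S \<in> carrier_mat m n" "T * S = 1\<^sub>m n" "S * T = 1\<^sub>m m"
proof -
  let ?K = "{v \<in> carrier_vec m. T *\<^sub>v v = 0\<^sub>v n}" and ?I = "{T *\<^sub>v v | v. v \<in> carrier_vec m}"
  have not_all: "?K \<noteq> carrier_vec m"
  proof
    assume "?K = carrier_vec m"
    then have "T *\<^sub>v v = 0\<^sub>m n m *\<^sub>v v" if "v \<in> carrier_vec m" for v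
      using that by (metis (mono_tags, lifting) mem_Collect_eq zero_mult_mat_vec)
    then show False using eq_matI_vec[OF T zero_carrier_mat] nz by blast
  qed
  then have K: "?K = {0\<^sub>v m}"
    using irrepD(3)[OF \<sigma> invariant_subspace_kernel[OF irrepD(1)[OF \<rho>] irrepD(1)[OF \<sigma>] T comm]] by blast
  from not_all have "\<exists>v \<in> carrier_vec m. T *\<^sub>v v \<noteq> 0\<^sub>v n" by blast
  then have "?I \<noteq> {0\<^sub>v n}" by blast
  then have I: "?I = carrier_vec n"
    using irrepD(3)[OF \<rho> invariant_subspace_image[OF irrepD(1)[OF \<rho>] irrepD(1)[OF \<sigma>] T comm]] by blast
  have "\<exists>v. v \<in> carrier_vec m \<and> T *\<^sub>v v = unit_vec n j" for j
    using I by (smt (verit) mem_Collect_eq unit_vec_carrier)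
  then obtain s where s: "\<And>j. s j \<in> carrier_vec m" "\<And>j. T *\<^sub>v s j = unit_vec n j" by metis
  define S where "S = mat m n (\<lambda>(i, j). s j $ i)"
  have S: "S \<in> carrier_mat m n" by (simp add: S_def)
  have col: "col S j = s j" if "j < n" for j using that s(1)[of j] by (auto simp: S_def)
  have TS: "T * S = 1\<^sub>m n"
  proof (intro eq_matI)
    fix i j assume "i < dim_row (1\<^sub>m n)" "j < dim_col (1\<^sub>m n)"
    then have ij: "i < n" "j < n" by auto
    have "(T * S) $$ (i, j) = col (T * S) j $ i" using ij T S by auto
    also have "col (T * S) j = unit_vec n j" using ij T S s(2) col by (metis col_mult2)
    finally show "(T * S) $$ (i, j) = 1\<^sub>m n $$ (i, j)" using ij by simp
  qed (use T S in auto)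
  have "S * T = 1\<^sub>m m"
  proof (rule eq_matI_vec)
    fix v :: "complex vec" assume v: "v \<in> carrier_vec m"
    let ?w = "S *\<^sub>v (T *\<^sub>v v) - v"
    have "T *\<^sub>v (S *\<^sub>v (T *\<^sub>v v)) = T *\<^sub>v v"
      using assoc_mult_mat_vec[OF T S, of "T *\<^sub>v v"] T TS v by simp
    then have "T *\<^sub>v ?w = 0\<^sub>v n"
      using T S v by (subst mult_minus_distrib_mat_vec) auto
    then have "?w \<in> ?K" using T S v by auto
    then have w0: "?w = 0\<^sub>v m" using K by blast
    have "S *\<^sub>v (T *\<^sub>v v) = v"
    proof (intro eq_vecI)
      fix i assume i: "i < dim_vec v"
      then have "?w $ i = 0" using w0 v by auto
      then show "(S *\<^sub>v (T *\<^sub>v v)) $ i = v $ i" using i v S by auto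
    qed (use S v in auto)
    then show "S * T *\<^sub>v v = 1\<^sub>m m *\<^sub>v v" using T S v by simp
  qed (use T S in auto)
  then show thesis using that S TS by blast
qed

text \<open>Over the complex numbers T has an eigenvalue k. The kernel of T - k is invariant and
  contains an eigenvector, hence is everything.\<close>

lemma schur_scalar:
  assumes \<rho>: "is_irrep G H n \<rho>" and T: "T \<in> carrier_mat n n"
    and comm: "\<And>h. h \<in> H \<Longrightarrow> \<rho> h * T = T * \<rho> h"
  shows "\<exists>c. T = c \<cdot>\<^sub>m 1\<^sub>m n"
proof -
  have "degree (char_poly T) > 0" using degree_monic_char_poly[OF T] irrepD(2)[OF \<rho>] by auto
  then have "\<not> constant (poly (char_poly T))" by (simp add: constant_degree)
  then obtain k where "poly (char_poly T) k = 0" using fundamental_theorem_of_algebra by auto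
  then have "eigenvalue T k" using eigenvalue_root_char_poly[OF T] by auto
  then obtain v where v: "v \<in> carrier_vec n" "v \<noteq> 0\<^sub>v n" "T *\<^sub>v v = k \<cdot>\<^sub>v v"
    using T by (auto simp: eigenvalue_def eigenvector_def)
  define U where "U = T - k \<cdot>\<^sub>m 1\<^sub>m n"
  have U: "U \<in> carrier_mat n n" using T by (auto simp: U_def)
  have Uv: "U *\<^sub>v w = T *\<^sub>v w - k \<cdot>\<^sub>v w" if "w \<in> carrier_vec n" for w
  proof -
    show ?thesis using T that by (simp add: U_def minus_mult_distrib_mat_vec[of _ n n] smult_one_mult_vec)
  qed
  have comm': "\<rho> h * U = U * \<rho> h" if h: "h \<in> H" for h
  proof -
    have c: "\<rho> h \<in> carrier_mat n n" using repD(1)[OF irrepD(1)[OF \<rho>] h] .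
    have "\<rho> h * (k \<cdot>\<^sub>m 1\<^sub>m n) = k \<cdot>\<^sub>m \<rho> h" "k \<cdot>\<^sub>m 1\<^sub>m n * \<rho> h = k \<cdot>\<^sub>m \<rho> h"
      using c by (auto simp: mult_smult_distrib[of _ n n _ n] mult_smult_assoc_mat[of _ n n _ n])
    then show ?thesis
      unfolding U_def using comm[OF h] c T
      by (subst mult_minus_distrib_mat[of _ n n _ n], auto simp: minus_mult_distrib_mat[of _ n n _ _ n])
  qed
  let ?K = "{v \<in> carrier_vec n. U *\<^sub>v v = 0\<^sub>v n}"
  have "v \<in> ?K" using v Uv by auto
  then have "?K \<noteq> {0\<^sub>v n}" using v by auto
  then have K: "?K = carrier_vec n"
    using irrepD(3)[OF \<rho> invariant_subspace_kernel[OF irrepD(1)[OF \<rho>] irrepD(1)[OF \<rho>] U comm']] by blast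
  have U0: "U = 0\<^sub>m n n"
  proof (rule eq_matI_vec[OF U])
    fix v :: "complex vec" assume "v \<in> carrier_vec n"
    then show "U *\<^sub>v v = 0\<^sub>m n n *\<^sub>v v"
      using K by (metis (mono_tags, lifting) mem_Collect_eq zero_mult_mat_vec)
  qed auto
  have "T = k \<cdot>\<^sub>m 1\<^sub>m n"
  proof (intro eq_matI)
    fix i j assume ij: "i < dim_row (k \<cdot>\<^sub>m 1\<^sub>m n)" "j < dim_col (k \<cdot>\<^sub>m 1\<^sub>m n)"
    then have "U $$ (i, j) = 0" using U0 by auto
    then show "T $$ (i, j) = (k \<cdot>\<^sub>m 1\<^sub>m n) $$ (i, j)" using ij T by (auto simp: U_def)
  qed (use T in auto)
  then show ?thesis by blast
qed

end

section \<open>Orthogonality of irreducible characters\<close>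

lemma sum_list_eq_sum_count_list:
  fixes f :: "'a \<Rightarrow> 'b :: comm_semiring_1"
  assumes "finite A" "set xs \<subseteq> A"
  shows "(\<Sum>x\<leftarrow>xs. f x) = (\<Sum>x\<in>A. of_nat (count_list xs x) * f x)"
  using assms(2)
proof (induction xs)
  case (Cons y xs)
  have "(\<Sum>x\<in>A. of_nat (count_list (y # xs) x) * f x)
    = (\<Sum>x\<in>A. (if x = y then f x else 0) + of_nat (count_list xs x) * f x)"
    by (intro sum.cong) (auto simp: distrib_right)
  also have "\<dots> = f y + (\<Sum>x\<in>A. of_nat (count_list xs x) * f x)"
    using assms(1) Cons.prems by (simp add: sum.distrib)
  finally show ?case using Cons by simp
qed simp

context finite_subgroup
begin

lemma irr_charsE:
  assumes "\<chi> \<in> irr_chars G H"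
  obtains n \<rho> where "is_irrep G H n \<rho>" "\<chi> = (\<lambda>h. if h \<in> H then mat_tr (\<rho> h) else 0)"
  using assms by (auto simp: irr_chars_def)

lemma irr_char_outside: "\<chi> \<in> irr_chars G H \<Longrightarrow> h \<notin> H \<Longrightarrow> \<chi> h = 0"
  by (erule irr_charsE) simp

lemma irr_char_one:
  assumes "\<chi> \<in> irr_chars G H"
  obtains n where "n > 0" "\<chi> \<one> = of_nat n"
proof -
  obtain n \<rho> where "is_irrep G H n \<rho>" "\<chi> = (\<lambda>h. if h \<in> H then mat_tr (\<rho> h) else 0)"
    using assms by (rule irr_charsE)
  then show thesis using that[of n] irrepD[of n \<rho>] repD(2)[of n \<rho>] by (simp add: mat_tr_one)
qed

lemma irr_char_class_function:
  assumes \<chi>: "\<chi> \<in> irr_chars G H" and gh: "g \<in> H" "h \<in> H"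
  shows "\<chi> (g \<otimes> h \<otimes> inv g) = \<chi> h"
proof -
  obtain n \<rho> where irr: "is_irrep G H n \<rho>" and \<chi>_def: "\<chi> = (\<lambda>h. if h \<in> H then mat_tr (\<rho> h) else 0)"
    using \<chi> by (rule irr_charsE)
  note \<rho> = irrepD(1)[OF irr]
  have H: "g \<otimes> h \<in> H" "inv g \<in> H" using gh by auto
  have "mat_tr (\<rho> (g \<otimes> h \<otimes> inv g)) = mat_tr (\<rho> (g \<otimes> h) * \<rho> (inv g))"
    using repD(3)[OF \<rho> H] by simp
  also have "\<dots> = mat_tr (\<rho> (inv g) * \<rho> (g \<otimes> h))"
    using mat_tr_mult_commute[OF repD(1)[OF \<rho> H(1)] repD(1)[OF \<rho> H(2)]] .
  also have "\<dots> = mat_tr (\<rho> (inv g \<otimes> (g \<otimes> h)))" using repD(3)[OF \<rho> H(2,1)] by simp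
  also have "inv g \<otimes> (g \<otimes> h) = h" using gh by (simp flip: m_assoc)
  finally show ?thesis using gh H by (simp add: \<chi>_def)
qed

lemma triv_char_irr: "triv_char H \<in> irr_chars G H"
proof -
  define \<rho> :: "'a \<Rightarrow> complex mat" where "\<rho> = (\<lambda>_. 1\<^sub>m 1)"
  have "is_irrep G H 1 \<rho>"
    unfolding is_irrep_def
  proof (intro conjI allI impI)
    fix W assume "invariant_subspace H 1 \<rho> W"
    then have W: "W \<subseteq> carrier_vec 1" "0\<^sub>v 1 \<in> W" "\<And>c v. v \<in> W \<Longrightarrow> c \<cdot>\<^sub>v v \<in> W"
      by (auto simp: invariant_subspace_def)
    show "W = {0\<^sub>v 1} \<or> W = carrier_vec 1"
    proof (rule disjCI)
      assume "W \<noteq> carrier_vec 1"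
      have "w = 0\<^sub>v 1" if w: "w \<in> W" for w
      proof (rule ccontr)
        have wc: "w \<in> carrier_vec 1" using w W by auto
        assume "w \<noteq> 0\<^sub>v 1"
        then have "w $ 0 \<noteq> 0" using wc by (metis carrier_vecD eq_vecI index_zero_vec less_one)
        then have "v = (v $ 0 / w $ 0) \<cdot>\<^sub>v w" if "v \<in> carrier_vec 1" for v
          using that wc by (intro eq_vecI) auto
        then have "carrier_vec 1 \<subseteq> W" using W(3) w by (metis subsetI)
        then show False using W(1) \<open>W \<noteq> carrier_vec 1\<close> by blast
      qed
      then show "W = {0\<^sub>v 1}" using W(2) by blast
    qed
  qed (auto simp: is_rep_def \<rho>_def)
  moreover have "triv_char H = (\<lambda>h. if h \<in> H then mat_tr (\<rho> h) else 0)"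
    by (intro ext) (simp add: triv_char_def \<rho>_def mat_tr_def)
  ultimately show ?thesis unfolding irr_chars_def by blast
qed

text \<open>The matrix below is the average of the elementary matrix with a single 1 in position (a, b).\<close>
lemma average_intertwines:
  assumes \<rho>: "is_rep G H n \<rho>" and \<sigma>: "is_rep G H m \<sigma>" and ab: "a < n" "b < m" and g: "g \<in> H"
  defines "T \<equiv> mat n m (\<lambda>(i, j). \<Sum>h\<in>H. \<rho> h $$ (i, a) * \<sigma> (inv h) $$ (b, j))"
  shows "\<rho> g * T = T * \<sigma> g"
proof (intro eq_matI)
  fix i j assume "i < dim_row (T * \<sigma> g)" "j < dim_col (T * \<sigma> g)"
  then have ij: "i < n" "j < m" using repD(1)[OF \<sigma> g] by (auto simp: T_def)
  have c: "\<And>h. h \<in> H \<Longrightarrow> \<rho> h \<in> carrier_mat n n" "\<And>h. h \<in> H \<Longrightarrow> \<sigma> h \<in> carrier_mat m m" "T \<in> carrier_mat n m"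
    using repD(1)[OF \<rho>] repD(1)[OF \<sigma>] by (auto simp: T_def)
  have "(\<rho> g * T) $$ (i, j) = (\<Sum>l<n. \<rho> g $$ (i, l) * (\<Sum>h\<in>H. \<rho> h $$ (l, a) * \<sigma> (inv h) $$ (b, j)))"
    using ij mat_mult_index_sum[OF c(1)[OF g] c(3) ij] by (simp add: T_def)
  also have "\<dots> = (\<Sum>h\<in>H. (\<Sum>l<n. \<rho> g $$ (i, l) * \<rho> h $$ (l, a)) * \<sigma> (inv h) $$ (b, j))"
    by (simp add: sum_distrib_left sum_distrib_right mult.assoc) (rule sum.swap)
  also have "\<dots> = (\<Sum>h\<in>H. \<rho> (g \<otimes> h) $$ (i, a) * \<sigma> (inv h) $$ (b, j))"
    using mat_mult_index_sum[OF c(1) c(1)] g ij ab repD(3)[OF \<rho>] by (intro sum.cong) auto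
  \<comment> \<open>Writing \<open>inv h\<close> as \<open>inv (g \<otimes> h) \<otimes> g\<close>
    makes the summand a function of \<open>g \<otimes> h\<close>, so that translation invariance
    applies and g reappears on the right.\<close>
  also have "\<dots> = (\<Sum>h\<in>H. \<rho> (g \<otimes> h) $$ (i, a) * \<sigma> (inv (g \<otimes> h) \<otimes> g) $$ (b, j))"
    using g by (intro sum.cong) (auto simp: inv_mult_group m_assoc)
  also have "\<dots> = (\<Sum>h\<in>H. \<rho> h $$ (i, a) * \<sigma> (inv h \<otimes> g) $$ (b, j))"
    by (rule sum_translate[OF g, of "\<lambda>h. \<rho> h $$ (i, a) * \<sigma> (inv h \<otimes> g) $$ (b, j)"])
  also have "\<dots> = (\<Sum>h\<in>H. \<rho> h $$ (i, a) * (\<Sum>l<m. \<sigma> (inv h) $$ (b, l) * \<sigma> g $$ (l, j)))"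
    using mat_mult_index_sum[OF c(2) c(2)] g ij ab repD(3)[OF \<sigma>] by (intro sum.cong) auto
  also have "\<dots> = (\<Sum>l<m. (\<Sum>h\<in>H. \<rho> h $$ (i, a) * \<sigma> (inv h) $$ (b, l)) * \<sigma> g $$ (l, j))"
    by (simp add: sum_distrib_left sum_distrib_right mult.assoc) (rule sum.swap)
  also have "\<dots> = (T * \<sigma> g) $$ (i, j)"
    using ij mat_mult_index_sum[OF c(3) c(2)[OF g] ij] by (simp add: T_def)
  finally show "(\<rho> g * T) $$ (i, j) = (T * \<sigma> g) $$ (i, j)" .
qed (use repD(1)[OF \<rho> g] repD(1)[OF \<sigma> g] in \<open>auto simp: T_def\<close>)

text \<open>Splits the inner product of two characters into matrix coefficients. Each inner sum is
  the entry (a, b) of the averaged matrix for the same a and b, to which Schur's lemma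
  applies.\<close>

lemma sum_trace_product:
  assumes \<rho>: "is_rep G H n \<rho>" and \<sigma>: "is_rep G H m \<sigma>"
  shows "(\<Sum>h\<in>H. mat_tr (\<rho> h) * mat_tr (\<sigma> (inv h)))
    = (\<Sum>a<n. \<Sum>b<m. \<Sum>h\<in>H. \<rho> h $$ (a, a) * \<sigma> (inv h) $$ (b, b))"
proof -
  have "(\<Sum>h\<in>H. mat_tr (\<rho> h) * mat_tr (\<sigma> (inv h)))
    = (\<Sum>h\<in>H. \<Sum>a<n. \<Sum>b<m. \<rho> h $$ (a, a) * \<sigma> (inv h) $$ (b, b))"
  proof (intro sum.cong refl)
    fix h assume h: "h \<in> H"
    then have "dim_row (\<rho> h) = n" "dim_row (\<sigma> (inv h)) = m"
      using repD(1)[OF \<rho> h] repD(1)[OF \<sigma> H_closed(3)[OF h]] by auto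
    then show "mat_tr (\<rho> h) * mat_tr (\<sigma> (inv h)) = (\<Sum>a<n. \<Sum>b<m. \<rho> h $$ (a, a) * \<sigma> (inv h) $$ (b, b))"
      by (simp add: mat_tr_def sum_product)
  qed
  also have "\<dots> = (\<Sum>a<n. \<Sum>h\<in>H. \<Sum>b<m. \<rho> h $$ (a, a) * \<sigma> (inv h) $$ (b, b))"
    by (rule sum.swap)
  also have "\<dots> = (\<Sum>a<n. \<Sum>b<m. \<Sum>h\<in>H. \<rho> h $$ (a, a) * \<sigma> (inv h) $$ (b, b))"
    by (intro sum.cong refl sum.swap)
  finally show ?thesis .
qed

text \<open>A nonzero averaged intertwiner would be invertible and conjugate one representation into
  the other, forcing equal traces. Inequivalence is therefore expressed by a differing trace, which
  suits a set of characters that are compared as functions.\<close>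

lemma irrep_orthogonality_distinct:
  assumes \<rho>: "is_irrep G H n \<rho>" and \<sigma>: "is_irrep G H m \<sigma>"
    and h: "h \<in> H" and ne: "mat_tr (\<rho> h) \<noteq> mat_tr (\<sigma> h)"
  shows "(\<Sum>h\<in>H. mat_tr (\<rho> h) * mat_tr (\<sigma> (inv h))) = 0"
proof -
  have "(\<Sum>h\<in>H. \<rho> h $$ (a, a) * \<sigma> (inv h) $$ (b, b)) = 0" if ab: "a < n" "b < m" for a b
  proof -
    define T where "T = mat n m (\<lambda>(i, j). \<Sum>h\<in>H. \<rho> h $$ (i, a) * \<sigma> (inv h) $$ (b, j))"
    have T: "T \<in> carrier_mat n m" by (simp add: T_def)
    have comm: "\<rho> g * T = T * \<sigma> g" if "g \<in> H" for g
      unfolding T_def using average_intertwines[OF irrepD(1)[OF \<rho>] irrepD(1)[OF \<sigma>] ab that] .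
    have "T = 0\<^sub>m n m"
    proof (rule ccontr)
      assume "T \<noteq> 0\<^sub>m n m"
      then obtain S where S: "S \<in> carrier_mat m n" "T * S = 1\<^sub>m n" "S * T = 1\<^sub>m m"
        using schur_invertible[OF \<rho> \<sigma> T comm] by blast
      have c: "\<rho> h \<in> carrier_mat n n" "\<sigma> h \<in> carrier_mat m m"
        using repD(1)[OF irrepD(1)[OF \<rho>] h] repD(1)[OF irrepD(1)[OF \<sigma>] h] by auto
      have "\<rho> h = \<rho> h * (T * S)" using c S by simp
      also have "\<dots> = T * \<sigma> h * S" using assoc_mult_mat[OF c(1) T S(1)] comm[OF h] by simp
      finally have "mat_tr (\<rho> h) = mat_tr (T * \<sigma> h * S)" by simp
      also have "\<dots> = mat_tr (S * (T * \<sigma> h))" using T S c by (intro mat_tr_mult_commute) auto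
      also have "S * (T * \<sigma> h) = \<sigma> h" using assoc_mult_mat[OF S(1) T c(2)] S(3) c by simp
      finally show False using ne by simp
    qed
    then have "T $$ (a, b) = 0" using ab by simp
    then show ?thesis using ab by (simp add: T_def)
  qed
  then show ?thesis by (subst sum_trace_product[OF irrepD(1)[OF \<rho>] irrepD(1)[OF \<sigma>]]) simp
qed

text \<open>The averaged matrix is a scalar c by Schur's lemma, and its trace fixes c: summing
  \<rho>(h^-1) \<rho>(h) = 1 over H gives c n = |H| if a = b and 0 otherwise. Only the n diagonal
  pairs contribute.\<close>

lemma irrep_orthogonality_same:
  assumes \<rho>: "is_irrep G H n \<rho>"
  shows "(\<Sum>h\<in>H. mat_tr (\<rho> h) * mat_tr (\<rho> (inv h))) = of_nat (card H)"
proof -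
  have n: "n > 0" and rep: "is_rep G H n \<rho>" using irrepD[OF \<rho>] by auto
  have "(\<Sum>h\<in>H. \<rho> h $$ (a, a) * \<rho> (inv h) $$ (b, b)) = (if a = b then of_nat (card H) / of_nat n else 0)"
    if ab: "a < n" "b < n" for a b
  proof -
    define T where "T = mat n n (\<lambda>(i, j). \<Sum>h\<in>H. \<rho> h $$ (i, a) * \<rho> (inv h) $$ (b, j))"
    have T: "T \<in> carrier_mat n n" by (simp add: T_def)
    have comm: "\<rho> g * T = T * \<rho> g" if "g \<in> H" for g
      unfolding T_def using average_intertwines[OF rep rep ab that] .
    obtain c where c: "T = c \<cdot>\<^sub>m 1\<^sub>m n" using schur_scalar[OF \<rho> T comm] by blast
    have "c * of_nat n = mat_tr T" by (simp add: c mat_tr_smult_one)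
    also have "\<dots> = (\<Sum>i<n. \<Sum>h\<in>H. \<rho> h $$ (i, a) * \<rho> (inv h) $$ (b, i))"
      by (simp add: mat_tr_def T_def)
    also have "\<dots> = (\<Sum>h\<in>H. \<Sum>i<n. \<rho> (inv h) $$ (b, i) * \<rho> h $$ (i, a))"
      by (subst sum.swap) (simp add: mult.commute)
    also have "\<dots> = (\<Sum>h\<in>H. 1\<^sub>m n $$ (b, a))"
    proof (intro sum.cong refl)
      fix h assume h: "h \<in> H"
      have "(\<Sum>i<n. \<rho> (inv h) $$ (b, i) * \<rho> h $$ (i, a)) = (\<rho> (inv h) * \<rho> h) $$ (b, a)"
        using mat_mult_index_sum[OF repD(1)[OF rep H_closed(3)[OF h]] repD(1)[OF rep h] ab(2,1)] by simp
      also have "\<rho> (inv h) * \<rho> h = 1\<^sub>m n" using h repD(2,3)[OF rep] by (metis H_closed(3,4) l_inv)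
      finally show "(\<Sum>i<n. \<rho> (inv h) $$ (b, i) * \<rho> h $$ (i, a)) = 1\<^sub>m n $$ (b, a)" .
    qed
    finally have "c * of_nat n = of_nat (card H) * 1\<^sub>m n $$ (b, a)" by simp
    then have c_eq: "c = of_nat (card H) * 1\<^sub>m n $$ (b, a) / of_nat n" using n by (simp add: field_simps)
    have "T $$ (a, b) = c * 1\<^sub>m n $$ (a, b)" using ab by (simp add: c)
    then show ?thesis using ab by (auto simp: T_def c_eq)
  qed
  then have "(\<Sum>h\<in>H. mat_tr (\<rho> h) * mat_tr (\<rho> (inv h)))
    = (\<Sum>a<n. \<Sum>b<n. if a = b then of_nat (card H) / of_nat n else 0)"
    by (subst sum_trace_product[OF rep rep]) simp
  also have "\<dots> = of_nat (card H)" using n by (simp add: sum.delta)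
  finally show ?thesis .
qed

text \<open>Irreducible characters are extended by 0, so two distinct ones already differ at some
  element of H, and this is the witness that the case of distinct traces asks for.\<close>

theorem row_orthogonality:
  assumes "\<chi> \<in> irr_chars G H" "\<psi> \<in> irr_chars G H"
  shows "(\<Sum>h\<in>H. \<chi> h * \<psi> (inv h)) = (if \<chi> = \<psi> then of_nat (card H) else 0)"
proof -
  obtain n \<rho> where \<rho>: "is_irrep G H n \<rho>" "\<chi> = (\<lambda>h. if h \<in> H then mat_tr (\<rho> h) else 0)"
    using assms(1) by (rule irr_charsE)
  obtain m \<sigma> where \<sigma>: "is_irrep G H m \<sigma>" "\<psi> = (\<lambda>h. if h \<in> H then mat_tr (\<sigma> h) else 0)"
    using assms(2) by (rule irr_charsE)
  show ?thesis
  proof (cases "\<chi> = \<psi>")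
    case True
    have "(\<Sum>h\<in>H. \<chi> h * \<chi> (inv h)) = (\<Sum>h\<in>H. mat_tr (\<rho> h) * mat_tr (\<rho> (inv h)))"
      using \<rho>(2) by (intro sum.cong) auto
    then show ?thesis using irrep_orthogonality_same[OF \<rho>(1)] True by simp
  next
    case False
    have "\<exists>h\<in>H. mat_tr (\<rho> h) \<noteq> mat_tr (\<sigma> h)"
    proof (rule ccontr)
      assume "\<not> ?thesis"
      then have "\<chi> = \<psi>" unfolding \<rho>(2) \<sigma>(2) by (intro ext) auto
      then show False using False by blast
    qed
    then obtain h where "h \<in> H" "mat_tr (\<rho> h) \<noteq> mat_tr (\<sigma> h)" by blast
    then have "(\<Sum>h\<in>H. mat_tr (\<rho> h) * mat_tr (\<sigma> (inv h))) = 0"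
      using irrep_orthogonality_distinct[OF \<rho>(1) \<sigma>(1)] by blast
    moreover have "(\<Sum>h\<in>H. \<chi> h * \<psi> (inv h)) = (\<Sum>h\<in>H. mat_tr (\<rho> h) * mat_tr (\<sigma> (inv h)))"
      using \<rho>(2) \<sigma>(2) by (intro sum.cong) auto
    ultimately show ?thesis using False by simp
  qed
qed

lemma multiplicity:
  assumes "set cs \<subseteq> irr_chars G H" "\<psi> \<in> irr_chars G H"
  shows "(\<Sum>h\<in>H. (\<Sum>c\<leftarrow>cs. c h) * \<psi> (inv h)) = of_nat (count_list cs \<psi>) * of_nat (card H)"
  using assms(1)
proof (induction cs)
  case (Cons c cs)
  then show ?case
    using row_orthogonality[of c \<psi>] assms(2) by (auto simp: distrib_right sum.distrib)
qed simp

section \<open>Permutation characters and the regular character\<close>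

text \<open>Serves two actions: left translation of H on itself, giving the regular character, and
  the affine action on a near-field.\<close>

lemma permutation_rep:
  assumes fin: "finite Y" and act: "\<And>g x. g \<in> H \<Longrightarrow> x \<in> Y \<Longrightarrow> act g x \<in> Y" "\<And>x. x \<in> Y \<Longrightarrow> act \<one> x = x"
    "\<And>g h x. g \<in> H \<Longrightarrow> h \<in> H \<Longrightarrow> x \<in> Y \<Longrightarrow> act (g \<otimes> h) x = act g (act h x)"
  obtains \<rho> where "is_rep G H (card Y) \<rho>" "\<And>h. h \<in> H \<Longrightarrow> mat_tr (\<rho> h) = of_nat (card {x \<in> Y. act h x = x})"
proof -
  let ?n = "card Y"
  obtain e where e: "bij_betw e {..<?n} Y"
    using ex_bij_betw_nat_finite[OF fin] by (auto simp: lessThan_atLeast0)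
  then have eY: "e i \<in> Y" if "i < ?n" for i using that by (auto dest: bij_betwE)
  have e_inj: "e i = e j \<longleftrightarrow> i = j" if "i < ?n" "j < ?n" for i j
    using that e by (auto simp: bij_betw_def inj_on_def)
  define \<rho> :: "'a \<Rightarrow> complex mat" where "\<rho> h = mat ?n ?n (\<lambda>(i, j). if e i = act h (e j) then 1 else 0)" for h
  have "is_rep G H ?n \<rho>"
    unfolding is_rep_def
  proof (intro conjI ballI)
    show "\<rho> \<one> = 1\<^sub>m ?n"
      using eY e_inj by (intro eq_matI) (auto simp: \<rho>_def act(2))
  next
    fix g h assume gh: "g \<in> H" "h \<in> H"
    show "\<rho> (g \<otimes> h) = \<rho> g * \<rho> h"
    proof (intro eq_matI)
      fix i j assume "i < dim_row (\<rho> g * \<rho> h)" "j < dim_col (\<rho> g * \<rho> h)"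
      then have ij: "i < ?n" "j < ?n" by (auto simp: \<rho>_def)
      have hY: "act h (e j) \<in> Y" using act(1) gh(2) eY ij by auto
      have "(\<rho> g * \<rho> h) $$ (i, j) = (\<Sum>l<?n. \<rho> g $$ (i, l) * \<rho> h $$ (l, j))"
        using ij by (subst mat_mult_index_sum[of _ ?n ?n _ ?n]) (auto simp: \<rho>_def)
      also have "\<dots> = (\<Sum>l<?n. (if e i = act g (e l) then 1 else 0) * (if e l = act h (e j) then 1 else 0))"
        using ij by (intro sum.cong) (auto simp: \<rho>_def)
      also have "\<dots> = (\<Sum>x\<in>Y. (if e i = act g x then 1 else 0) * (if x = act h (e j) then 1 else 0))"
        by (rule sum.reindex_bij_betw[OF e])
      also have "\<dots> = (\<Sum>x\<in>Y. if x = act h (e j) then (if e i = act g (act h (e j)) then 1 else 0) else 0)"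
        by (intro sum.cong) auto
      also have "\<dots> = \<rho> (g \<otimes> h) $$ (i, j)"
        using fin hY ij gh eY by (simp add: \<rho>_def act(3))
      finally show "\<rho> (g \<otimes> h) $$ (i, j) = (\<rho> g * \<rho> h) $$ (i, j)" by simp
    qed (auto simp: \<rho>_def)
  qed (auto simp: \<rho>_def)
  moreover have "mat_tr (\<rho> h) = of_nat (card {x \<in> Y. act h x = x})" if "h \<in> H" for h
  proof -
    have "mat_tr (\<rho> h) = (\<Sum>i<?n. if act h (e i) = e i then 1 else 0)"
      unfolding mat_tr_def by (intro sum.cong) (auto simp: \<rho>_def)
    also have "\<dots> = (\<Sum>x\<in>Y. if act h x = x then 1 else 0)"
      by (rule sum.reindex_bij_betw[OF e])
    also have "\<dots> = of_nat (card {x \<in> Y. act h x = x})"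
      using fin by (simp add: sum.If_cases Int_def)
    finally show ?thesis .
  qed
  ultimately show thesis using that by blast
qed

text \<open>Left translation by h has a fixed point only for h = 1, so pairing its character with
  \<psi> leaves the single term |H| \<psi>(1). Degrees are positive, hence every irreducible
  character occurs in the list; this gives finiteness of \<open>irr_chars\<close> and, after
  grouping equal entries, the column relation.\<close>

lemma regular_character:
  "\<exists>cs. set cs = irr_chars G H \<and> (\<forall>\<psi>\<in>irr_chars G H. of_nat (count_list cs \<psi>) = \<psi> \<one>) \<and>
    (\<forall>h\<in>H. (\<Sum>c\<leftarrow>cs. c h) = (if h = \<one> then of_nat (card H) else 0))"
proof -
  obtain \<rho> where \<rho>: "is_rep G H (card H) \<rho>" "\<And>h. h \<in> H \<Longrightarrow> mat_tr (\<rho> h) = of_nat (card {x \<in> H. h \<otimes> x = x})"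
  proof -
    have act: "g \<otimes> h \<otimes> x = g \<otimes> (h \<otimes> x)" if "g \<in> H" "h \<in> H" "x \<in> H" for g h x
      using that by (simp add: m_assoc)
    show thesis
      by (rule permutation_rep[OF finite_H, of "(\<otimes>)", OF H_closed(2) l_one[OF H_closed(4)] act])
        (assumption | rule that)+
  qed
  obtain cs where cs: "set cs \<subseteq> irr_chars G H" "\<forall>h\<in>H. mat_tr (\<rho> h) = (\<Sum>c\<leftarrow>cs. c h)"
    using character_decomposition[OF \<rho>(1)] by blast
  have fixed: "{x \<in> H. h \<otimes> x = x} = (if h = \<one> then H else {})" if "h \<in> H" for h
    using that by auto
  have reg: "(\<Sum>c\<leftarrow>cs. c h) = (if h = \<one> then of_nat (card H) else 0)" if "h \<in> H" for h
    using bspec[OF cs(2) that] \<rho>(2)[OF that] fixed[OF that] by (cases "h = \<one>") auto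
  have count: "of_nat (count_list cs \<psi>) = \<psi> \<one>" if "\<psi> \<in> irr_chars G H" for \<psi>
  proof -
    have "of_nat (count_list cs \<psi>) * of_nat (card H) = (\<Sum>h\<in>H. (\<Sum>c\<leftarrow>cs. c h) * \<psi> (inv h))"
      using multiplicity[OF cs(1) that] by simp
    also have "\<dots> = (\<Sum>h\<in>H. if h = \<one> then of_nat (card H) * \<psi> \<one> else 0)"
      using reg by (intro sum.cong) auto
    also have "\<dots> = of_nat (card H) * \<psi> \<one>" using finite_H by simp
    finally show ?thesis using card_H_pos by simp
  qed
  have "\<psi> \<in> set cs" if "\<psi> \<in> irr_chars G H" for \<psi>
  proof -
    obtain n where "n > 0" "\<psi> \<one> = of_nat n" using irr_char_one[OF \<open>\<psi> \<in> irr_chars G H\<close>] by blast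
    then have "count_list cs \<psi> > 0" using count[OF \<open>\<psi> \<in> irr_chars G H\<close>] by simp
    then show ?thesis using count_list_0_iff[of cs \<psi>] by (metis less_numeral_extra(3))
  qed
  then have "set cs = irr_chars G H" using cs(1) by blast
  then show ?thesis using reg count by blast
qed

lemma finite_irr_chars: "finite (irr_chars G H)"
proof -
  obtain cs where "set cs = irr_chars G H" using regular_character by blast
  then show ?thesis using List.finite_set[of cs] by simp
qed

theorem column_orthogonality_one:
  assumes "h \<in> H"
  shows "(\<Sum>\<psi>\<in>irr_chars G H. \<psi> \<one> * \<psi> h) = (if h = \<one> then of_nat (card H) else 0)"
proof -
  obtain cs where cs: "set cs = irr_chars G H" "\<forall>\<psi>\<in>irr_chars G H. of_nat (count_list cs \<psi>) = \<psi> \<one>"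
    "\<forall>h\<in>H. (\<Sum>c\<leftarrow>cs. c h) = (if h = \<one> then of_nat (card H) else 0)"
    using regular_character by blast
  have "(\<Sum>c\<leftarrow>cs. c h) = (\<Sum>\<psi>\<in>set cs. of_nat (count_list cs \<psi>) * \<psi> h)"
    by (rule sum_list_eq_sum_count_list) auto
  also have "\<dots> = (\<Sum>\<psi>\<in>irr_chars G H. \<psi> \<one> * \<psi> h)" unfolding cs(1) using cs(2) by simp
  finally show ?thesis using cs(3) assms by simp
qed

end

section \<open>Transpositions commuting with the S-matrix\<close>

lemma transp_perm_mat_alt:
  "transp_perm_mat C F x y = (if y = transpose C F x then 1 else 0)"
  by (auto simp: transp_perm_mat_def transpose_def)

text \<open>Multiplying by the permutation matrix on the left permutes rows, on the right columns,
  and each sum collapses to one entry. Commuting thus means that the transposition may be moved from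
  one index of A to the other.\<close>

lemma commutes_on_transp_perm_mat:
  assumes "finite I" "C \<in> I" "F \<in> I"
  shows "commutes_on I (\<lambda>x y. of_nat (transp_perm_mat C F x y)) A
    \<longleftrightarrow> (\<forall>x\<in>I. \<forall>y\<in>I. A (transpose C F x) y = A x (transpose C F y))"
proof -
  have mem: "transpose C F x \<in> I" if "x \<in> I" for x using that assms by (simp add: transpose_def)
  have l: "(\<Sum>z\<in>I. of_nat (transp_perm_mat C F x z) * A z y) = A (transpose C F x) y" if "x \<in> I" for x y
  proof -
    have "(\<Sum>z\<in>I. of_nat (transp_perm_mat C F x z) * A z y)
      = (\<Sum>z\<in>I. if z = transpose C F x then A z y else 0)"
      by (intro sum.cong) (auto simp: transp_perm_mat_alt)
    then show ?thesis using assms(1) mem[OF that] by simp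
  qed
  have r: "(\<Sum>z\<in>I. A x z * of_nat (transp_perm_mat C F z y)) = A x (transpose C F y)" if "y \<in> I" for x y
  proof -
    have "(\<Sum>z\<in>I. A x z * of_nat (transp_perm_mat C F z y))
      = (\<Sum>z\<in>I. if z = transpose C F y then A x z else 0)"
      by (intro sum.cong) (auto simp: transp_perm_mat_def transpose_def)
    then show ?thesis using assms(1) mem[OF that] by simp
  qed
  show ?thesis unfolding commutes_on_def using l r by simp
qed

section \<open>Conjugation, simple objects and rows of the S-matrix\<close>

locale finite_grp = group G for G (structure) +
  assumes finite_carrier: "finite (carrier G)"
begin

lemma finite_subgroupI: "subgroup H G \<Longrightarrow> finite_subgroup G H"
  using finite_subset[OF subgroup.subset finite_carrier]
  by (simp add: finite_subgroup_def finite_subgroup_axioms_def group_axioms)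

lemma finite_subgroup_carrier: "finite_subgroup G (carrier G)"
  by (rule finite_subgroupI[OF subgroup_self])

lemma inv_conj: "g \<in> carrier G \<Longrightarrow> x \<in> carrier G \<Longrightarrow> inv (g \<otimes> x \<otimes> inv g) = g \<otimes> inv x \<otimes> inv g"
  by (simp add: inv_mult_group m_assoc)

lemma inv_conj': "g \<in> carrier G \<Longrightarrow> x \<in> carrier G \<Longrightarrow> inv (inv g \<otimes> x \<otimes> g) = inv g \<otimes> inv x \<otimes> g"
  by (simp add: inv_mult_group m_assoc)

lemma conj_cancel:
  assumes "g \<in> carrier G" "x \<in> carrier G"
  shows "g \<otimes> (inv g \<otimes> x \<otimes> g) \<otimes> inv g = x" "inv g \<otimes> (g \<otimes> x \<otimes> inv g) \<otimes> g = x"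
proof -
  have "g \<otimes> (inv g \<otimes> x \<otimes> g) \<otimes> inv g = (g \<otimes> inv g) \<otimes> x \<otimes> (g \<otimes> inv g)"
    "inv g \<otimes> (g \<otimes> x \<otimes> inv g) \<otimes> g = (inv g \<otimes> g) \<otimes> x \<otimes> (inv g \<otimes> g)"
    using assms by (simp_all only: m_assoc inv_closed m_closed)
  then show "g \<otimes> (inv g \<otimes> x \<otimes> g) \<otimes> inv g = x" "inv g \<otimes> (g \<otimes> x \<otimes> inv g) \<otimes> g = x"
    using assms by simp_all
qed

lemma conj_mult:
  assumes "g \<in> carrier G" "x \<in> carrier G" "y \<in> carrier G"
  shows "g \<otimes> (x \<otimes> y) \<otimes> inv g = (g \<otimes> x \<otimes> inv g) \<otimes> (g \<otimes> y \<otimes> inv g)"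
proof -
  have "(g \<otimes> x \<otimes> inv g) \<otimes> (g \<otimes> y \<otimes> inv g) = g \<otimes> x \<otimes> (inv g \<otimes> g) \<otimes> y \<otimes> inv g"
    using assms by (simp only: m_assoc inv_closed m_closed)
  then show ?thesis using assms by (simp add: m_assoc)
qed

lemma conj_conj:
  assumes "g \<in> carrier G" "h \<in> carrier G" "x \<in> carrier G"
  shows "g \<otimes> (h \<otimes> x \<otimes> inv h) \<otimes> inv g = (g \<otimes> h) \<otimes> x \<otimes> inv (g \<otimes> h)"
  using assms by (simp add: m_assoc inv_mult_group)

lemma conj_eq_iff:
  assumes "g \<in> carrier G" "x \<in> carrier G" "y \<in> carrier G"
  shows "g \<otimes> x \<otimes> inv g = y \<longleftrightarrow> x = inv g \<otimes> y \<otimes> g"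
  using assms conj_cancel by auto

lemma centr_subgroup: "a \<in> carrier G \<Longrightarrow> subgroup (centr G a) G"
proof (rule subgroupI)
  assume a: "a \<in> carrier G"
  show "centr G a \<subseteq> carrier G" "centr G a \<noteq> {}"
    using a by (auto simp: centr_def intro!: exI[of _ \<one>])
  fix x assume "x \<in> centr G a"
  then have x: "x \<in> carrier G" "x \<otimes> a = a \<otimes> x" by (auto simp: centr_def)
  then have "inv x \<otimes> (x \<otimes> a) \<otimes> inv x = inv x \<otimes> (a \<otimes> x) \<otimes> inv x" by simp
  then have "(inv x \<otimes> x) \<otimes> a \<otimes> inv x = inv x \<otimes> a \<otimes> (x \<otimes> inv x)"
    using x(1) a by (simp only: m_assoc inv_closed m_closed)
  then have "a \<otimes> inv x = inv x \<otimes> a" using x a by simp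
  then show "inv x \<in> centr G a" using x by (auto simp: centr_def)
  fix y assume "y \<in> centr G a"
  then show "x \<otimes> y \<in> centr G a" using x a by (auto simp: centr_def m_assoc) (metis m_assoc)
qed

lemma centr_finite_subgroup: "a \<in> carrier G \<Longrightarrow> finite_subgroup G (centr G a)"
  by (rule finite_subgroupI[OF centr_subgroup])

lemma centr_one: "centr G \<one> = carrier G"
  by (auto simp: centr_def)

lemma self_centr: "a \<in> carrier G \<Longrightarrow> a \<in> centr G a"
  by (auto simp: centr_def)

lemma centr_iff_conj:
  assumes "a \<in> carrier G" "h \<in> carrier G"
  shows "h \<in> centr G a \<longleftrightarrow> h \<otimes> a \<otimes> inv h = a"
proof -
  have "h \<otimes> a \<otimes> inv h = a \<longleftrightarrow> h \<otimes> a = a \<otimes> h"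
    using assms by (metis inv_solve_right m_closed)
  then show ?thesis using assms by (simp add: centr_def)
qed

lemma conj_class_self: "a \<in> carrier G \<Longrightarrow> a \<in> conj_class G a"
  unfolding conj_class_def by (auto intro!: exI[of _ \<one>])

lemma one_notin_conj_class:
  assumes "a \<in> carrier G" "a \<noteq> \<one>"
  shows "\<one> \<notin> conj_class G a"
proof
  assume "\<one> \<in> conj_class G a"
  then obtain g where "g \<in> carrier G" "g \<otimes> a \<otimes> inv g = \<one>" by (auto simp: conj_class_def)
  then show False using conj_eq_iff[of g a \<one>] assms by simp
qed

lemma conj_class_closed: "a \<in> carrier G \<Longrightarrow> conj_class G a \<subseteq> carrier G"
  unfolding conj_class_def by auto

lemma conj_class_trans:
  assumes "a \<in> carrier G" "b \<in> conj_class G a"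
  shows "conj_class G b \<subseteq> conj_class G a"
proof
  fix c assume "c \<in> conj_class G b"
  then obtain g h where gh: "g \<in> carrier G" "h \<in> carrier G" "b = g \<otimes> a \<otimes> inv g" "c = h \<otimes> b \<otimes> inv h"
    using assms by (auto simp: conj_class_def)
  then have "c = (h \<otimes> g) \<otimes> a \<otimes> inv (h \<otimes> g)" using assms conj_conj by simp
  then show "c \<in> conj_class G a" unfolding conj_class_def using gh by blast
qed

lemma conj_class_sym:
  assumes "a \<in> carrier G" "b \<in> conj_class G a"
  shows "a \<in> conj_class G b"
proof -
  obtain g where g: "g \<in> carrier G" "b = g \<otimes> a \<otimes> inv g" using assms by (auto simp: conj_class_def)
  then have "a = inv g \<otimes> b \<otimes> inv (inv g)" using assms conj_cancel by simp
  then show ?thesis unfolding conj_class_def using g by blast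
qed

lemma conj_class_eq:
  assumes "a \<in> carrier G" "b \<in> conj_class G a"
  shows "conj_class G b = conj_class G a"
  using assms conj_class_trans conj_class_sym conj_class_closed by (meson subset_antisym subsetD)

text \<open>The choice is made from the class as a set, so equal classes have literally equal
  representatives; uniqueness of representatives rests on this.\<close>

lemma class_reps_SOME:
  assumes "r \<in> class_reps G"
  shows "r \<in> carrier G" "r = (SOME x. x \<in> conj_class G r)"
proof -
  obtain a where a: "a \<in> carrier G" "r = (SOME x. x \<in> conj_class G a)"
    using assms by (auto simp: class_reps_def)
  have r: "r \<in> conj_class G a" using conj_class_self[OF a(1)] unfolding a(2) by (rule someI)
  then show "r \<in> carrier G" "r = (SOME x. x \<in> conj_class G r)"
    using a conj_class_closed conj_class_eq[OF a(1) r] by auto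
qed

lemma class_reps_unique: "r \<in> class_reps G \<Longrightarrow> s \<in> class_reps G \<Longrightarrow> s \<in> conj_class G r \<Longrightarrow> s = r"
  using class_reps_SOME conj_class_eq by metis

lemma class_reps_ex:
  assumes "a \<in> carrier G"
  shows "\<exists>r\<in>class_reps G. r \<in> conj_class G a"
proof -
  have "(SOME x. x \<in> conj_class G a) \<in> conj_class G a"
    using conj_class_self[OF assms] by (rule someI)
  moreover have "(SOME x. x \<in> conj_class G a) \<in> class_reps G"
    using assms by (auto simp: class_reps_def)
  ultimately show ?thesis by blast
qed

text \<open>The class of 1 is a singleton, which leaves no freedom to the choice. This makes the
  trivial object and all chargeons, whose first component is literally 1, simple objects.\<close>

lemma one_class_reps: "\<one> \<in> class_reps G"
proof -
  obtain r where "r \<in> class_reps G" "r \<in> conj_class G \<one>" using class_reps_ex[OF one_closed] by blast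
  moreover have "conj_class G \<one> = {\<one>}" by (auto simp: conj_class_def intro!: exI[of _ \<one>])
  ultimately show ?thesis by simp
qed

lemma simplesD:
  assumes "(b, \<psi>) \<in> simples G"
  shows "b \<in> class_reps G" "b \<in> carrier G" "\<psi> \<in> irr_chars G (centr G b)"
  using assms class_reps_SOME by (auto simp: simples_def)

lemma simplesI: "b \<in> class_reps G \<Longrightarrow> \<psi> \<in> irr_chars G (centr G b) \<Longrightarrow> (b, \<psi>) \<in> simples G"
  by (auto simp: simples_def)

lemma finite_simples: "finite (simples G)"
proof -
  have "simples G = (SIGMA b:class_reps G. irr_chars G (centr G b))"
    by (auto simp: simples_def)
  moreover have "finite (class_reps G)"
    using finite_subset[OF _ finite_carrier] class_reps_SOME(1) by blast
  ultimately show ?thesis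
    using finite_subgroup.finite_irr_chars[OF centr_finite_subgroup] class_reps_SOME(1) by auto
qed

lemma zero_obj_simple: "zero_obj G \<in> simples G"
  using finite_subgroup.triv_char_irr[OF finite_subgroup_carrier] one_class_reps
  by (auto simp: zero_obj_def simples_def centr_one)

text \<open>Inverting h exchanges the two index sets: h b h^-1 commutes with a exactly if h^-1 a h
  commutes with b.\<close>

lemma S_mat_sym: 
  assumes "x \<in> simples G" "y \<in> simples G"
  shows "S_mat G x y = S_mat G y x"
proof -
  obtain a \<chi> b \<psi> where xy: "x = (a, \<chi>)" "y = (b, \<psi>)" by (metis surj_pair)
  have ab: "a \<in> carrier G" "b \<in> carrier G" using simplesD assms xy by auto
  have mem: "inv h \<otimes> a \<otimes> h \<in> centr G b" if "h \<in> carrier G" "h \<otimes> b \<otimes> inv h \<in> centr G a" for h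
  proof -
    have "(h \<otimes> b \<otimes> inv h) \<otimes> a \<otimes> inv (h \<otimes> b \<otimes> inv h) = a"
      using that ab centr_iff_conj by simp
    then have "a \<otimes> (h \<otimes> b \<otimes> inv h) = (h \<otimes> b \<otimes> inv h) \<otimes> a"
      using that by (simp add: centr_def)
    then have "inv h \<otimes> (a \<otimes> (h \<otimes> b \<otimes> inv h)) \<otimes> h = inv h \<otimes> ((h \<otimes> b \<otimes> inv h) \<otimes> a) \<otimes> h" by simp
    then have "(inv h \<otimes> a \<otimes> h) \<otimes> (b \<otimes> (inv h \<otimes> h)) = (inv h \<otimes> h) \<otimes> b \<otimes> (inv h \<otimes> a \<otimes> h)"
      using that ab by (simp only: m_assoc inv_closed m_closed)
    then show ?thesis using that ab by (auto simp: centr_def)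
  qed
  have "(\<Sum>h\<in>{h \<in> carrier G. h \<otimes> b \<otimes> inv h \<in> centr G a}. \<chi> (h \<otimes> inv b \<otimes> inv h) * \<psi> (inv h \<otimes> inv a \<otimes> h))
      = (\<Sum>h\<in>{h \<in> carrier G. h \<otimes> a \<otimes> inv h \<in> centr G b}. \<psi> (h \<otimes> inv a \<otimes> inv h) * \<chi> (inv h \<otimes> inv b \<otimes> h))"
  proof (rule sum.reindex_bij_witness[of _ "\<lambda>h. inv h" "\<lambda>h. inv h"])
    fix h assume "h \<in> {h \<in> carrier G. h \<otimes> b \<otimes> inv h \<in> centr G a}"
    then show "inv h \<in> {h \<in> carrier G. h \<otimes> a \<otimes> inv h \<in> centr G b}" using mem by simp
  next
    fix h assume "h \<in> {h \<in> carrier G. h \<otimes> a \<otimes> inv h \<in> centr G b}"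
    then have h: "h \<in> carrier G" "h \<otimes> a \<otimes> inv h \<in> centr G b" by auto
    have "h \<otimes> a \<otimes> inv h \<otimes> b = b \<otimes> (h \<otimes> a \<otimes> inv h)" using h by (simp add: centr_def)
    then have "inv h \<otimes> (h \<otimes> a \<otimes> inv h \<otimes> b) \<otimes> h = inv h \<otimes> (b \<otimes> (h \<otimes> a \<otimes> inv h)) \<otimes> h" by simp
    then have "(inv h \<otimes> h) \<otimes> a \<otimes> (inv h \<otimes> b \<otimes> h) = (inv h \<otimes> b \<otimes> h) \<otimes> (a \<otimes> (inv h \<otimes> h))"
      using h ab by (simp only: m_assoc inv_closed m_closed)
    then show "inv h \<in> {h \<in> carrier G. h \<otimes> b \<otimes> inv h \<in> centr G a}"
      using h ab by (auto simp: centr_def)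
  qed auto
  then show ?thesis unfolding xy S_mat_def by (simp add: mult.commute)
qed

text \<open>Every element centralizes 1 and \<chi> absorbs conjugation, so all summands agree and
  their number |G| cancels against |Z(1)|.\<close>

lemma S_mat_chargeon:
  assumes \<chi>: "\<chi> \<in> irr_chars G (carrier G)" and b: "b \<in> carrier G"
  shows "S_mat G (\<one>, \<chi>) (b, \<psi>) = \<chi> (inv b) * \<psi> \<one> / of_nat (card (centr G b))"
proof -
  note class_function = finite_subgroup.irr_char_class_function[OF finite_subgroup_carrier \<chi>]
  have "(\<Sum>h\<in>{h \<in> carrier G. h \<otimes> b \<otimes> inv h \<in> centr G \<one>}. \<chi> (h \<otimes> inv b \<otimes> inv h) * \<psi> (inv h \<otimes> inv \<one> \<otimes> h))
    = (\<Sum>h\<in>carrier G. \<chi> (inv b) * \<psi> \<one>)"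
    using b class_function by (intro sum.cong) (auto simp: centr_one)
  then show ?thesis unfolding S_mat_def using finite_subgroup.card_H_pos[OF finite_subgroup_carrier]
    by (simp add: centr_one)
qed

text \<open>The index condition puts the argument of the trivial character into Z(a), where it is 1.
  What remains is a sum of \<psi> over conjugates of a^-1, the quantity that both directions have to
  evaluate.\<close>

lemma S_mat_fluxion:
  assumes a: "a \<in> carrier G" and b: "b \<in> carrier G"
  shows "S_mat G (a, triv_char (centr G a)) (b, \<psi>)
    = (\<Sum>h\<in>{h \<in> carrier G. h \<otimes> b \<otimes> inv h \<in> centr G a}. \<psi> (inv h \<otimes> inv a \<otimes> h))
      / (of_nat (card (centr G a)) * of_nat (card (centr G b)))"
proof -
  have "(\<Sum>h\<in>{h \<in> carrier G. h \<otimes> b \<otimes> inv h \<in> centr G a}.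
      triv_char (centr G a) (h \<otimes> inv b \<otimes> inv h) * \<psi> (inv h \<otimes> inv a \<otimes> h))
    = (\<Sum>h\<in>{h \<in> carrier G. h \<otimes> b \<otimes> inv h \<in> centr G a}. \<psi> (inv h \<otimes> inv a \<otimes> h))"
  proof (intro sum.cong refl)
    fix h assume "h \<in> {h \<in> carrier G. h \<otimes> b \<otimes> inv h \<in> centr G a}"
    then have "inv (h \<otimes> b \<otimes> inv h) \<in> centr G a" "h \<in> carrier G"
      using subgroup.m_inv_closed[OF centr_subgroup[OF a]] by auto
    then have "h \<otimes> inv b \<otimes> inv h \<in> centr G a" using b inv_conj by simp
    then show "triv_char (centr G a) (h \<otimes> inv b \<otimes> inv h) * \<psi> (inv h \<otimes> inv a \<otimes> h) = \<psi> (inv h \<otimes> inv a \<otimes> h)"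
      by (simp add: triv_char_def)
  qed
  then show ?thesis unfolding S_mat_def by simp
qed

text \<open>The normalization at the trivial object says that the transposition fixes it. The
  equalities of entries are the exchange relation for the pair (C, F) and for the pairs (F,
  y).\<close>

lemma transposition_invariantD:
  assumes CF: "C \<in> simples G" "F \<in> simples G" "C \<noteq> F"
    and inv: "modular_invariant G (transp_perm_mat C F)"
  shows "C \<noteq> zero_obj G" "F \<noteq> zero_obj G" "S_mat G C C = S_mat G F F"
    "\<And>y. y \<in> simples G \<Longrightarrow> y \<noteq> C \<Longrightarrow> y \<noteq> F \<Longrightarrow> S_mat G C y = S_mat G F y"
proof -
  have "transp_perm_mat C F (zero_obj G) (zero_obj G) = 1" using inv by (auto simp: modular_invariant_def)
  then show "C \<noteq> zero_obj G" "F \<noteq> zero_obj G"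
    using CF(3) by (auto simp: transp_perm_mat_def split: if_splits)
  have *: "S_mat G (transpose C F x) y = S_mat G x (transpose C F y)" if "x \<in> simples G" "y \<in> simples G" for x y
    using inv that commutes_on_transp_perm_mat[OF finite_simples CF(1,2), of "S_mat G"]
    by (auto simp: modular_invariant_def)
  show "S_mat G C C = S_mat G F F" using *[of C F] CF by simp
  show "S_mat G C y = S_mat G F y" if "y \<in> simples G" "y \<noteq> C" "y \<noteq> F" for y
    using *[of F y] CF that by (simp add: transpose_apply_other)
qed

text \<open>Symmetry of S turns equal rows into equal columns and settles the mixed entries, because
  S(C,F) = S(F,C). For the diagonal T only the two exchanged entries have to agree.\<close>

lemma transposition_invariantI:
  assumes CF: "C \<in> simples G" "F \<in> simples G" "C \<noteq> zero_obj G" "F \<noteq> zero_obj G"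
    and T: "T_mat G C C = T_mat G F F" and S: "S_mat G C C = S_mat G F F"
    "\<And>y. y \<in> simples G \<Longrightarrow> y \<noteq> C \<Longrightarrow> y \<noteq> F \<Longrightarrow> S_mat G C y = S_mat G F y"
  shows "modular_invariant G (transp_perm_mat C F)"
  unfolding modular_invariant_def
proof (intro conjI)
  show "transp_perm_mat C F (zero_obj G) (zero_obj G) = 1"
    using CF by (auto simp: transp_perm_mat_def)
  have T': "T_mat G (transpose C F x) y = T_mat G x (transpose C F y)" for x y
  proof (cases "transpose C F x = y")
    case True
    then have "x = transpose C F y" by auto
    moreover have "T_mat G (transpose C F y) (transpose C F y) = T_mat G y y"
      using T by (cases "y = C"; cases "y = F") (auto simp: transpose_apply_other)
    ultimately show ?thesis by simp
  next
    case False
    then have "x \<noteq> transpose C F y" by auto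
    then show ?thesis using False by (simp add: T_mat_def)
  qed
  then show "commutes_on (simples G) (\<lambda>x y. of_nat (transp_perm_mat C F x y)) (T_mat G)"
    using commutes_on_transp_perm_mat[OF finite_simples CF(1,2)] by blast
  have S': "S_mat G (transpose C F x) y = S_mat G x (transpose C F y)"
    if "x \<in> simples G" "y \<in> simples G" for x y
  proof -
    have sym: "S_mat G x C = S_mat G C x" "S_mat G x F = S_mat G F x" "S_mat G F C = S_mat G C F"
      using S_mat_sym that CF by auto
    note eqs = S(1) S(2)[OF that(1)] S(2)[OF that(2)] sym
    consider "x = C" | "x = F" | "x \<noteq> C" "x \<noteq> F" by blast
    then show ?thesis
    proof cases
      case 1
      then show ?thesis using eqs by (metis transpose_apply_first transpose_apply_second transpose_apply_other)
    next
      case 2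
      then show ?thesis using eqs by (metis transpose_apply_first transpose_apply_second transpose_apply_other)
    next
      case 3
      then show ?thesis using eqs by (metis transpose_apply_first transpose_apply_second transpose_apply_other)
    qed
  qed
  then show "commutes_on (simples G) (\<lambda>x y. of_nat (transp_perm_mat C F x y)) (S_mat G)"
    using commutes_on_transp_perm_mat[OF finite_simples CF(1,2)] by blast
qed

end

section \<open>Sufficient conditions for an invariant transposition\<close>

text \<open>By row orthogonality the norm is |H| times the sum of the squared multiplicities. The
  trivial character has multiplicity 1, and 2 = 1 + 1 leaves room for exactly one further
  constituent, of multiplicity 1.\<close>

lemma (in finite_subgroup) irr_char_of_norm_two:
  assumes cs: "set cs \<subseteq> irr_chars G H" and \<theta>: "\<And>h. h \<in> H \<Longrightarrow> \<theta> h = (\<Sum>c\<leftarrow>cs. c h)"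
    and one: "(\<Sum>h\<in>H. \<theta> h) = of_nat (card H)"
    and norm: "(\<Sum>h\<in>H. \<theta> h * \<theta> (inv h)) = 2 * of_nat (card H)"
  shows "(\<lambda>h. if h \<in> H then \<theta> h - 1 else 0) \<in> irr_chars G H"
proof -
  let ?n = "count_list cs" and ?A = "set cs - {triv_char H}"
  have mult: "(\<Sum>h\<in>H. \<theta> h * \<psi> (inv h)) = of_nat (?n \<psi>) * of_nat (card H)"
    if "\<psi> \<in> irr_chars G H" for \<psi>
    using multiplicity[OF cs that] \<theta> by simp
  have pos: "card H \<noteq> 0" using card_H_pos by simp
  have "(\<Sum>h\<in>H. \<theta> h * triv_char H (inv h)) = (\<Sum>h\<in>H. \<theta> h)"
    by (intro sum.cong) (auto simp: triv_char_def)
  then have "of_nat (?n (triv_char H)) * of_nat (card H) = (of_nat (card H) :: complex)"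
    using mult[OF triv_char_irr] one by simp
  then have n1: "?n (triv_char H) = 1" using pos by simp
  have "(\<Sum>h\<in>H. \<theta> h * \<theta> (inv h)) = (\<Sum>h\<in>H. \<Sum>c\<in>set cs. of_nat (?n c) * (\<theta> h * c (inv h)))"
  proof (rule sum.cong[OF refl])
    fix h assume "h \<in> H"
    then have "\<theta> (inv h) = (\<Sum>c\<in>set cs. of_nat (?n c) * c (inv h))"
      using \<theta>[of "inv h"] sum_list_eq_sum_count_list[of "set cs" cs "\<lambda>c. c (inv h)"] by simp
    then show "\<theta> h * \<theta> (inv h) = (\<Sum>c\<in>set cs. of_nat (?n c) * (\<theta> h * c (inv h)))"
      by (simp add: sum_distrib_left mult.left_commute)
  qed
  also have "\<dots> = (\<Sum>c\<in>set cs. of_nat (?n c) * (\<Sum>h\<in>H. \<theta> h * c (inv h)))"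
    by (subst sum.swap) (simp add: sum_distrib_left)
  also have "\<dots> = (\<Sum>c\<in>set cs. of_nat (?n c) * (of_nat (?n c) * of_nat (card H)))"
  proof (rule sum.cong[OF refl])
    fix c assume "c \<in> set cs"
    then have "c \<in> irr_chars G H" using cs by blast
    then show "of_nat (?n c) * (\<Sum>h\<in>H. \<theta> h * c (inv h)) = of_nat (?n c) * (of_nat (?n c) * of_nat (card H))"
      using mult by simp
  qed
  also have "\<dots> = of_nat (\<Sum>c\<in>set cs. ?n c * ?n c) * of_nat (card H)"
    by (simp add: sum_distrib_right mult.assoc)
  finally have "of_nat (\<Sum>c\<in>set cs. ?n c * ?n c) * of_nat (card H) = (of_nat 2 * of_nat (card H) :: complex)"
    using norm by simp
  then have "of_nat (\<Sum>c\<in>set cs. ?n c * ?n c) = (of_nat 2 :: complex)" using pos by simp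
  then have total: "(\<Sum>c\<in>set cs. ?n c * ?n c) = 2" by (simp only: of_nat_eq_iff)
  have triv: "triv_char H \<in> set cs" using n1 count_list_0_iff[of cs "triv_char H"] by fastforce
  have A: "(\<Sum>c\<in>?A. ?n c * ?n c) = 1"
    using total n1 by (simp add: sum.remove[OF _ triv])
  have npos: "?n c \<ge> 1" if "c \<in> ?A" for c
    using that count_list_0_iff[of cs c] by fastforce
  have "?A \<noteq> {}" using A by (metis sum.empty zero_neq_one)
  then obtain \<chi> where \<chi>: "\<chi> \<in> ?A" by blast
  have split: "?n \<chi> * ?n \<chi> + (\<Sum>c\<in>?A - {\<chi>}. ?n c * ?n c) = 1"
    using A by (simp add: sum.remove[OF _ \<chi>])
  moreover have "?n \<chi> * ?n \<chi> \<ge> 1" using npos[OF \<chi>] by simp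
  ultimately have n\<chi>: "?n \<chi> * ?n \<chi> = 1" and rest: "(\<Sum>c\<in>?A - {\<chi>}. ?n c * ?n c) = 0" by linarith+
  have "?A - {\<chi>} = {}"
  proof (rule ccontr)
    assume "?A - {\<chi>} \<noteq> {}"
    then obtain c where c: "c \<in> ?A - {\<chi>}" by blast
    have "finite (?A - {\<chi>})" by simp
    then have "\<forall>c\<in>?A - {\<chi>}. ?n c * ?n c = 0" using rest by (subst (asm) sum_eq_0_iff)
    then have "?n c * ?n c = 0" using c by blast
    then show False using npos[of c] c by simp
  qed
  then have "set cs = {triv_char H, \<chi>}" "triv_char H \<noteq> \<chi>" using triv \<chi> by auto
  then have "\<theta> h = 1 + \<chi> h" if "h \<in> H" for h
    using that \<theta>[OF that] sum_list_eq_sum_count_list[of "set cs" cs "\<lambda>c. c h"] n1 n\<chi>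
    by (simp add: triv_char_def)
  moreover have \<chi>_irr: "\<chi> \<in> irr_chars G H" using \<chi> cs by blast
  ultimately have "(\<lambda>h. if h \<in> H then \<theta> h - 1 else 0) = \<chi>"
    using irr_char_outside[OF \<chi>_irr] by (intro ext) auto
  then show ?thesis using \<chi>_irr by simp
qed

context finite_grp
begin

text \<open>The identity, the rest of K and the complement of K are the three regions on which the
  characters summed below take simple values.\<close>

lemma sum_carrier_split:
  assumes "subgroup K G"
  shows "(\<Sum>h\<in>carrier G. f h) = f \<one> + (\<Sum>k\<in>K - {\<one>}. f k) + (\<Sum>h\<in>carrier G - K. f h)"
proof -
  have K: "K \<subseteq> carrier G" "\<one> \<in> K" using subgroup.subset subgroup.one_closed assms by auto
  have "(\<Sum>h\<in>carrier G. f h) = (\<Sum>h\<in>carrier G - K. f h) + (\<Sum>k\<in>K. f k)"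
    by (rule sum.subset_diff[OF K(1) finite_carrier])
  also have "(\<Sum>k\<in>K. f k) = f \<one> + (\<Sum>k\<in>K - {\<one>}. f k)"
    using K finite_subset[OF K(1) finite_carrier] by (simp add: sum.remove)
  finally show ?thesis by (simp add: algebra_simps)
qed

text \<open>Keeps of an affine group only what the S-matrix sees: the classes and centralizers
  inside the translation subgroup K, and the values of \<chi>, a permutation character minus 1. The
  position of b decides why the rows agree: outside K both entries vanish, at 1 the reason is
  orthogonality to \<chi>, at a it is orthogonality to the trivial character of K.\<close>

lemma chargeon_fluxion_transposition_invariant:
  assumes K: "subgroup K G" "card K > 1" and card_G: "card (carrier G) = card K * (card K - 1)"
    and normal: "\<And>g k. g \<in> carrier G \<Longrightarrow> k \<in> K \<Longrightarrow> g \<otimes> k \<otimes> inv g \<in> K"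
    and centr: "\<And>a. a \<in> K \<Longrightarrow> a \<noteq> \<one> \<Longrightarrow> centr G a = K"
    and conj: "\<And>a b. a \<in> K \<Longrightarrow> a \<noteq> \<one> \<Longrightarrow> b \<in> K \<Longrightarrow> b \<noteq> \<one> \<Longrightarrow> b \<in> conj_class G a"
    and \<chi>: "\<chi> \<in> irr_chars G (carrier G)" and \<chi>1: "\<chi> \<one> = of_nat (card K - 1)"
    and \<chi>K: "\<And>k. k \<in> K \<Longrightarrow> k \<noteq> \<one> \<Longrightarrow> \<chi> k = -1"
    and \<chi>0: "\<And>g. g \<in> carrier G \<Longrightarrow> g \<notin> K \<Longrightarrow> \<chi> g = 0"
  shows "\<exists>C F. is_chargeon G C \<and> is_fluxion G F \<and> C \<noteq> F \<and> modular_invariant G (transp_perm_mat C F)"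
proof -
  define d where "d = card K - 1"
  have d: "d > 0" "card K = d + 1" "card (carrier G) = (d + 1) * d" "\<chi> \<one> = of_nat d"
    using K card_G \<chi>1 by (auto simp: d_def)
  have KG: "k \<in> K \<Longrightarrow> k \<in> carrier G" for k using subgroup.mem_carrier[OF K(1)] .
  have one: "\<one> \<in> K" using subgroup.one_closed[OF K(1)] .
  have finK: "finite K" using K(2) card_ge_0_finite by force
  have invK: "inv k \<in> K" if "k \<in> K" for k using subgroup.m_inv_closed[OF K(1) that] .
  have inv_notin: "inv g \<notin> K" if "g \<in> carrier G" "g \<notin> K" for g using invK that by (metis inv_inv)
  have inv_ne: "inv k \<noteq> \<one>" if "k \<in> carrier G" "k \<noteq> \<one>" for k using that by (metis inv_inv inv_one)
  have cardK1: "card (K - {\<one>}) = d" using finK one d by simp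
  obtain k where k: "k \<in> K" "k \<noteq> \<one>" using cardK1 d(1) by (metis card.empty Diff_eq_empty_iff insertI1 less_numeral_extra(3) singletonD subsetI)
  \<comment> \<open>A fluxion is labelled by the chosen representative of its class, so a has to be
    that representative rather than an arbitrary k.\<close>
  obtain a where a: "a \<in> class_reps G" "a \<in> conj_class G k" using class_reps_ex[OF KG[OF k(1)]] by blast
  have aK: "a \<in> K" using a(2) normal k by (auto simp: conj_class_def)
  have a1: "a \<noteq> \<one>" using a(2) one_notin_conj_class[OF KG[OF k(1)] k(2)] by blast
  note aG = KG[OF aK]
  define C where "C = (\<one>, \<chi>)"
  define F where "F = (a, triv_char (centr G a))"
  have CS: "C \<in> simples G" unfolding C_def using one_class_reps \<chi> by (intro simplesI) (auto simp: centr_one)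
  have FS: "F \<in> simples G"
    unfolding F_def using a(1) finite_subgroup.triv_char_irr[OF centr_finite_subgroup[OF aG]] by (intro simplesI)
  have cen: "centr G a = K" using centr aK a1 by blast
  have "modular_invariant G (transp_perm_mat C F)"
  proof (rule transposition_invariantI[OF CS FS])
    \<comment> \<open>The value -1 at a separates \<chi> from the trivial character also when both
      have degree 1, that is for |K| = 2.\<close>
    have "\<chi> a \<noteq> triv_char (carrier G) a" using \<chi>K[OF aK a1] aG by (simp add: triv_char_def)
    then show "C \<noteq> zero_obj G" unfolding C_def zero_obj_def by auto
    show "F \<noteq> zero_obj G" using a1 by (simp add: F_def zero_obj_def)
    show "T_mat G C C = T_mat G F F"
      using d aK one by (simp add: T_mat_def C_def F_def cen triv_char_def)
    have "{h \<in> carrier G. h \<otimes> a \<otimes> inv h \<in> centr G a} = carrier G"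
      using normal aK by (auto simp: cen)
    moreover have "triv_char K (inv h \<otimes> inv a \<otimes> h) = 1" if "h \<in> carrier G" for h
      using normal[of "inv h" "inv a"] that invK[OF aK] by (simp add: triv_char_def)
    ultimately have "S_mat G F F = of_nat (card (carrier G)) / (of_nat (card K) * of_nat (card K))"
      unfolding F_def by (subst S_mat_fluxion[OF aG aG]) (simp add: cen)
    moreover have "S_mat G C C = of_nat d * of_nat d / of_nat (card (carrier G))"
      unfolding C_def by (subst S_mat_chargeon[OF \<chi> one_closed]) (simp add: centr_one d(4))
    moreover have "of_nat d + 1 \<noteq> (0 :: complex)" by (metis of_nat_Suc of_nat_eq_0_iff old.nat.distinct(1) add.commute)
    \<comment> \<open>Both diagonal entries are d / (d + 1): one arises as d^2 / |G|, the other as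
      |G| / |K|^2.\<close>
    moreover have "D * D / ((D + 1) * D) = (D + 1) * D / ((D + 1) * (D + 1))"
      if "D \<noteq> 0" "D + 1 \<noteq> 0" for D :: complex using that by simp
    ultimately show "S_mat G C C = S_mat G F F"
      unfolding d(2,3) using d(1) by (simp only: of_nat_mult of_nat_add of_nat_1 of_nat_eq_0_iff) simp
  next
    fix y assume y: "y \<in> simples G" "y \<noteq> C" "y \<noteq> F"
    obtain b \<psi> where yb: "y = (b, \<psi>)" by (cases y)
    note b = simplesD[OF y(1)[unfolded yb]]
    have Zpos: "card (centr G b) \<noteq> 0"
      using finite_subgroup.card_H_pos[OF centr_finite_subgroup[OF b(2)]] by simp
    have Kpos: "of_nat (card K) \<noteq> (0 :: complex)" using K(2) by simp
    \<comment> \<open>The equality of the two entries after clearing the denominators |K| and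
      |Z(b)|.\<close>
    have "(\<Sum>h\<in>{h \<in> carrier G. h \<otimes> b \<otimes> inv h \<in> centr G a}. \<psi> (inv h \<otimes> inv a \<otimes> h))
      = of_nat (card K) * (\<chi> (inv b) * \<psi> \<one>)"
    proof (cases "b \<in> K")
      case False
      \<comment> \<open>K is normal, so no conjugate of b enters it and the sum is empty; the other
        side is 0 because \<chi> vanishes off K.\<close>
      have "h \<otimes> b \<otimes> inv h \<notin> K" if h: "h \<in> carrier G" for h
      proof
        assume "h \<otimes> b \<otimes> inv h \<in> K"
        then have "inv h \<otimes> (h \<otimes> b \<otimes> inv h) \<otimes> inv (inv h) \<in> K" using normal h by blast
        then show False using False h b conj_cancel by simp
      qed
      then have empty: "{h \<in> carrier G. h \<otimes> b \<otimes> inv h \<in> centr G a} = {}" by (auto simp: cen)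
      show ?thesis unfolding empty using \<chi>0[of "inv b"] inv_notin[OF b(2) False] b by simp
    next
      case True
      have all: "{h \<in> carrier G. h \<otimes> b \<otimes> inv h \<in> centr G a} = carrier G"
        using normal True by (auto simp: cen)
      show ?thesis
      proof (cases "b = \<one>")
        case True
        have \<psi>: "\<psi> \<in> irr_chars G (carrier G)" using b(3) True by (simp add: centr_one)
        have \<psi>\<chi>: "\<psi> \<noteq> \<chi>" using y True by (auto simp: yb C_def)
        note cl = finite_subgroup.irr_char_class_function[OF finite_subgroup_carrier \<psi>]
        have \<psi>conj: "\<psi> k' = \<psi> (inv a)" if "k' \<in> K" "k' \<noteq> \<one>" for k'
        proof -
          have "k' \<in> conj_class G (inv a)" using conj that invK[OF aK] inv_ne[OF aG a1] by blast
          then show ?thesis using cl aG by (auto simp: conj_class_def)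
        qed
        \<comment> \<open>\<psi> is constant on the nontrivial elements of K, where \<chi> is -1.
          With \<chi> = 0 off K, orthogonality reads 0 = d \<psi>(1) - d \<psi>(a^-1).\<close>
        have "0 = (\<Sum>h\<in>carrier G. \<psi> h * \<chi> (inv h))"
          using finite_subgroup.row_orthogonality[OF finite_subgroup_carrier \<psi> \<chi>] \<psi>\<chi> by simp
        also have "\<dots> = \<psi> \<one> * of_nat d + (\<Sum>k\<in>K - {\<one>}. \<psi> k * \<chi> (inv k)) + (\<Sum>h\<in>carrier G - K. \<psi> h * \<chi> (inv h))"
          using d by (subst sum_carrier_split[OF K(1)]) simp
        also have "(\<Sum>k\<in>K - {\<one>}. \<psi> k * \<chi> (inv k)) = (\<Sum>k\<in>K - {\<one>}. - \<psi> (inv a))"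
        proof (rule sum.cong[OF refl])
          fix x assume x: "x \<in> K - {\<one>}"
          then have "\<chi> (inv x) = -1" "\<psi> x = \<psi> (inv a)"
            using \<chi>K invK inv_ne KG \<psi>conj by auto
          then show "\<psi> x * \<chi> (inv x) = - \<psi> (inv a)" by simp
        qed
        also have "\<dots> = - of_nat d * \<psi> (inv a)" using cardK1 by simp
        also have "(\<Sum>h\<in>carrier G - K. \<psi> h * \<chi> (inv h)) = 0"
          using \<chi>0 inv_notin by (intro sum.neutral) auto
        finally have "\<psi> (inv a) = \<psi> \<one>" using d(1) by (simp add: algebra_simps)
        moreover have "\<psi> (inv h \<otimes> inv a \<otimes> h) = \<psi> (inv a)" if "h \<in> carrier G" for h
          using cl[of "inv h" "inv a"] that aG by simp
        ultimately have "(\<Sum>h\<in>carrier G. \<psi> (inv h \<otimes> inv a \<otimes> h)) = of_nat (card (carrier G)) * \<psi> \<one>"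
          by simp
        then show ?thesis unfolding all using True d by (simp add: algebra_simps)
      next
        case False
        have "b \<in> conj_class G a" using conj True False aK a1 by blast
        then have ba: "b = a" using class_reps_unique a(1) b(1) by blast
        have \<psi>: "\<psi> \<in> irr_chars G K" using b(3) ba cen by simp
        have \<psi>t: "\<psi> \<noteq> triv_char K" using y ba cen by (auto simp: yb F_def)
        interpret K: finite_subgroup G K by (rule finite_subgroupI[OF K(1)])
        \<comment> \<open>\<open>U x\<close> depends on the class of x only, and all nontrivial
          elements of K are conjugate. Its value at a^-1 is thus the average over them, and after
          exchanging the sums the inner one is a sum of \<psi> over K without 1, known from
          orthogonality to the trivial character.\<close>
        define U where "U x = (\<Sum>h\<in>carrier G. \<psi> (inv h \<otimes> x \<otimes> h))" for x
        have U: "U x = U (inv a)" if "x \<in> K" "x \<noteq> \<one>" for x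
        proof -
          have "x \<in> conj_class G (inv a)" using conj that invK[OF aK] inv_ne[OF aG a1] by blast
          then obtain g where g: "g \<in> carrier G" "x = g \<otimes> inv a \<otimes> inv g" by (auto simp: conj_class_def)
          have "U x = (\<Sum>h\<in>carrier G. \<psi> (inv (inv g \<otimes> h) \<otimes> inv a \<otimes> (inv g \<otimes> h)))"
            unfolding U_def using g aG by (intro sum.cong) (auto simp: inv_mult_group m_assoc)
          also have "\<dots> = U (inv a)"
            unfolding U_def
            using finite_subgroup.sum_translate[OF finite_subgroup_carrier, of "inv g" "\<lambda>h. \<psi> (inv h \<otimes> inv a \<otimes> h)"] g
            by simp
          finally show ?thesis .
        qed
        have "0 = (\<Sum>k\<in>K. \<psi> k * triv_char K (inv k))"
          using K.row_orthogonality[OF \<psi> K.triv_char_irr] \<psi>t by simp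
        also have "\<dots> = (\<Sum>k\<in>K. \<psi> k)" using invK by (intro sum.cong) (auto simp: triv_char_def)
        also have "\<dots> = \<psi> \<one> + (\<Sum>k\<in>K - {\<one>}. \<psi> k)" using finK one by (simp add: sum.remove)
        finally have sumK: "(\<Sum>k\<in>K - {\<one>}. \<psi> k) = - \<psi> \<one>" by (simp add: eq_neg_iff_add_eq_0 add.commute)
        have inner: "(\<Sum>x\<in>K - {\<one>}. \<psi> (inv h \<otimes> x \<otimes> h)) = - \<psi> \<one>" if h: "h \<in> carrier G" for h
        proof -
          have *: "g \<otimes> x \<otimes> inv g \<in> K - {\<one>}" if "g \<in> carrier G" "x \<in> K - {\<one>}" for g x
            using that normal KG conj_eq_iff[of g x \<one>] by auto
          have "(\<Sum>x\<in>K - {\<one>}. \<psi> (inv h \<otimes> x \<otimes> h)) = (\<Sum>k\<in>K - {\<one>}. \<psi> k)"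
          proof (rule sum.reindex_bij_witness[of _ "\<lambda>k. h \<otimes> k \<otimes> inv h" "\<lambda>x. inv h \<otimes> x \<otimes> h"])
            fix x assume x: "x \<in> K - {\<one>}"
            then show "inv h \<otimes> x \<otimes> h \<in> K - {\<one>}" "h \<otimes> x \<otimes> inv h \<in> K - {\<one>}"
              using *[of "inv h" x] *[of h x] h by auto
            show "h \<otimes> (inv h \<otimes> x \<otimes> h) \<otimes> inv h = x" "inv h \<otimes> (h \<otimes> x \<otimes> inv h) \<otimes> h = x"
              using conj_cancel h KG x by auto
          qed simp
          then show ?thesis using sumK by simp
        qed
        have "of_nat d * U (inv a) = (\<Sum>x\<in>K - {\<one>}. U x)" using U cardK1 by simp
        also have "\<dots> = (\<Sum>h\<in>carrier G. \<Sum>x\<in>K - {\<one>}. \<psi> (inv h \<otimes> x \<otimes> h))"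
          unfolding U_def by (rule sum.swap)
        also have "\<dots> = - of_nat (card (carrier G)) * \<psi> \<one>" using inner by simp
        finally have "of_nat d * U (inv a) = of_nat d * (- of_nat (card K) * \<psi> \<one>)"
          unfolding d(2,3) by (simp add: algebra_simps)
        then have "U (inv a) = - of_nat (card K) * \<psi> \<one>"
          using d(1) mult_left_cancel[of "of_nat d :: complex"] by (metis less_numeral_extra(3) of_nat_eq_0_iff)
        then show ?thesis
          unfolding all using \<chi>K[of "inv a"] invK[OF aK] inv_ne[OF aG a1] by (simp add: U_def ba)
      qed
    qed
    then show "S_mat G C y = S_mat G F y"
      unfolding C_def F_def yb S_mat_chargeon[OF \<chi> b(2)] S_mat_fluxion[OF aG b(2)]
      using Zpos Kpos by (simp add: cen)
  qed
  moreover have "C \<noteq> F" using a1 by (simp add: C_def F_def)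
  ultimately show ?thesis
    using CS FS by (intro exI[of _ C] exI[of _ F]) (auto simp: is_chargeon_def is_fluxion_def C_def F_def)
qed

end

section \<open>The affine group of a near-field\<close>

locale finite_near_field =
  fixes R (structure)
  assumes near_field: "near_field R" and finite_R: "finite (carrier R)"
begin

sublocale abelian_group R
  using near_field by (simp add: near_field_def)

abbreviation (input) nonzero :: "'a set" where "nonzero \<equiv> carrier R - {\<zero>}"

abbreviation (input) mult_group :: "'a monoid" where
  "mult_group \<equiv> \<lparr>carrier = nonzero, monoid.mult = monoid.mult R, one = \<one>\<rparr>"

lemma group_mult_group: "group mult_group"
  using near_field by (simp add: near_field_def)

lemma times_closed: "x \<in> carrier R \<Longrightarrow> y \<in> carrier R \<Longrightarrow> x \<otimes> y \<in> carrier R"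
  and times_zero: "x \<in> carrier R \<Longrightarrow> \<zero> \<otimes> x = \<zero>" "x \<in> carrier R \<Longrightarrow> x \<otimes> \<zero> = \<zero>"
  and times_distrib: "x \<in> carrier R \<Longrightarrow> y \<in> carrier R \<Longrightarrow> z \<in> carrier R \<Longrightarrow> x \<otimes> (y \<oplus> z) = x \<otimes> y \<oplus> x \<otimes> z"
  using near_field by (auto simp: near_field_def)

lemma one_nonzero: "\<one> \<in> carrier R" "\<one> \<noteq> \<zero>"
  using monoid.one_closed[OF group.is_monoid[OF group_mult_group]] by auto

lemma times_nonzero: "x \<in> nonzero \<Longrightarrow> y \<in> nonzero \<Longrightarrow> x \<otimes> y \<in> nonzero"
  using monoid.m_closed[OF group.is_monoid[OF group_mult_group]] by simp

lemma one_times: "x \<in> carrier R \<Longrightarrow> \<one> \<otimes> x = x"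
  using monoid.l_one[OF group.is_monoid[OF group_mult_group], of x] times_zero one_nonzero by (cases "x = \<zero>") auto

lemma times_one: "x \<in> carrier R \<Longrightarrow> x \<otimes> \<one> = x"
  using monoid.r_one[OF group.is_monoid[OF group_mult_group], of x] times_zero one_nonzero by (cases "x = \<zero>") auto

lemma times_assoc:
  assumes "x \<in> carrier R" "y \<in> carrier R" "z \<in> carrier R"
  shows "(x \<otimes> y) \<otimes> z = x \<otimes> (y \<otimes> z)"
proof (cases "x = \<zero> \<or> y = \<zero> \<or> z = \<zero>")
  case True
  then show ?thesis using assms times_closed times_zero by auto
next
  case False
  then show ?thesis using monoid.m_assoc[OF group.is_monoid[OF group_mult_group], of x y z] assms by simp
qed

lemma left_inverse:
  assumes "x \<in> nonzero"
  obtains y where "y \<in> nonzero" "y \<otimes> x = \<one>"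
  using group.l_inv_ex[OF group_mult_group, of x] assms by auto

text \<open>Right cancellation among nonzero elements. It is the reason why a multiplier other than
  1 fixes no difference of distinct points, so that an affine map fixing two points is the
  identity.\<close>

lemma times_eq_self:
  assumes "\<alpha> \<in> nonzero" "x \<in> nonzero" "\<alpha> \<otimes> x = x"
  shows "\<alpha> = \<one>"
proof -
  have "\<alpha> \<otimes> x = \<one> \<otimes> x" using assms one_times by simp
  then show ?thesis
    using group.right_cancel[OF group_mult_group, of x \<alpha> \<one>] assms one_nonzero by auto
qed

text \<open>The available distributive law handles signs in the right factor, which is the side on
  which an affine map has its argument.\<close>

lemma times_minus:
  assumes "x \<in> carrier R" "y \<in> carrier R"
  shows "x \<otimes> (\<ominus> y) = \<ominus> (x \<otimes> y)"
proof -
  have "x \<otimes> (\<ominus> y) \<oplus> x \<otimes> y = \<zero>"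
    using assms times_distrib[of x "\<ominus> y" y] times_zero by (simp add: l_neg)
  then show ?thesis using assms times_closed by (metis a_inv_closed minus_equality)
qed

lemma nf_group_simps [simp]:
  "carrier (nf_group R) = carrier R \<times> nonzero"
  "(a, \<alpha>) \<otimes>\<^bsub>nf_group R\<^esub> (b, \<beta>) = (a \<oplus> \<alpha> \<otimes> b, \<alpha> \<otimes> \<beta>)"
  "\<one>\<^bsub>nf_group R\<^esub> = (\<zero>, \<one>)"
  by (simp_all add: nf_group_def)

lemma nf_group_group: "group (nf_group R)"
proof (rule groupI)
  fix p q assume "p \<in> carrier (nf_group R)" "q \<in> carrier (nf_group R)"
  then show "p \<otimes>\<^bsub>nf_group R\<^esub> q \<in> carrier (nf_group R)"
    using times_closed times_nonzero by (cases p; cases q) auto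
next
  show "\<one>\<^bsub>nf_group R\<^esub> \<in> carrier (nf_group R)" using one_nonzero by simp
next
  fix p q r assume "p \<in> carrier (nf_group R)" "q \<in> carrier (nf_group R)" "r \<in> carrier (nf_group R)"
  then show "p \<otimes>\<^bsub>nf_group R\<^esub> q \<otimes>\<^bsub>nf_group R\<^esub> r = p \<otimes>\<^bsub>nf_group R\<^esub> (q \<otimes>\<^bsub>nf_group R\<^esub> r)"
    using times_closed times_nonzero times_assoc times_distrib
    by (cases p; cases q; cases r) (auto simp: a_assoc)
next
  fix p assume "p \<in> carrier (nf_group R)"
  then show "\<one>\<^bsub>nf_group R\<^esub> \<otimes>\<^bsub>nf_group R\<^esub> p = p"
    using one_times by (cases p) auto
next
  fix p assume p: "p \<in> carrier (nf_group R)"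
  obtain a \<alpha> where p_eq: "p = (a, \<alpha>)" by (cases p)
  with p have a: "a \<in> carrier R" "\<alpha> \<in> nonzero" by auto
  obtain \<beta> where \<beta>: "\<beta> \<in> nonzero" "\<beta> \<otimes> \<alpha> = \<one>" using left_inverse a by blast
  have "\<beta> \<otimes> a \<in> carrier R" using \<beta> a times_closed by blast
  then show "\<exists>q\<in>carrier (nf_group R). q \<otimes>\<^bsub>nf_group R\<^esub> p = \<one>\<^bsub>nf_group R\<^esub>"
    using \<beta> by (intro bexI[of _ "(\<ominus> (\<beta> \<otimes> a), \<beta>)"]) (auto simp: p_eq l_neg)
qed

text \<open>For \<alpha> different from 1 the map x - \<alpha> x is injective, since multiplication
  by \<alpha> fixes no nonzero difference. Finiteness makes it surjective, so it attains a exactly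
  once.\<close>

lemma card_fixed_points:
  assumes a: "a \<in> carrier R" and \<alpha>: "\<alpha> \<in> nonzero"
  shows "card {x \<in> carrier R. a \<oplus> \<alpha> \<otimes> x = x} = (if \<alpha> = \<one> then if a = \<zero> then card (carrier R) else 0 else 1)"
proof (cases "\<alpha> = \<one>")
  case True
  have "{x \<in> carrier R. a \<oplus> \<alpha> \<otimes> x = x} = (if a = \<zero> then carrier R else {})"
    using a one_times True by auto
  then show ?thesis using True by simp
next
  case False
  have \<alpha>R: "\<alpha> \<in> carrier R" using \<alpha> by simp
  define f where "f x = x \<ominus> \<alpha> \<otimes> x" for x
  have f_closed: "f x \<in> carrier R" if "x \<in> carrier R" for x
    using that \<alpha>R times_closed by (simp add: f_def)
  have decomp: "x = f x \<oplus> \<alpha> \<otimes> x" if "x \<in> carrier R" for x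
    using that times_closed[OF \<alpha>R that] by (simp add: f_def minus_eq a_assoc l_neg)
  have inj: "inj_on f (carrier R)"
  proof (rule inj_onI)
    fix x y assume xy: "x \<in> carrier R" "y \<in> carrier R" "f x = f y"
    have c: "\<alpha> \<otimes> x \<in> carrier R" "\<alpha> \<otimes> y \<in> carrier R" using xy \<alpha>R times_closed by auto
    have "x = f x \<oplus> \<alpha> \<otimes> x" "y = f y \<oplus> \<alpha> \<otimes> y"
      by (rule decomp[OF xy(1)], rule decomp[OF xy(2)])
    \<comment> \<open>Substituting the decomposition of x and y cancels the common value of f and
      shows that \<alpha> fixes the difference.\<close>
    then have "x \<ominus> y = (f x \<oplus> \<alpha> \<otimes> x) \<ominus> (f x \<oplus> \<alpha> \<otimes> y)" using xy(3) by metis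
    also have "\<dots> = \<alpha> \<otimes> x \<ominus> \<alpha> \<otimes> y"
    proof -
      have "(f x \<oplus> \<alpha> \<otimes> x) \<ominus> (f x \<oplus> \<alpha> \<otimes> y) = (f x \<oplus> \<ominus> f x) \<oplus> (\<alpha> \<otimes> x \<ominus> \<alpha> \<otimes> y)"
        using c f_closed[OF xy(1)] by (simp add: minus_eq minus_add a_ac del: r_neg l_neg)
      then show ?thesis using c f_closed[OF xy(1)] by (simp add: r_neg)
    qed
    also have "\<dots> = \<alpha> \<otimes> (x \<ominus> y)"
      using xy \<alpha>R by (simp add: minus_eq times_distrib times_minus)
    finally have fixed: "\<alpha> \<otimes> (x \<ominus> y) = x \<ominus> y" by simp
    have "x \<ominus> y = \<zero>"
    proof (rule ccontr)
      assume "x \<ominus> y \<noteq> \<zero>"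
      then have "x \<ominus> y \<in> nonzero" using xy by simp
      then show False using times_eq_self[OF \<alpha> _ fixed] False by blast
    qed
    moreover have "x = (x \<ominus> y) \<oplus> y" using xy by (simp add: minus_eq a_assoc l_neg)
    ultimately show "x = y" using xy by simp
  qed
  then have surj: "f ` carrier R = carrier R"
    using f_closed finite_R by (intro endo_inj_surj) auto
  have fix_iff: "a \<oplus> \<alpha> \<otimes> x = x \<longleftrightarrow> f x = a" if x: "x \<in> carrier R" for x
  proof -
    have c: "\<alpha> \<otimes> x \<in> carrier R" using x \<alpha>R times_closed by auto
    show ?thesis
    proof
      assume "a \<oplus> \<alpha> \<otimes> x = x"
      then have "f x = (a \<oplus> \<alpha> \<otimes> x) \<ominus> \<alpha> \<otimes> x" by (simp add: f_def)
      then show "f x = a" using a c by (simp add: minus_eq a_assoc r_neg)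
    next
      assume "f x = a"
      then show "a \<oplus> \<alpha> \<otimes> x = x" using x c by (auto simp: f_def minus_eq a_assoc l_neg)
    qed
  qed
  have "a \<in> f ` carrier R" using surj a by simp
  then obtain x where x: "a = f x" "x \<in> carrier R" by (rule imageE)
  then have "z = x" if "z \<in> carrier R" "f z = a" for z
    using inj_onD[OF inj, of z x] that by simp
  then have "{x \<in> carrier R. a \<oplus> \<alpha> \<otimes> x = x} = {x}"
    using x fix_iff by auto
  then show ?thesis using False by simp
qed

lemma card_carrier_gt_one: "card (carrier R) > 1"
proof -
  have "card {\<zero>, \<one>} \<le> card (carrier R)" using one_nonzero finite_R by (intro card_mono) auto
  then show ?thesis using one_nonzero by simp
qed

sublocale A: finite_grp "nf_group R"
  using nf_group_group finite_R by (simp add: finite_grp_def finite_grp_axioms_def)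

section \<open>Translations and the affine permutation character\<close>

definition translation_group where "translation_group = carrier R \<times> {\<one>}"

lemma translation_subgroup: "subgroup translation_group (nf_group R)"
proof (rule A.subgroupI)
  show "translation_group \<subseteq> carrier (nf_group R)" "translation_group \<noteq> {}" using one_nonzero by (auto simp: translation_group_def)
  fix p assume "p \<in> translation_group"
  then obtain x where x: "p = (x, \<one>)" "x \<in> carrier R" by (auto simp: translation_group_def)
  then have "inv\<^bsub>nf_group R\<^esub> p = (\<ominus> x, \<one>)"
    using one_nonzero one_times by (intro A.inv_equality) (auto simp: l_neg)
  then show "inv\<^bsub>nf_group R\<^esub> p \<in> translation_group" using x by (simp add: translation_group_def)
  fix q assume "q \<in> translation_group"
  then show "p \<otimes>\<^bsub>nf_group R\<^esub> q \<in> translation_group" using x one_nonzero by (auto simp: translation_group_def one_times)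
qed

text \<open>Normality of the translations, their centralizers and their being conjugate to each
  other are all read off from this formula. It is checked with the inverse moved to the other side,
  where both products are explicit.\<close>

lemma translation_conj:
  assumes "u \<in> carrier R" "\<alpha> \<in> nonzero" "x \<in> carrier R"
  shows "(u, \<alpha>) \<otimes>\<^bsub>nf_group R\<^esub> (x, \<one>) \<otimes>\<^bsub>nf_group R\<^esub> inv\<^bsub>nf_group R\<^esub> (u, \<alpha>) = (\<alpha> \<otimes> x, \<one>)"
proof -
  have c: "\<alpha> \<in> carrier R" "\<alpha> \<otimes> x \<in> carrier R" using assms times_closed by auto
  have "(u, \<alpha>) \<otimes>\<^bsub>nf_group R\<^esub> (x, \<one>) = (\<alpha> \<otimes> x, \<one>) \<otimes>\<^bsub>nf_group R\<^esub> (u, \<alpha>)"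
    using assms c one_nonzero by (simp add: one_times times_one a_comm)
  moreover have "(u, \<alpha>) \<in> carrier (nf_group R)" "(x, \<one>) \<in> carrier (nf_group R)" "(\<alpha> \<otimes> x, \<one>) \<in> carrier (nf_group R)"
    using assms c one_nonzero by auto
  ultimately show ?thesis by (metis A.inv_solve_right A.m_closed)
qed

lemma card_nonzero: "card nonzero = card (carrier R) - 1"
  using finite_R by (simp add: card_Diff_singleton)

lemma card_translation_group: "card translation_group = card (carrier R)"
  by (simp add: translation_group_def card_cartesian_product)

text \<open>\<theta> counts fixed points: q at the identity, 0 at the other translations, 1
  elsewhere. Its sum is |G|, as for one orbit on points, and its norm q^2 + (q(q - 1) - q) = 2 q (q
  - 1) is 2 |G|, as for two orbits on pairs. So \<theta> - 1 is irreducible, and its values q - 1,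
  -1, 0 are those required of \<chi>.\<close>

lemma nf_group_modular_invariant:
  "\<exists>C F. is_chargeon (nf_group R) C \<and> is_fluxion (nf_group R) F \<and> C \<noteq> F \<and>
    modular_invariant (nf_group R) (transp_perm_mat C F)"
proof -
  interpret G: finite_subgroup "nf_group R" "carrier R \<times> nonzero"
    using A.finite_subgroup_carrier by simp
  let ?G = "carrier R \<times> nonzero"
  define q where "q = card (carrier R)"
  have q: "q > 1" using card_carrier_gt_one by (simp add: q_def)
  have card_G: "card ?G = q * (q - 1)" by (simp add: card_cartesian_product card_nonzero q_def)
  define act where "act p x = fst p \<oplus> snd p \<otimes> x" for p x
  obtain \<rho> where \<rho>: "is_rep (nf_group R) ?G (card (carrier R)) \<rho>"
    "\<And>h. h \<in> ?G \<Longrightarrow> mat_tr (\<rho> h) = of_nat (card {x \<in> carrier R. act h x = x})"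
  proof (rule G.permutation_rep[OF finite_R, of act])
    show "act g x \<in> carrier R" if "g \<in> ?G" "x \<in> carrier R" for g x
      using that times_closed by (auto simp: act_def)
    show "act \<one>\<^bsub>nf_group R\<^esub> x = x" if "x \<in> carrier R" for x
      using that one_times by (simp add: act_def)
    show "act (g \<otimes>\<^bsub>nf_group R\<^esub> h) x = act g (act h x)" if "g \<in> ?G" "h \<in> ?G" "x \<in> carrier R" for g h x
      using that times_closed times_distrib times_assoc
      by (cases g; cases h) (auto simp: act_def a_assoc)
  qed blast
  obtain cs where cs: "set cs \<subseteq> irr_chars (nf_group R) ?G" "\<forall>h\<in>?G. mat_tr (\<rho> h) = (\<Sum>c\<leftarrow>cs. c h)"
    using G.character_decomposition[OF \<rho>(1)] by blast
  define \<theta> where "\<theta> h = mat_tr (\<rho> h)" for h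
  have \<theta>: "\<theta> h = of_nat (card {x \<in> carrier R. act h x = x})" if "h \<in> ?G" for h
    using \<rho>(2) that by (simp add: \<theta>_def)
  have \<theta>_val: "\<theta> (a, \<alpha>) = (if \<alpha> = \<one> then if a = \<zero> then of_nat q else 0 else 1)"
    if "a \<in> carrier R" "\<alpha> \<in> nonzero" for a \<alpha>
    using \<theta>[of "(a, \<alpha>)"] card_fixed_points[OF that] that by (simp add: act_def q_def)
  have \<theta>1: "\<theta> \<one>\<^bsub>nf_group R\<^esub> = of_nat q"
    and \<theta>T: "k \<in> translation_group \<Longrightarrow> k \<noteq> \<one>\<^bsub>nf_group R\<^esub> \<Longrightarrow> \<theta> k = 0"
    and \<theta>0: "g \<in> carrier (nf_group R) \<Longrightarrow> g \<notin> translation_group \<Longrightarrow> \<theta> g = 1" for k g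
    using one_nonzero by (auto simp: \<theta>_val translation_group_def split: if_splits)
  have invK: "inv\<^bsub>nf_group R\<^esub> k \<in> translation_group" if "k \<in> translation_group" for k
    using subgroup.m_inv_closed[OF translation_subgroup that] .
  have inv_notin: "inv\<^bsub>nf_group R\<^esub> g \<notin> translation_group" if "g \<in> carrier (nf_group R)" "g \<notin> translation_group" for g
    using invK that A.inv_inv by metis
  have inv1: "inv\<^bsub>nf_group R\<^esub> (\<zero>, \<one>) = (\<zero>, \<one>)" using A.inv_one by simp
  have card_diff: "card (carrier (nf_group R) - translation_group) = q * (q - 1) - q"
    using card_G card_translation_group one_nonzero
    by (subst card_Diff_subset) (auto simp: q_def finite_R translation_group_def)
  \<comment> \<open>Keeps the natural-number subtraction in \<open>card_diff\<close> exact. Equality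
    holds for q = 2, when every element is a translation.\<close>
  have qle: "q \<le> q * (q - 1)" using q by simp
  have sum\<theta>: "(\<Sum>h\<in>?G. \<theta> h) = of_nat (card ?G)"
  proof -
    have "(\<Sum>h\<in>carrier (nf_group R). \<theta> h) = of_nat q + 0 + of_nat (card (carrier (nf_group R) - translation_group))"
      using \<theta>1 \<theta>T \<theta>0 by (subst A.sum_carrier_split[OF translation_subgroup]) simp
    then show ?thesis using qle card_diff card_G by (simp flip: of_nat_add)
  qed
  have norm\<theta>: "(\<Sum>h\<in>?G. \<theta> h * \<theta> (inv\<^bsub>nf_group R\<^esub> h)) = 2 * of_nat (card ?G)"
  proof -
    have "(\<Sum>h\<in>carrier (nf_group R). \<theta> h * \<theta> (inv\<^bsub>nf_group R\<^esub> h))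
      = of_nat q * of_nat q + 0 + of_nat (card (carrier (nf_group R) - translation_group))"
      using \<theta>1 \<theta>T \<theta>0 inv_notin inv1 by (subst A.sum_carrier_split[OF translation_subgroup]) simp
    moreover have "q * q + (q * (q - 1) - q) = 2 * (q * (q - 1))"
    proof -
      have "q * q = q * (q - 1) + q" using q by (cases q) auto
      then show ?thesis using qle by simp
    qed
    then have "of_nat q * of_nat q + 0 + of_nat (q * (q - 1) - q) = (of_nat (2 * (q * (q - 1))) :: complex)"
      by (metis add_0_right of_nat_add of_nat_mult)
    ultimately show ?thesis using card_diff card_G by (simp only: of_nat_mult of_nat_numeral nf_group_simps(1))
  qed
  define \<chi> where "\<chi> = (\<lambda>h. if h \<in> ?G then \<theta> h - 1 else 0)"
  have \<chi>: "\<chi> \<in> irr_chars (nf_group R) ?G"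
    unfolding \<chi>_def using cs sum\<theta> norm\<theta> by (intro G.irr_char_of_norm_two) (auto simp: \<theta>_def)
  have KE: "\<exists>x. x \<in> carrier R \<and> k = (x, \<one>)" if "k \<in> translation_group" for k using that by (auto simp: translation_group_def)
  show ?thesis
  proof (rule A.chargeon_fluxion_transposition_invariant[OF translation_subgroup])
    show "1 < card translation_group" using q by (simp add: card_translation_group q_def)
    show "card (carrier (nf_group R)) = card translation_group * (card translation_group - 1)" using card_G by (simp add: card_translation_group q_def)
    show "g \<otimes>\<^bsub>nf_group R\<^esub> k \<otimes>\<^bsub>nf_group R\<^esub> inv\<^bsub>nf_group R\<^esub> g \<in> translation_group"
      if "g \<in> carrier (nf_group R)" "k \<in> translation_group" for g k
      using KE[OF that(2)] that(1) translation_conj times_closed by (cases g) (auto simp: translation_group_def)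
    show "centr (nf_group R) a = translation_group" if aT: "a \<in> translation_group" "a \<noteq> \<one>\<^bsub>nf_group R\<^esub>" for a
    proof -
      obtain x where x: "x \<in> nonzero" "a = (x, \<one>)" using KE[OF aT(1)] aT(2) by force
      have "(u, \<alpha>) \<in> centr (nf_group R) a \<longleftrightarrow> \<alpha> = \<one>" if "u \<in> carrier R" "\<alpha> \<in> nonzero" for u \<alpha>
      proof -
        have "(u, \<alpha>) \<in> centr (nf_group R) a \<longleftrightarrow> \<alpha> \<otimes> x = x"
          using A.centr_iff_conj[of a "(u, \<alpha>)"] translation_conj[of u \<alpha> x] that x one_nonzero by simp
        then show ?thesis using times_eq_self x that one_times by blast
      qed
      moreover have "centr (nf_group R) a \<subseteq> carrier R \<times> nonzero" by (auto simp: centr_def)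
      ultimately show ?thesis using one_nonzero unfolding translation_group_def by (auto; blast)
    qed
    show "b \<in> conj_class (nf_group R) a"
      if abT: "a \<in> translation_group" "a \<noteq> \<one>\<^bsub>nf_group R\<^esub>" "b \<in> translation_group" "b \<noteq> \<one>\<^bsub>nf_group R\<^esub>" for a b
    proof -
      obtain x where x: "x \<in> nonzero" "a = (x, \<one>)" using KE[OF abT(1)] abT(2) by force
      obtain y where y: "y \<in> nonzero" "b = (y, \<one>)" using KE[OF abT(3)] abT(4) by force
      obtain \<beta> where \<beta>: "\<beta> \<in> nonzero" "\<beta> \<otimes> x = \<one>" using left_inverse x by blast
      have "(y \<otimes> \<beta>) \<otimes> x = y" using times_assoc \<beta> x y times_one by auto
      moreover have "y \<otimes> \<beta> \<in> nonzero" using times_nonzero y \<beta> by blast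
      ultimately have "b = (\<zero>, y \<otimes> \<beta>) \<otimes>\<^bsub>nf_group R\<^esub> a \<otimes>\<^bsub>nf_group R\<^esub> inv\<^bsub>nf_group R\<^esub> (\<zero>, y \<otimes> \<beta>)"
        using translation_conj[of \<zero> "y \<otimes> \<beta>" x] x y by auto
      moreover have "(\<zero>, y \<otimes> \<beta>) \<in> carrier (nf_group R)" using \<open>y \<otimes> \<beta> \<in> nonzero\<close> by simp
      ultimately show ?thesis unfolding conj_class_def by blast
    qed
    show "\<chi> \<in> irr_chars (nf_group R) (carrier (nf_group R))" using \<chi> by simp
    show "\<chi> \<one>\<^bsub>nf_group R\<^esub> = of_nat (card translation_group - 1)"
      using \<theta>1 one_nonzero q by (simp add: \<chi>_def card_translation_group q_def of_nat_diff)
    show "\<chi> k = -1" if "k \<in> translation_group" "k \<noteq> \<one>\<^bsub>nf_group R\<^esub>" for k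
      using \<theta>T[OF that] that one_nonzero by (auto simp: \<chi>_def translation_group_def)
    show "\<chi> g = 0" if "g \<in> carrier (nf_group R)" "g \<notin> translation_group" for g
      using \<theta>0[OF that] by (simp add: \<chi>_def)
  qed
qed

end

section \<open>The centralizer of the flux\<close>

context finite_grp
begin

text \<open>The fibres of the map sending g to g a g^-1 are left cosets of the centralizer.\<close>

lemma card_conj_class:
  assumes a: "a \<in> carrier G"
  shows "card (carrier G) = card (conj_class G a) * card (centr G a)"
proof -
  let ?c = "\<lambda>g. g \<otimes> a \<otimes> inv g"
  have image: "conj_class G a = ?c ` carrier G" by (auto simp: conj_class_def)
  have fibre: "card {h \<in> carrier G. ?c h = x} = card (centr G a)" if x: "x \<in> conj_class G a" for x
  proof -
    obtain g where g: "g \<in> carrier G" "x = ?c g" using x by (auto simp: conj_class_def)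
    have "bij_betw (\<lambda>z. g \<otimes> z) (centr G a) {h \<in> carrier G. ?c h = x}"
    proof (rule bij_betw_byWitness[of _ "\<lambda>h. inv g \<otimes> h"])
      show "\<forall>z\<in>centr G a. inv g \<otimes> (g \<otimes> z) = z" using g by (auto simp: centr_def simp flip: m_assoc)
      show "\<forall>h\<in>{h \<in> carrier G. ?c h = x}. g \<otimes> (inv g \<otimes> h) = h" using g by (auto simp flip: m_assoc)
      show "(\<lambda>z. g \<otimes> z) ` centr G a \<subseteq> {h \<in> carrier G. ?c h = x}"
      proof safe
        fix z assume z: "z \<in> centr G a"
        then have zc: "z \<in> carrier G" by (simp add: centr_def)
        then show "g \<otimes> z \<in> carrier G" using g by simp
        show "?c (g \<otimes> z) = x" using conj_conj[OF g(1) zc a] centr_iff_conj[OF a zc] z g by simp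
      qed
      show "(\<lambda>h. inv g \<otimes> h) ` {h \<in> carrier G. ?c h = x} \<subseteq> centr G a"
      proof safe
        fix h assume h: "h \<in> carrier G" "x = ?c h"
        have "?c (inv g \<otimes> h) = inv g \<otimes> ?c h \<otimes> inv (inv g)"
          using conj_conj[of "inv g" h a] g h a by simp
        also have "\<dots> = a" using h g a conj_cancel(2)[OF g(1) a] by simp
        finally show "inv g \<otimes> h \<in> centr G a" using centr_iff_conj[OF a, of "inv g \<otimes> h"] g h by simp
      qed
    qed
    then show ?thesis by (metis bij_betw_same_card)
  qed
  have "card (carrier G) = (\<Sum>x\<in>?c ` carrier G. \<Sum>h\<in>{h \<in> carrier G. ?c h = x}. 1)"
    using sum.image_gen[OF finite_carrier, of "\<lambda>_. 1 :: nat" ?c] by simp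
  also have "\<dots> = (\<Sum>x\<in>conj_class G a. card (centr G a))"
    using fibre by (simp add: image)
  finally show ?thesis by simp
qed

text \<open>Each comparable entry of S relates the numbers d = \<chi>(1), z = |Z| and N = |G|. The
  final set equality is a count: Z contains 1 and the class of a, and these make up all d + 1 of its
  elements.\<close>

lemma transposition_class_centralizer:
  assumes C: "is_chargeon G C" and F: "is_fluxion G F" and CF: "C \<noteq> F"
    and inv: "modular_invariant G (transp_perm_mat C F)"
  obtains a where "a \<in> carrier G" "a \<noteq> \<one>" "centr G a = insert \<one> (conj_class G a)"
proof -
  obtain \<chi> where C_eq: "C = (\<one>, \<chi>)" using C by (cases C) (auto simp: is_chargeon_def)
  obtain a where F_eq: "F = (a, triv_char (centr G a))" using F by (cases F) (auto simp: is_fluxion_def)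
  have CS: "C \<in> simples G" and FS: "F \<in> simples G" using C F by (auto simp: is_chargeon_def is_fluxion_def)
  have \<chi>: "\<chi> \<in> irr_chars G (carrier G)" using simplesD(3)[OF CS[unfolded C_eq]] by (simp add: centr_one)
  have a: "a \<in> class_reps G" "a \<in> carrier G" using simplesD[OF FS[unfolded F_eq]] by auto
  note D = transposition_invariantD[OF CS FS CF inv]
  have a1: "a \<noteq> \<one>" using D(2) by (auto simp: F_eq zero_obj_def centr_one)
  define Z where "Z = centr G a"
  interpret Z: finite_subgroup G Z unfolding Z_def by (rule centr_finite_subgroup[OF a(2)])
  define z N where "z = card Z" and "N = card (carrier G)"
  have zpos: "z > 0" using Z.card_H_pos by (simp add: z_def)
  have Npos: "N > 0" using finite_subgroup.card_H_pos[OF finite_subgroup_carrier] by (simp add: N_def)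
  obtain d where d: "d > 0" "\<chi> \<one> = of_nat d"
    using finite_subgroup.irr_char_one[OF finite_subgroup_carrier \<chi>] by blast
  have S_C: "S_mat G C (b, \<psi>) = \<chi> (inv b) * \<psi> \<one> / of_nat (card (centr G b))" if "b \<in> carrier G" for b \<psi>
    unfolding C_eq by (rule S_mat_chargeon[OF \<chi> that])
  have S_F: "S_mat G F (b, \<psi>) = (\<Sum>h\<in>{h \<in> carrier G. h \<otimes> b \<otimes> inv h \<in> Z}. \<psi> (inv h \<otimes> inv a \<otimes> h))
      / (of_nat z * of_nat (card (centr G b)))" if "b \<in> carrier G" for b \<psi>
    unfolding F_eq using S_mat_fluxion[OF a(2) that] by (simp add: Z_def z_def)
  have S_F1: "S_mat G F (\<one>, \<psi>) = \<psi> (inv a) / of_nat z" if "\<psi> \<in> irr_chars G (carrier G)" for \<psi>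
  proof -
    have "{h \<in> carrier G. h \<otimes> \<one> \<otimes> inv h \<in> Z} = carrier G" by (auto simp: Z.H_closed(1))
    moreover have "\<psi> (inv h \<otimes> inv a \<otimes> h) = \<psi> (inv a)" if "h \<in> carrier G" for h
      using finite_subgroup.irr_char_class_function[OF finite_subgroup_carrier \<open>\<psi> \<in> _\<close>, of "inv h" "inv a"] a that
      by simp
    ultimately show ?thesis using S_F[OF one_closed, of \<psi>] Npos by (simp add: centr_one N_def)
  qed
  \<comment> \<open>The column of the trivial object has entry d / N in row C and 1 / z in row
    F.\<close>
  have zN: "of_nat d * of_nat z = (of_nat N :: complex)"
  proof -
    have "S_mat G C (zero_obj G) = S_mat G F (zero_obj G)" using D zero_obj_simple by metis
    moreover have "triv_char (carrier G) (inv a) = 1" using a by (simp add: triv_char_def)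
    ultimately have "of_nat d / of_nat N = 1 / (of_nat z :: complex)"
      using S_C[OF one_closed] S_F1[OF finite_subgroup.triv_char_irr[OF finite_subgroup_carrier]] d
      by (simp add: zero_obj_def centr_one N_def triv_char_def)
    then show ?thesis using zpos Npos by (simp add: field_simps)
  qed
  have dN: "d * z = N" using zN by (metis of_nat_eq_iff of_nat_mult)
  have other: "\<psi> (inv a) = \<psi> \<one>" if \<psi>: "\<psi> \<in> irr_chars G (carrier G)" "\<psi> \<noteq> \<chi>" for \<psi>
  proof -
    have "(\<one>, \<psi>) \<in> simples G" using one_class_reps \<psi> by (intro simplesI) (auto simp: centr_one)
    then have "S_mat G C (\<one>, \<psi>) = S_mat G F (\<one>, \<psi>)"
      using \<psi> a1 by (intro D(4)) (auto simp: C_eq F_eq)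
    then have "of_nat d * \<psi> \<one> / of_nat N = \<psi> (inv a) / of_nat z"
      using S_C[OF one_closed] S_F1[OF \<psi>(1)] d by (simp add: centr_one N_def)
    then show ?thesis using zpos d(1) unfolding zN[symmetric] by (simp add: field_simps)
  qed
  have \<chi>a: "\<chi> (inv a) = of_nat d - of_nat z"
  proof -
    have inva: "inv a \<noteq> \<one>" using a a1 by (metis inv_inv inv_one)
    let ?I = "irr_chars G (carrier G)"
    have fin: "finite ?I" by (rule finite_subgroup.finite_irr_chars[OF finite_subgroup_carrier])
    \<comment> \<open>The column relation at 1 and at a^-1 evaluates this sum to N = d z. By
      \<open>other\<close> all its terms except that of \<chi> vanish, so d (d - \<chi>(a^-1)) = d
      z.\<close>
    have "(\<Sum>\<psi>\<in>?I. \<psi> \<one> * (\<psi> \<one> - \<psi> (inv a))) = (\<Sum>\<psi>\<in>?I. \<psi> \<one> * \<psi> \<one>) - (\<Sum>\<psi>\<in>?I. \<psi> \<one> * \<psi> (inv a))"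
      by (simp add: right_diff_distrib sum_subtractf)
    also have "\<dots> = of_nat N"
      using finite_subgroup.column_orthogonality_one[OF finite_subgroup_carrier, of \<one>]
        finite_subgroup.column_orthogonality_one[OF finite_subgroup_carrier, of "inv a"] a inva
      by (simp add: N_def)
    also have "(\<Sum>\<psi>\<in>?I. \<psi> \<one> * (\<psi> \<one> - \<psi> (inv a))) = \<chi> \<one> * (\<chi> \<one> - \<chi> (inv a))"
    proof -
      have "(\<Sum>\<psi>\<in>?I - {\<chi>}. \<psi> \<one> * (\<psi> \<one> - \<psi> (inv a))) = 0"
      proof (intro sum.neutral ballI)
        fix \<psi> assume "\<psi> \<in> ?I - {\<chi>}"
        then have "\<psi> (inv a) = \<psi> \<one>" using other by blast
        then show "\<psi> \<one> * (\<psi> \<one> - \<psi> (inv a)) = 0" by simp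
      qed
      then show ?thesis by (simp add: sum.remove[OF fin \<chi>])
    qed
    finally have "of_nat d * (of_nat d - \<chi> (inv a)) = of_nat d * of_nat z" by (simp add: d zN)
    then have "of_nat d - \<chi> (inv a) = of_nat z" using d(1) by simp
    then show ?thesis by (simp add: algebra_simps)
  qed
  have inZ: "h \<otimes> a \<otimes> inv h \<in> Z" if h: "h \<in> carrier G" for h
  proof -
    \<comment> \<open>The entry FF counts the h in \<open>?B\<close>, where both a condition on the
      index and one from the trivial character hold. Equality with CC reads d^2 / N =
      |\<open>?B\<close>| / z^2, so \<open>?B\<close> has N elements and both conditions always
      hold.\<close>
    let ?A = "{h \<in> carrier G. h \<otimes> a \<otimes> inv h \<in> Z}"
    let ?B = "{h \<in> ?A. inv h \<otimes> inv a \<otimes> h \<in> Z}"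
    have finA: "finite ?A" using finite_carrier by simp
    have "of_nat d * of_nat d / of_nat N = (of_nat (card ?B) / (of_nat z * of_nat z) :: complex)"
    proof -
      have "(\<Sum>h\<in>?A. triv_char Z (inv h \<otimes> inv a \<otimes> h)) = of_nat (card ?B)"
        using finA by (simp add: triv_char_def sum.If_cases Int_def)
      then have "S_mat G F F = of_nat (card ?B) / (of_nat z * of_nat z)"
        using S_F[OF a(2), of "triv_char Z"] by (simp add: F_eq Z_def z_def)
      moreover have "S_mat G C C = of_nat d * of_nat d / of_nat N"
        using S_C[OF one_closed, of \<chi>] d by (simp add: C_eq centr_one N_def)
      ultimately show ?thesis using D(3) by simp
    qed
    then have "of_nat (card ?B) * (of_nat d * of_nat z) = (of_nat d * of_nat z) * (of_nat d * of_nat z :: complex)"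
      using zpos d(1) unfolding zN[symmetric] by (simp add: field_simps)
    then have "of_nat (card ?B) = (of_nat d * of_nat z :: complex)"
      using zpos d(1) by simp
    then have "card ?B = card (carrier G)" unfolding zN by (simp add: N_def)
    moreover have "?B \<subseteq> carrier G" by auto
    ultimately have "?B = carrier G" using card_subset_eq[OF finite_carrier] by blast
    then show ?thesis using h by blast
  qed
  have zd: "z = d + 1"
  proof -
    let ?I = "irr_chars G Z" and ?t = "triv_char Z"
    have fin: "finite ?I" by (rule Z.finite_irr_chars)
    have t1: "?t x = 1" if "x \<in> Z" for x using that by (simp add: triv_char_def)
    have mem: "inv h \<otimes> inv a \<otimes> h \<in> Z" "inv h \<otimes> inv a \<otimes> h \<noteq> \<one>" if h: "h \<in> carrier G" for h
    proof -
      have eq: "inv h \<otimes> inv a \<otimes> h = inv (inv h \<otimes> a \<otimes> h)" using inv_conj' h a by simp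
      show "inv h \<otimes> inv a \<otimes> h \<in> Z" unfolding eq using inZ[of "inv h"] h Z.H_closed(3) by simp
      show "inv h \<otimes> inv a \<otimes> h \<noteq> \<one>"
      proof
        assume "inv h \<otimes> inv a \<otimes> h = \<one>"
        then have "inv h \<otimes> a \<otimes> h = \<one>" unfolding eq using h a by (metis inv_closed inv_inv inv_one m_closed)
        then have "h \<otimes> (inv h \<otimes> a \<otimes> h) \<otimes> inv h = \<one>" using h by simp
        then show False using conj_cancel h a a1 by simp
      qed
    qed
    have eqn: "\<chi> (inv a) * \<psi> \<one> * of_nat z = (\<Sum>h\<in>carrier G. \<psi> (inv h \<otimes> inv a \<otimes> h))"
      if \<psi>: "\<psi> \<in> ?I" "\<psi> \<noteq> ?t" for \<psi>
    proof -
      have "(a, \<psi>) \<in> simples G" using a \<psi> by (intro simplesI) (auto simp: Z_def)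
      then have "S_mat G C (a, \<psi>) = S_mat G F (a, \<psi>)"
        using \<psi> a1 by (intro D(4)) (auto simp: C_eq F_eq Z_def)
      moreover have "{h \<in> carrier G. h \<otimes> a \<otimes> inv h \<in> Z} = carrier G" using inZ by auto
      ultimately have "\<chi> (inv a) * \<psi> \<one> / of_nat z
          = (\<Sum>h\<in>carrier G. \<psi> (inv h \<otimes> inv a \<otimes> h)) / (of_nat z * of_nat z)"
        using S_C[OF a(2), of \<psi>] S_F[OF a(2), of \<psi>] by (simp add: Z_def z_def)
      then show ?thesis using zpos by (simp add: field_simps)
    qed
    have inner: "(\<Sum>\<psi>\<in>?I - {?t}. \<psi> \<one> * \<psi> x) = (if x = \<one> then of_nat z - 1 else -1)" if "x \<in> Z" for x
    proof -
      have "(\<Sum>\<psi>\<in>?I. \<psi> \<one> * \<psi> x) = 1 + (\<Sum>\<psi>\<in>?I - {?t}. \<psi> \<one> * \<psi> x)"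
        using t1[OF that] t1[OF Z.H_closed(1)] by (simp add: sum.remove[OF fin Z.triv_char_irr])
      then have "(\<Sum>\<psi>\<in>?I - {?t}. \<psi> \<one> * \<psi> x) = (\<Sum>\<psi>\<in>?I. \<psi> \<one> * \<psi> x) - 1" by simp
      then show ?thesis unfolding Z.column_orthogonality_one[OF that] by (simp add: z_def)
    qed
    \<comment> \<open>With the weight \<psi>(1) the left side becomes a sum of squared degrees and
      the right side, for each h, a column relation at a nontrivial element of Z.\<close>
    have "(\<Sum>\<psi>\<in>?I - {?t}. \<psi> \<one> * (\<chi> (inv a) * \<psi> \<one> * of_nat z))
      = (\<Sum>\<psi>\<in>?I - {?t}. \<psi> \<one> * (\<Sum>h\<in>carrier G. \<psi> (inv h \<otimes> inv a \<otimes> h)))"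
    proof (rule sum.cong[OF refl])
      fix \<psi> assume "\<psi> \<in> ?I - {?t}"
      then show "\<psi> \<one> * (\<chi> (inv a) * \<psi> \<one> * of_nat z) = \<psi> \<one> * (\<Sum>h\<in>carrier G. \<psi> (inv h \<otimes> inv a \<otimes> h))"
        using eqn[of \<psi>] by simp
    qed
    also have "\<dots> = (\<Sum>h\<in>carrier G. \<Sum>\<psi>\<in>?I - {?t}. \<psi> \<one> * \<psi> (inv h \<otimes> inv a \<otimes> h))"
      by (simp add: sum_distrib_left) (rule sum.swap)
    also have "\<dots> = (\<Sum>h\<in>carrier G. -1)"
      using inner mem by (intro sum.cong) auto
    also have "\<dots> = - of_nat N" by (simp add: N_def)
    also have "(\<Sum>\<psi>\<in>?I - {?t}. \<psi> \<one> * (\<chi> (inv a) * \<psi> \<one> * of_nat z))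
      = \<chi> (inv a) * of_nat z * (\<Sum>\<psi>\<in>?I - {?t}. \<psi> \<one> * \<psi> \<one>)"
      by (simp add: sum_distrib_left algebra_simps)
    also have "(\<Sum>\<psi>\<in>?I - {?t}. \<psi> \<one> * \<psi> \<one>) = of_nat z - 1"
      using inner[OF Z.H_closed(1)] by simp
    finally have "(of_nat d - of_nat z) * of_nat z * (of_nat z - 1) = - (of_nat d * of_nat z :: complex)"
      by (simp add: \<chi>a zN)
    \<comment> \<open>Expanding (d - z) z (z - 1) + d z gives z^2 (d + 1 - z), and z is not
      0.\<close>
    then have "of_nat z * of_nat z * (of_nat d + 1 - of_nat z) = (0 :: complex)"
      by (simp add: algebra_simps)
    then have "of_nat d + 1 - of_nat z = (0 :: complex)" using zpos by simp
    then have "of_nat (d + 1) = (of_nat z :: complex)" by (simp add: add.commute)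
    then show ?thesis by (simp only: of_nat_eq_iff)
  qed
  have sub: "insert \<one> (conj_class G a) \<subseteq> Z" using inZ Z.H_closed(1) by (auto simp: conj_class_def)
  have "N = card (conj_class G a) * z" using card_conj_class[OF a(2)] by (simp add: N_def Z_def z_def)
  then have "card (conj_class G a) = d" using dN zpos by simp
  moreover have "\<one> \<notin> conj_class G a" by (rule one_notin_conj_class[OF a(2) a1])
  moreover have "finite (conj_class G a)"
    using conj_class_closed[OF a(2)] finite_carrier finite_subset by blast
  ultimately have "card (insert \<one> (conj_class G a)) = card Z" using zd by (simp add: z_def)
  then have "insert \<one> (conj_class G a) = Z" using card_subset_eq[OF Z.finite_H sub] by blast
  then show thesis using that[OF a(2) a1] by (simp add: Z_def)
qed

text \<open>A transversal T of K gives the crossed homomorphism sending g to the product over T of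
  g t (g t)'^-1, where x' is the representative of the coset of x. Its kernel is the complement,
  because it restricts to the bijection k -> k^|T| = k^-1 on K.\<close>
lemma abelian_normal_complement:
  assumes K: "subgroup K G" and normal: "\<And>g k. g \<in> carrier G \<Longrightarrow> k \<in> K \<Longrightarrow> g \<otimes> k \<otimes> inv g \<in> K"
    and comm: "\<And>x y. x \<in> K \<Longrightarrow> y \<in> K \<Longrightarrow> x \<otimes> y = y \<otimes> x"
    and card_G: "card (carrier G) = card K * (card K - 1)"
  obtains L where "subgroup L G" "L \<inter> K = {\<one>}" "\<forall>g\<in>carrier G. \<exists>k\<in>K. \<exists>l\<in>L. g = k \<otimes> l"
proof -
  have KG: "K \<subseteq> carrier G" by (rule subgroup.subset[OF K])
  have Kc: "x \<in> K \<Longrightarrow> x \<in> carrier G" for x using KG by blast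
  have K1: "\<one> \<in> K" by (rule subgroup.one_closed[OF K])
  have Km: "x \<in> K \<Longrightarrow> y \<in> K \<Longrightarrow> x \<otimes> y \<in> K" for x y by (rule subgroup.m_closed[OF K])
  have Ki: "x \<in> K \<Longrightarrow> inv x \<in> K" for x by (rule subgroup.m_inv_closed[OF K])
  have finK: "finite K" by (rule finite_subset[OF KG finite_carrier])
  have cardK: "card K > 0" using finK K1 card_gt_0_iff by blast
  \<comment> \<open>Products over T take place in K as a commutative group of its own, in which the
    order of factors does not matter.\<close>
  define M where "M = G\<lparr>carrier := K\<rparr>"
  have M_simps: "carrier M = K" "\<And>x y. x \<otimes>\<^bsub>M\<^esub> y = x \<otimes> y" "\<one>\<^bsub>M\<^esub> = \<one>" by (simp_all add: M_def)
  interpret M: comm_group M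
    unfolding M_def
  proof (rule group.group_comm_groupI[OF subgroup_imp_group[OF K]])
    fix x y assume "x \<in> carrier (G\<lparr>carrier := K\<rparr>)" "y \<in> carrier (G\<lparr>carrier := K\<rparr>)"
    then show "x \<otimes>\<^bsub>G\<lparr>carrier := K\<rparr>\<^esub> y = y \<otimes>\<^bsub>G\<lparr>carrier := K\<rparr>\<^esub> x" using comm[of x y] by simp
  qed
  \<comment> \<open>Chosen from the coset as a set, hence constant on it; \<open>rep\<close> is
    idempotent and T is the set of its values.\<close>
  define rep where "rep x = (SOME y. y \<in> K #> x)" for x
  define T where "T = rep ` carrier G"
  have coset: "K #> (k \<otimes> x) = K #> x" if "k \<in> K" "x \<in> carrier G" for k x
    using that KG K coset_join2[of k K] by (metis Kc coset_mult_assoc)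
  have rep_in: "rep x \<in> K #> x" if "x \<in> carrier G" for x
    unfolding rep_def using rcos_self[OF that K] by (rule someI)
  have repE: "\<exists>k\<in>K. rep x = k \<otimes> x" if "x \<in> carrier G" for x
    using rep_in[OF that] by (auto simp: r_coset_def)
  have rep_c: "rep x \<in> carrier G" if "x \<in> carrier G" for x using repE[OF that] Kc that by auto
  have rep_mult: "rep (k \<otimes> x) = rep x" if "k \<in> K" "x \<in> carrier G" for k x
    using coset[OF that] by (simp add: rep_def)
  have rep_rep: "rep (rep x) = rep x" if "x \<in> carrier G" for x
    using repE[OF that] rep_mult that by metis
  have rep_inv: "x \<otimes> inv (rep x) \<in> K" if x: "x \<in> carrier G" for x
  proof -
    obtain k where k: "k \<in> K" "rep x = k \<otimes> x" using repE[OF x] by blast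
    then have "x \<otimes> inv (rep x) = inv k" using x Kc by (simp add: inv_mult_group flip: m_assoc)
    then show ?thesis using k Ki by simp
  qed
  have TG: "t \<in> T \<Longrightarrow> t \<in> carrier G" for t using rep_c by (auto simp: T_def)
  have finT: "finite T" using finite_carrier by (simp add: T_def)
  have rep_T: "rep t = t" if "t \<in> T" for t using that rep_rep by (auto simp: T_def)
  have rep_mult_rep: "rep (g \<otimes> rep x) = rep (g \<otimes> x)" if gx: "g \<in> carrier G" "x \<in> carrier G" for g x
  proof -
    obtain k where k: "k \<in> K" "rep x = k \<otimes> x" using repE[OF gx(2)] by blast
    have "g \<otimes> rep x = (g \<otimes> k \<otimes> inv g) \<otimes> (g \<otimes> x)"
      using k gx Kc[OF k(1)] by (simp add: m_assoc) (simp flip: m_assoc)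
    then show ?thesis using rep_mult[OF normal[OF gx(1) k(1)], of "g \<otimes> x"] gx by simp
  qed
  have card_T: "card T = card K - 1"
  proof -
    have "bij_betw (\<lambda>c. SOME y. y \<in> c) (rcosets K) T"
    proof -
      have "K #> rep x = K #> x" if "x \<in> carrier G" for x
        using repE[OF that] coset that by metis
      then have eq: "K #> x = K #> y" if "x \<in> carrier G" "y \<in> carrier G" "rep x = rep y" for x y
        using that by metis
      have "inj_on (\<lambda>c. SOME y. y \<in> c) (rcosets K)"
      proof (rule inj_onI)
        fix A B assume "A \<in> rcosets K" "B \<in> rcosets K" and some: "(SOME y. y \<in> A) = (SOME y. y \<in> B)"
        then obtain x y where "x \<in> carrier G" "A = K #> x" "y \<in> carrier G" "B = K #> y"
          by (auto simp: RCOSETS_def)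
        then show "A = B" using eq[of x y] some by (simp add: rep_def)
      qed
      moreover have "(\<lambda>c. SOME y. y \<in> c) ` (rcosets K) = T"
        unfolding RCOSETS_def T_def rep_def by auto
      ultimately show ?thesis by (simp add: bij_betw_def)
    qed
    then have "card T = card (rcosets K)" by (simp add: bij_betw_same_card)
    moreover have "card (rcosets K) * card K = card K * (card K - 1)"
      using lagrange[OF K] card_G by (simp add: Coset.order_def)
    ultimately show ?thesis using cardK by simp
  qed
  define f where "f g t = g \<otimes> t \<otimes> inv (rep (g \<otimes> t))" for g t
  define \<phi> where "\<phi> g = finprod M (f g) T" for g
  have fK: "f g t \<in> K" if "g \<in> carrier G" "t \<in> carrier G" for g t
    unfolding f_def using rep_inv[of "g \<otimes> t"] that by simp
  have \<phi>K: "\<phi> g \<in> K" if "g \<in> carrier G" for g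
    unfolding \<phi>_def using M.finprod_closed[of "f g" T] fK[OF that] TG by (auto simp: M_simps)
  \<comment> \<open>Conjugation by g is an automorphism of K and so passes through finite
    products.\<close>
  have conj_prod: "finprod M (\<lambda>t. g \<otimes> u t \<otimes> inv g) S = g \<otimes> finprod M u S \<otimes> inv g"
    if g: "g \<in> carrier G" and S: "finite S" "u \<in> S \<rightarrow> K" for g u and S :: "'a set"
    using S
  proof (induction S)
    case empty
    show ?case using g by (simp add: M_simps)
  next
    case (insert x S)
    have u: "u \<in> S \<rightarrow> K" "u x \<in> K" using insert.prems by auto
    have P: "finprod M u S \<in> K" using M.finprod_closed[of u S] u by (simp add: M_simps)
    have "finprod M (\<lambda>t. g \<otimes> u t \<otimes> inv g) (insert x S)
      = (g \<otimes> u x \<otimes> inv g) \<otimes> finprod M (\<lambda>t. g \<otimes> u t \<otimes> inv g) S"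
      using insert.hyps u normal[OF g] by (subst M.finprod_insert) (auto simp: M_simps)
    also have "\<dots> = g \<otimes> (u x \<otimes> finprod M u S) \<otimes> inv g"
      using insert.IH[OF u(1)] conj_mult[OF g Kc[OF u(2)] Kc[OF P]] by simp
    also have "u x \<otimes> finprod M u S = finprod M u (insert x S)"
      using insert.hyps u by (subst M.finprod_insert) (auto simp: M_simps)
    finally show ?case .
  qed
  have crossed: "\<phi> (g \<otimes> h) = (g \<otimes> \<phi> h \<otimes> inv g) \<otimes> \<phi> g" if gh: "g \<in> carrier G" "h \<in> carrier G" for g h
  proof -
    \<comment> \<open>Left multiplication by h permutes the cosets of the normal subgroup K. This is
      that permutation on representatives, undone by the one for h^-1.\<close>
    define p where "p t = rep (h \<otimes> t)" for t
    have pT: "p t \<in> T" if "t \<in> T" for t unfolding p_def T_def using TG[OF that] gh by auto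
    have inj: "inj_on p T"
    proof (rule inj_onI)
      fix s t assume st: "s \<in> T" "t \<in> T" "p s = p t"
      have "rep (inv h \<otimes> rep (h \<otimes> x)) = x" if "x \<in> T" for x
        using rep_mult_rep[of "inv h" "h \<otimes> x"] rep_T[OF that] TG[OF that] gh by (simp flip: m_assoc)
      then show "s = t" using st by (metis p_def)
    qed
    then have pimg: "p ` T = T" using pT finT by (intro endo_inj_surj) auto
    \<comment> \<open>Inserting the representative of the coset of h t between h t and g makes the
      two factors telescope. Its index \<open>p t\<close> runs through T again, so the product of
      the second factors is \<phi>(g).\<close>
    have split: "f (g \<otimes> h) t = (g \<otimes> f h t \<otimes> inv g) \<otimes> f g (p t)" if t: "t \<in> T" for t
    proof -
      note tc = TG[OF t]
      have r: "rep (g \<otimes> p t) = rep (g \<otimes> h \<otimes> t)"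
        using rep_mult_rep[of g "h \<otimes> t"] gh tc by (simp add: p_def m_assoc)
      have pc: "p t \<in> carrier G" using TG[OF pT[OF t]] .
      have rc: "rep (g \<otimes> h \<otimes> t) \<in> carrier G" using rep_c gh tc by simp
      have "(g \<otimes> f h t \<otimes> inv g) \<otimes> f g (p t)
        = g \<otimes> (h \<otimes> t \<otimes> inv (p t)) \<otimes> inv g \<otimes> (g \<otimes> p t \<otimes> inv (rep (g \<otimes> h \<otimes> t)))"
        unfolding f_def r by (simp add: p_def)
      also have "\<dots> = g \<otimes> h \<otimes> t \<otimes> (inv (p t) \<otimes> ((inv g \<otimes> g) \<otimes> p t)) \<otimes> inv (rep (g \<otimes> h \<otimes> t))"
        using gh tc pc rc by (simp only: m_assoc inv_closed m_closed)
      also have "\<dots> = f (g \<otimes> h) t" unfolding f_def using gh tc pc rc by simp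
      finally show ?thesis by simp
    qed
    have "\<phi> (g \<otimes> h) = finprod M (\<lambda>t. (g \<otimes> f h t \<otimes> inv g) \<otimes>\<^bsub>M\<^esub> f g (p t)) T"
      unfolding \<phi>_def using split fK gh TG pT normal Km
      by (intro M.finprod_cong') (auto simp: M_simps)
    also have "\<dots> = finprod M (\<lambda>t. g \<otimes> f h t \<otimes> inv g) T \<otimes>\<^bsub>M\<^esub> finprod M (\<lambda>t. f g (p t)) T"
      using fK gh TG pT normal by (intro M.finprod_multf) (auto simp: M_simps)
    also have "finprod M (\<lambda>t. g \<otimes> f h t \<otimes> inv g) T = g \<otimes> \<phi> h \<otimes> inv g"
      unfolding \<phi>_def using fK gh TG by (intro conj_prod finT) auto
    also have "finprod M (\<lambda>t. f g (p t)) T = \<phi> g"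
      unfolding \<phi>_def using M.finprod_reindex[of "f g" p T] inj pimg fK gh TG by (auto simp: M_simps)
    finally show ?thesis by (simp add: M_simps)
  qed
  \<comment> \<open>For k in K each factor equals k, because k t lies in the coset of t. There are
    |K| - 1 factors, and one more k gives k^|K| = 1.\<close>
  have \<phi>_K: "\<phi> k \<otimes> k = \<one>" if k: "k \<in> K" for k
  proof -
    have "f k t = k" if "t \<in> T" for t
      unfolding f_def using rep_mult[OF k TG[OF that]] rep_T[OF that] TG[OF that] Kc[OF k]
      by (simp add: m_assoc)
    then have "\<phi> k = finprod M (\<lambda>t. k) T"
      unfolding \<phi>_def using k by (intro M.finprod_cong') (auto simp: M_simps)
    also have "\<dots> = k [^]\<^bsub>M\<^esub> (card K - 1)" using k by (subst M.finprod_const) (auto simp: M_simps card_T)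
    finally have "\<phi> k \<otimes>\<^bsub>M\<^esub> k = k [^]\<^bsub>M\<^esub> Suc (card K - 1)" by simp
    also have "\<dots> = k [^]\<^bsub>M\<^esub> Coset.order M" using cardK by (simp add: Coset.order_def M_simps)
    also have "\<dots> = \<one>" using M.pow_order_eq_1[of k] k by (simp add: M_simps)
    finally show ?thesis by (simp add: M_simps)
  qed
  define L where "L = {g \<in> carrier G. \<phi> g = \<one>}"
  have \<phi>1: "\<phi> \<one> = \<one>" using \<phi>_K[OF K1] \<phi>K[OF one_closed] Kc by simp
  have "subgroup L G"
  proof (rule subgroupI)
    show "L \<subseteq> carrier G" "L \<noteq> {}" using \<phi>1 by (auto simp: L_def)
    fix g assume "g \<in> L"
    then have g: "g \<in> carrier G" "\<phi> g = \<one>" by (auto simp: L_def)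
    have "\<phi> (g \<otimes> inv g) = g \<otimes> \<phi> (inv g) \<otimes> inv g"
      using crossed[of g "inv g"] g Kc[OF \<phi>K[of "inv g"]] by simp
    then have "g \<otimes> \<phi> (inv g) \<otimes> inv g = \<one>" using g \<phi>1 by simp
    then have "\<phi> (inv g) = \<one>" using conj_eq_iff[of g "\<phi> (inv g)" \<one>] g Kc[OF \<phi>K[of "inv g"]] by simp
    then show "inv g \<in> L" using g by (simp add: L_def)
    fix h assume "h \<in> L"
    then show "g \<otimes> h \<in> L" using crossed[of g h] g by (auto simp: L_def)
  qed
  moreover have "L \<inter> K = {\<one>}"
  proof -
    have "k = \<one>" if "k \<in> L" "k \<in> K" for k using \<phi>_K[OF that(2)] that Kc by (auto simp: L_def)
    then show ?thesis using \<phi>1 K1 by (auto simp: L_def)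
  qed
  moreover have "\<exists>k\<in>K. \<exists>l\<in>L. g = k \<otimes> l" if g: "g \<in> carrier G" for g
  proof -
    \<comment> \<open>Since K is commutative, conjugating \<phi>(g) by k = \<phi>(g) changes
      nothing, so \<phi>(k g) = k \<phi>(k) = 1. Thus k g lies in L, and k^-1 is the K-part of
      g.\<close>
    define k where "k = \<phi> g"
    have k: "k \<in> K" using \<phi>K[OF g] by (simp add: k_def)
    note kc = Kc[OF k]
    have "k \<otimes> \<phi> g \<otimes> inv k = \<phi> g" using kc by (simp add: k_def m_assoc)
    then have "\<phi> (k \<otimes> g) = k \<otimes> \<phi> k" using crossed[OF kc g] by (simp add: k_def)
    also have "\<dots> = \<one>" using \<phi>_K[OF k] comm[OF k \<phi>K[OF kc]] by simp
    finally have "k \<otimes> g \<in> L" using kc g by (simp add: L_def)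
    moreover have "g = inv k \<otimes> (k \<otimes> g)" using kc g by (simp flip: m_assoc)
    ultimately show ?thesis using Ki[OF k] by blast
  qed
  ultimately show thesis using that by blast
qed

section \<open>Near-field structure on the centralizer\<close>

text \<open>Conjugation by L is simply transitive on the nontrivial elements of K, so the orbit map
  at a carries the group structure of L over to them, with a as multiplicative identity. The left
  factor of a product acts as conjugation by its element of L, an automorphism of K; this is left
  distributivity.\<close>

lemma near_field_of_regular_complement:
  fixes a
  assumes K: "subgroup K G" and comm: "\<And>x y. x \<in> K \<Longrightarrow> y \<in> K \<Longrightarrow> x \<otimes> y = y \<otimes> x"
    and a: "a \<in> carrier G" "a \<noteq> \<one>" and centr: "centr G a = K" and K_class: "K = insert \<one> (conj_class G a)"
    and L: "subgroup L G" "L \<inter> K = {\<one>}" "\<forall>g\<in>carrier G. \<exists>k\<in>K. \<exists>l\<in>L. g = k \<otimes> l"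
  shows "\<exists>R :: 'a ring. near_field R \<and> finite (carrier R) \<and> nf_group R \<cong> G"
proof -
  have Kc: "x \<in> K \<Longrightarrow> x \<in> carrier G" for x by (rule subgroup.mem_carrier[OF K])
  have K1: "\<one> \<in> K" by (rule subgroup.one_closed[OF K])
  have Km: "x \<in> K \<Longrightarrow> y \<in> K \<Longrightarrow> x \<otimes> y \<in> K" for x y by (rule subgroup.m_closed[OF K])
  have Ki: "x \<in> K \<Longrightarrow> inv x \<in> K" for x by (rule subgroup.m_inv_closed[OF K])
  have Lc: "x \<in> L \<Longrightarrow> x \<in> carrier G" for x by (rule subgroup.mem_carrier[OF L(1)])
  have L1: "\<one> \<in> L" by (rule subgroup.one_closed[OF L(1)])
  have Lm: "x \<in> L \<Longrightarrow> y \<in> L \<Longrightarrow> x \<otimes> y \<in> L" for x y by (rule subgroup.m_closed[OF L(1)])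
  have Li: "x \<in> L \<Longrightarrow> inv x \<in> L" for x by (rule subgroup.m_inv_closed[OF L(1)])
  have aK: "a \<in> K" using self_centr[OF a(1)] centr by simp
  define c where "c l x = l \<otimes> x \<otimes> inv l" for l x
  have c_closed: "c l x \<in> carrier G" if "l \<in> carrier G" "x \<in> carrier G" for l x
    using that by (simp add: c_def)
  have c_one: "c l \<one> = \<one>" "c \<one> x = x" if "l \<in> carrier G" "x \<in> carrier G" for l x
    using that by (simp_all add: c_def)
  have c_mult: "c l (x \<otimes> y) = c l x \<otimes> c l y" if "l \<in> carrier G" "x \<in> carrier G" "y \<in> carrier G" for l x y
    unfolding c_def using conj_mult[OF that] .
  have c_c: "c l (c m x) = c (l \<otimes> m) x" if "l \<in> carrier G" "m \<in> carrier G" "x \<in> carrier G" for l m x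
    unfolding c_def using conj_conj[OF that] .
  have c_inv: "c (inv l) (c l x) = x" if "l \<in> carrier G" "x \<in> carrier G" for l x
    using c_c[of "inv l" l x] c_one(2)[of \<one> x] that by simp
  have c_ne: "c l x \<noteq> \<one>" if "l \<in> carrier G" "x \<in> carrier G" "x \<noteq> \<one>" for l x
    using c_inv[OF that(1,2)] c_one(1)[of "inv l"] that by auto
  have c_K: "c g x \<in> K" if gx: "g \<in> carrier G" "x \<in> K" for g x
  proof (cases "x = \<one>")
    case True
    then show ?thesis using K1 c_one(1)[OF gx(1) one_closed] by simp
  next
    case False
    then have "x \<in> conj_class G a" using K_class gx by auto
    moreover have "c g x \<in> conj_class G x" using gx by (auto simp: c_def conj_class_def)
    ultimately show ?thesis using K_class conj_class_trans[OF a(1)] by blast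
  qed
  \<comment> \<open>All of G is transitive on the class of a, and the K-part of g acts trivially on
    K, so its L-part alone does the conjugation.\<close>
  have ex: "\<exists>l\<in>L. c l a = x" if x: "x \<in> K" "x \<noteq> \<one>" for x
  proof -
    have "x \<in> conj_class G a" using K_class x by auto
    then obtain g where g: "g \<in> carrier G" "c g a = x" by (auto simp: conj_class_def c_def)
    obtain k l where kl: "k \<in> K" "l \<in> L" "g = k \<otimes> l" using bspec[OF L(3) g(1)] by blast
    have y: "c l a \<in> K" using c_K[OF Lc[OF kl(2)] aK] .
    have "c k (c l a) = c l a"
      using comm[OF kl(1) y] Kc[OF kl(1)] Kc[OF y] by (simp add: c_def[of k] m_assoc)
    then have "c l a = x" using c_c[OF Kc[OF kl(1)] Lc[OF kl(2)] a(1)] g(2) kl(3) by simp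
    then show ?thesis using kl(2) by blast
  qed
  \<comment> \<open>If l and m agree on a, then l^-1 m centralizes a and lies in both K and
    L.\<close>
  have unique: "l = m" if lm: "l \<in> L" "m \<in> L" "c l a = c m a" for l m
  proof -
    have lmc: "l \<in> carrier G" "m \<in> carrier G" using Lc lm by auto
    have "c (inv l \<otimes> m) a = c (inv l) (c m a)" using c_c[of "inv l" m a] lmc a by simp
    also have "\<dots> = a" using c_inv[OF lmc(1) a(1)] lm(3) by simp
    finally have "inv l \<otimes> m \<in> K" using centr_iff_conj[OF a(1), of "inv l \<otimes> m"] lmc centr by (simp add: c_def)
    then have "inv l \<otimes> m = \<one>" using L(2) Lm[OF Li[OF lm(1)] lm(2)] by blast
    then show ?thesis using lmc by (metis inv_equality inv_inv inv_closed)
  qed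
  \<comment> \<open>The inverse of the orbit map at a. At the neutral element of G its value is an
    arbitrary choice, as no conjugate of a is trivial.\<close>
  define \<eta> where "\<eta> x = (SOME l. l \<in> L \<and> c l a = x)" for x
  have \<eta>: "\<eta> x \<in> L" "c (\<eta> x) a = x" if "x \<in> K" "x \<noteq> \<one>" for x
    using someI_ex[of "\<lambda>l. l \<in> L \<and> c l a = x"] ex[OF that] by (auto simp: \<eta>_def)
  have \<eta>c: "\<eta> x \<in> carrier G" if "x \<in> K" "x \<noteq> \<one>" for x using Lc \<eta>(1)[OF that] .
  have \<eta>_eq: "\<eta> (c l a) = l" if "l \<in> L" for l
  proof -
    have "c l a \<in> K" "c l a \<noteq> \<one>" using c_K[OF Lc[OF that] aK] c_ne[OF Lc[OF that] a] by auto
    then show ?thesis using unique[OF \<eta>(1) that] \<eta>(2) by blast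
  qed
  \<comment> \<open>The neutral element of G is the zero of the near-field, so a zero left factor
    needs its own case; a zero right factor is preserved by conjugation.\<close>
  define mul where "mul x y = (if x = \<one> then \<one> else c (\<eta> x) y)" for x y
  define R :: "'a ring" where
    "R = \<lparr>carrier = K, monoid.mult = mul, one = a, ring.zero = \<one>, ring.add = monoid.mult G\<rparr>"
  have R_simps: "carrier R = K" "monoid.mult R = mul" "monoid.one R = a" "ring.zero R = \<one>" "ring.add R = monoid.mult G"
    by (simp_all add: R_def)
  have mul_K: "mul x y \<in> K" if "x \<in> K" "y \<in> K" for x y
    using c_K \<eta>c that K1 by (simp add: mul_def)
  have mul_ne: "mul x y \<noteq> \<one>" if "x \<in> K" "y \<in> K" "x \<noteq> \<one>" "y \<noteq> \<one>" for x y
    using c_ne[OF \<eta>c Kc] that by (simp add: mul_def)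
  have \<eta>_mul: "\<eta> (mul x y) = \<eta> x \<otimes> \<eta> y" if "x \<in> K" "y \<in> K" "x \<noteq> \<one>" "y \<noteq> \<one>" for x y
  proof -
    have "mul x y = c (\<eta> x) (c (\<eta> y) a)" using \<eta>(2)[of y] that by (simp add: mul_def)
    also have "\<dots> = c (\<eta> x \<otimes> \<eta> y) a" using c_c \<eta>c that a by simp
    finally show ?thesis using \<eta>_eq Lm \<eta>(1) that by simp
  qed
  have \<eta>a: "\<eta> a = \<one>" using \<eta>_eq[OF L1] c_one(2)[OF one_closed a(1)] by simp
  have "abelian_group R"
  proof (rule abelian_groupI)
    fix x assume "x \<in> carrier R"
    then show "\<exists>y\<in>carrier R. y \<oplus>\<^bsub>R\<^esub> x = \<zero>\<^bsub>R\<^esub>"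
      using Ki Kc by (intro bexI[of _ "inv x"]) (auto simp: R_simps)
  next
    fix x y assume "x \<in> carrier R" "y \<in> carrier R"
    then show "x \<oplus>\<^bsub>R\<^esub> y = y \<oplus>\<^bsub>R\<^esub> x" using comm[of x y] by (simp add: R_simps)
  qed (use Km K1 Kc in \<open>auto simp: R_simps m_assoc\<close>)
  moreover have "group \<lparr>carrier = carrier R - {\<zero>\<^bsub>R\<^esub>}, monoid.mult = monoid.mult R, one = \<one>\<^bsub>R\<^esub>\<rparr>"
    (is "group ?M")
  proof (rule groupI)
    fix x y assume "x \<in> carrier ?M" "y \<in> carrier ?M"
    then show "x \<otimes>\<^bsub>?M\<^esub> y \<in> carrier ?M" using mul_K mul_ne by (simp add: R_simps)
  next
    show "\<one>\<^bsub>?M\<^esub> \<in> carrier ?M" using aK a by (simp add: R_simps)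
  next
    fix x y z assume "x \<in> carrier ?M" "y \<in> carrier ?M" "z \<in> carrier ?M"
    then have xyz: "x \<in> K" "y \<in> K" "z \<in> K" "x \<noteq> \<one>" "y \<noteq> \<one>" "z \<noteq> \<one>" by (simp_all add: R_simps)
    have "mul (mul x y) z = c (\<eta> (mul x y)) z" using mul_ne xyz by (simp add: mul_def[of "mul x y"])
    also have "\<dots> = c (\<eta> x) (c (\<eta> y) z)" using \<eta>_mul c_c \<eta>c Kc xyz by simp
    finally show "x \<otimes>\<^bsub>?M\<^esub> y \<otimes>\<^bsub>?M\<^esub> z = x \<otimes>\<^bsub>?M\<^esub> (y \<otimes>\<^bsub>?M\<^esub> z)"
      using xyz by (simp add: R_simps mul_def)
  next
    fix x assume "x \<in> carrier ?M"
    then show "\<one>\<^bsub>?M\<^esub> \<otimes>\<^bsub>?M\<^esub> x = x" using a \<eta>a c_one(2)[OF one_closed Kc] by (simp add: R_simps mul_def)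
  next
    fix x assume "x \<in> carrier ?M"
    then have x: "x \<in> K" "x \<noteq> \<one>" by (simp_all add: R_simps)
    let ?y = "c (inv (\<eta> x)) a"
    have l: "inv (\<eta> x) \<in> L" using Li \<eta>(1)[OF x] .
    have y: "?y \<in> K" "?y \<noteq> \<one>" using c_K[OF Lc[OF l] aK] c_ne[OF Lc[OF l] a] by auto
    have "mul ?y x = c (inv (\<eta> x)) (c (\<eta> x) a)" using y \<eta>_eq[OF l] \<eta>(2)[OF x] by (simp add: mul_def)
    also have "\<dots> = a" using c_inv[OF \<eta>c[OF x] a(1)] .
    finally show "\<exists>y\<in>carrier ?M. y \<otimes>\<^bsub>?M\<^esub> x = \<one>\<^bsub>?M\<^esub>"
      using y by (intro bexI[of _ ?y]) (auto simp: R_simps)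
  qed
  moreover have "mul x (y \<otimes> z) = mul x y \<otimes> mul x z" if "x \<in> K" "y \<in> K" "z \<in> K" for x y z
    using that c_mult[OF \<eta>c] Kc by (simp add: mul_def)
  moreover have "mul x \<one> = \<one>" if "x \<in> K" for x
    using that c_one(1)[OF \<eta>c one_closed] by (simp add: mul_def)
  ultimately have nf: "near_field R"
    unfolding near_field_def using mul_K by (simp add: R_simps) (simp add: mul_def)
  have fin: "finite (carrier R)"
    using finite_subset[OF subgroup.subset[OF K] finite_carrier] by (simp add: R_simps)
  interpret N: finite_near_field R using nf fin by unfold_locales
  \<comment> \<open>A pair becomes the product of its K-part and the L-part that its second
    component stands for; the trivial intersection of K and L makes the factorization
    unique.\<close>
  define \<xi> where "\<xi> p = fst p \<otimes> \<eta> (snd p)" for p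
  have "\<xi> \<in> iso (nf_group R) G"
  proof (rule isoI)
    show "\<xi> \<in> hom (nf_group R) G"
    proof (rule homI)
      fix p assume "p \<in> carrier (nf_group R)"
      then show "\<xi> p \<in> carrier G" using Kc \<eta>c by (cases p) (auto simp: \<xi>_def R_simps)
    next
      fix p q assume pq: "p \<in> carrier (nf_group R)" "q \<in> carrier (nf_group R)"
      obtain x y u v where eq: "p = (x, y)" "q = (u, v)" by (cases p; cases q)
      have m: "x \<in> K" "u \<in> K" "y \<in> K" "y \<noteq> \<one>" "v \<in> K" "v \<noteq> \<one>" using pq by (auto simp: eq R_simps)
      have cc: "x \<in> carrier G" "u \<in> carrier G" "\<eta> y \<in> carrier G" "\<eta> v \<in> carrier G" using m Kc \<eta>c by auto
      have "\<xi> (p \<otimes>\<^bsub>nf_group R\<^esub> q) = x \<otimes> c (\<eta> y) u \<otimes> (\<eta> y \<otimes> \<eta> v)"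
        using \<eta>_mul[of y v] m by (simp add: eq \<xi>_def R_simps) (simp add: mul_def)
      also have "\<dots> = x \<otimes> (\<eta> y \<otimes> (u \<otimes> ((inv (\<eta> y) \<otimes> \<eta> y) \<otimes> \<eta> v)))"
        unfolding c_def using cc by (simp only: m_assoc inv_closed m_closed)
      also have "\<dots> = \<xi> p \<otimes> \<xi> q" using cc by (simp add: eq \<xi>_def m_assoc)
      finally show "\<xi> (p \<otimes>\<^bsub>nf_group R\<^esub> q) = \<xi> p \<otimes> \<xi> q" .
    qed
    show "bij_betw \<xi> (carrier (nf_group R)) (carrier G)"
    proof (rule bij_betwI')
      fix p assume "p \<in> carrier (nf_group R)"
      then show "\<xi> p \<in> carrier G" using Kc \<eta>c by (cases p) (auto simp: \<xi>_def R_simps)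
    next
      fix p q assume pq: "p \<in> carrier (nf_group R)" "q \<in> carrier (nf_group R)"
      obtain x y u v where eq: "p = (x, y)" "q = (u, v)" by (cases p; cases q)
      have m: "x \<in> K" "u \<in> K" "y \<in> K" "y \<noteq> \<one>" "v \<in> K" "v \<noteq> \<one>" using pq by (auto simp: eq R_simps)
      have cc: "x \<in> carrier G" "u \<in> carrier G" "\<eta> y \<in> carrier G" "\<eta> v \<in> carrier G" using m Kc \<eta>c by auto
      have "p = q" if "\<xi> p = \<xi> q"
      proof -
        have "x \<otimes> \<eta> y = u \<otimes> \<eta> v" using that by (simp add: \<xi>_def eq)
        then have "inv u \<otimes> (x \<otimes> \<eta> y) \<otimes> inv (\<eta> y) = inv u \<otimes> (u \<otimes> \<eta> v) \<otimes> inv (\<eta> y)" by simp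
        then have "(inv u \<otimes> x) \<otimes> (\<eta> y \<otimes> inv (\<eta> y)) = (inv u \<otimes> u) \<otimes> (\<eta> v \<otimes> inv (\<eta> y))"
          using cc by (simp only: m_assoc inv_closed m_closed)
        then have *: "inv u \<otimes> x = \<eta> v \<otimes> inv (\<eta> y)" using cc by simp
        have "inv u \<otimes> x \<in> K" using Km Ki m by blast
        moreover have "\<eta> v \<otimes> inv (\<eta> y) \<in> L" using Lm Li \<eta>(1) m by blast
        ultimately have **: "inv u \<otimes> x = \<one>" "\<eta> v \<otimes> inv (\<eta> y) = \<one>" using L(2) * by auto
        have "x = u" using **(1) cc by (metis inv_equality inv_inv inv_closed)
        moreover have "\<eta> v = \<eta> y" using **(2) cc by (metis inv_equality inv_inv inv_closed)
        then have "v = y" using \<eta>(2) m by metis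
        ultimately show ?thesis by (simp add: eq)
      qed
      then show "(\<xi> p = \<xi> q) = (p = q)" by blast
    next
      fix g assume "g \<in> carrier G"
      then obtain k l where kl: "k \<in> K" "l \<in> L" "g = k \<otimes> l" using L(3) by blast
      have "c l a \<in> K" "c l a \<noteq> \<one>" using c_K[OF Lc[OF kl(2)] aK] c_ne[OF Lc[OF kl(2)] a] by auto
      then show "\<exists>p\<in>carrier (nf_group R). g = \<xi> p"
        using kl \<eta>_eq[OF kl(2)] by (intro bexI[of _ "(k, c l a)"]) (auto simp: \<xi>_def R_simps)
    qed
  qed
  then have "nf_group R \<cong> G" by (auto simp: is_iso_def)
  then show ?thesis using nf fin by blast
qed

end

section \<open>Both directions assembled\<close>

theorem theorem5:
  fixes G :: "'g monoid" and R :: "'a ring"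
  shows "(group G \<and> finite (carrier G) \<and>
           (\<exists>C F. is_chargeon G C \<and> is_fluxion G F \<and> C \<noteq> F \<and>
                  modular_invariant G (transp_perm_mat C F))
          \<longrightarrow> (\<exists>H :: 'g ring. near_field H \<and> finite (carrier H) \<and> G \<cong> nf_group H))
       \<and> (near_field R \<and> finite (carrier R)
          \<longrightarrow> (\<exists>C F. is_chargeon (nf_group R) C \<and> is_fluxion (nf_group R) F \<and> C \<noteq> F \<and>
                  modular_invariant (nf_group R) (transp_perm_mat C F)))"
proof (intro conjI impI)
  assume "group G \<and> finite (carrier G) \<and>
    (\<exists>C F. is_chargeon G C \<and> is_fluxion G F \<and> C \<noteq> F \<and> modular_invariant G (transp_perm_mat C F))"
  then obtain C F where G: "group G" "finite (carrier G)"
    and CF: "is_chargeon G C" "is_fluxion G F" "C \<noteq> F" "modular_invariant G (transp_perm_mat C F)"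
    by blast
  interpret finite_grp G using G by (simp add: finite_grp_def finite_grp_axioms_def)
  obtain a where a: "a \<in> carrier G" "a \<noteq> \<one>\<^bsub>G\<^esub>" and K_eq: "centr G a = insert \<one>\<^bsub>G\<^esub> (conj_class G a)"
    using transposition_class_centralizer[OF CF] by blast
  define K where "K = centr G a"
  have K: "subgroup K G" unfolding K_def by (rule centr_subgroup[OF a(1)])
  have K_class: "K = insert \<one>\<^bsub>G\<^esub> (conj_class G a)" using K_eq by (simp add: K_def)
  \<comment> \<open>K is a union of two conjugacy classes.\<close>
  have normal: "g \<otimes>\<^bsub>G\<^esub> k \<otimes>\<^bsub>G\<^esub> inv\<^bsub>G\<^esub> g \<in> K" if g: "g \<in> carrier G" and k: "k \<in> K" for g k
  proof (cases "k = \<one>\<^bsub>G\<^esub>")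
    case True
    then show ?thesis using g K_class by simp
  next
    case False
    then have "k \<in> conj_class G a" using K_class k by blast
    moreover have "g \<otimes>\<^bsub>G\<^esub> k \<otimes>\<^bsub>G\<^esub> inv\<^bsub>G\<^esub> g \<in> conj_class G k" using g by (auto simp: conj_class_def)
    ultimately show ?thesis using K_class conj_class_trans[OF a(1)] by blast
  qed
  \<comment> \<open>A nontrivial x is g a g^-1 for some g. Normality puts the conjugate w = g^-1 y g
    into K, the centralizer of a, and conjugating back by g turns w a = a w into the claim.\<close>
  have comm: "x \<otimes>\<^bsub>G\<^esub> y = y \<otimes>\<^bsub>G\<^esub> x" if x: "x \<in> K" and y: "y \<in> K" for x y
  proof (cases "x = \<one>\<^bsub>G\<^esub>")
    case True
    then show ?thesis using subgroup.mem_carrier[OF K y] by simp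
  next
    case False
    then have "x \<in> conj_class G a" using K_class x by blast
    then obtain g where g: "g \<in> carrier G" "x = g \<otimes>\<^bsub>G\<^esub> a \<otimes>\<^bsub>G\<^esub> inv\<^bsub>G\<^esub> g" by (auto simp: conj_class_def)
    define w where "w = inv\<^bsub>G\<^esub> g \<otimes>\<^bsub>G\<^esub> y \<otimes>\<^bsub>G\<^esub> g"
    have yc: "y \<in> carrier G" by (rule subgroup.mem_carrier[OF K y])
    have "w \<in> K" unfolding w_def using normal[of "inv\<^bsub>G\<^esub> g" y] g y by simp
    then have wa: "w \<in> carrier G" "w \<otimes>\<^bsub>G\<^esub> a = a \<otimes>\<^bsub>G\<^esub> w" by (auto simp: K_def centr_def)
    have "y = g \<otimes>\<^bsub>G\<^esub> w \<otimes>\<^bsub>G\<^esub> inv\<^bsub>G\<^esub> g" unfolding w_def using conj_cancel(1)[OF g(1) yc] by simp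
    then show ?thesis using g(2) wa conj_mult[OF g(1) a(1) wa(1)] conj_mult[OF g(1) wa(1) a(1)] by simp
  qed
  have "\<one>\<^bsub>G\<^esub> \<notin> conj_class G a" by (rule one_notin_conj_class[OF a])
  moreover have "finite (conj_class G a)"
    using conj_class_closed[OF a(1)] finite_carrier finite_subset by blast
  ultimately have "card (conj_class G a) = card K - 1" by (simp add: K_class)
  then have card_G: "card (carrier G) = card K * (card K - 1)"
    using card_conj_class[OF a(1)] by (simp add: K_def mult.commute)
  obtain L where L: "subgroup L G" "L \<inter> K = {\<one>\<^bsub>G\<^esub>}"
    "\<forall>g\<in>carrier G. \<exists>k\<in>K. \<exists>l\<in>L. g = k \<otimes>\<^bsub>G\<^esub> l"
    by (rule abelian_normal_complement[OF K normal comm card_G])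
  obtain H :: "'g ring" where H: "near_field H" "finite (carrier H)" "nf_group H \<cong> G"
    using near_field_of_regular_complement[OF K comm a K_def[symmetric] K_class L] by blast
  have "finite_near_field H" using H by unfold_locales
  then have "group (nf_group H)" by (rule finite_near_field.nf_group_group)
  then have "G \<cong> nf_group H" using H(3) group.iso_sym by blast
  then show "\<exists>H :: 'g ring. near_field H \<and> finite (carrier H) \<and> G \<cong> nf_group H" using H by blast
next
  assume "near_field R \<and> finite (carrier R)"
  then have "finite_near_field R" by unfold_locales auto
  then show "\<exists>C F. is_chargeon (nf_group R) C \<and> is_fluxion (nf_group R) F \<and> C \<noteq> F \<and>
    modular_invariant (nf_group R) (transp_perm_mat C F)"
    by (rule finite_near_field.nf_group_modular_invariant)
qed

end
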